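(* Let $(\mathfrak A,\alpha,\omega)$ be a $C^*$-dynamical system such that the support $s(\omega)$ of $\omega$ in the bidual $\mathfrak A^{**}$ is central, i.e. $s(\omega)\in Z(\mathfrak A^{**})$. Fix integers $k_1,k_2$ with $k_1\neq 0$, $k_2\neq 0$, $k_1\neq k_2$, and suppose that $\omega$ is ergodic with respect to the action $\{\alpha^{n(k_2-k_1)}\mid n\in\mathbb Z\}$. Then for all $A_0,A_1,A_2\in\mathfrak A$, $$\lim_{N\to+\infty}\frac1N\sum_{n=0}^{N-1}\omega\left(A_0\alpha^{nk_1}(A_1)\alpha^{nk_2}(A_2)\right)=\left\langle V\left(\pi_\omega(A_1)\Omega\otimes\pi_\omega(A_2)\Omega\right),\pi_\omega(A_0^* )\Omega\right\rangle,$$ where $V:\mathcal H_\omega\otimes\mathcal H_\omega\to\mathcal H_\omega$ is the partial isometry associated to $(k_1,k_2)$ defined in the context.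
   Context: A (discrete) $C^*$-dynamical system $(\mathfrak A,\alpha,\omega)$ consists of a unital $C^*$-algebra $\mathfrak A$, a $*$-automorphism $\alpha$ of $\mathfrak A$, and a state $\omega$ with $\omega\circ\alpha=\omega$. Inner products are linear in the first variable. $(\mathcal H_\omega,\pi_\omega,U_\omega,\Omega)$ is the covariant GNS representation: $\omega(A)=\langle\pi_\omega(A)\Omega,\Omega\rangle$, $U_\omega$ unitary, $U_\omega\Omega=\Omega$, $U_\omega\pi_\omega(A)U_\omega^*=\pi_\omega(\alpha(A))$. $Z(\cdot)$ denotes the centre. The condition $s(\omega)\in Z(\mathfrak A^{**})$ is equivalent to $\Omega$ being separating for $\pi_\omega(\mathfrak A)''$. Write $M=\pi_\omega(\mathfrak A)''$, $M'=\pi_\omega(\mathfrak A)'$. $\omega$ is ergodic for an automorphism $\beta$ leaving it invariant if it is an extreme point of the convex set of $\beta$-invariant states; when $s(\omega)$ is central this is equivalent to the implementing unitary having one-dimensional space of fixed vectors. $\sigma_{\rm pp}(U)$ denotes the set of eigenvalues of a unitary $U$. If $s(\omega)\in Z(\mathfrak A^{**})$, $k_1,k_2$ are integers with $k_1\neq 0$, $k_2\neq 0$, $k_1\neq k_2$, and $\omega$ is ergodic with respect to the action $\{\alpha^{n(k_2-k_1)}\mid n\in\mathbb Z\}$, it is known that for each $v\in\sigma_{\rm pp}(U_\omega)$ the eigenspace of $U_\omega$ for $v$ is one-dimensional, equal to $\mathbb C V_v\Omega=\mathbb C W_v\Omega$ for unitaries $V_v\in M$, $W_v\in M'$, each unique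 up to a phase, with $U_\omega V_vU_\omega^*=vV_v$, $U_\omega W_vU_\omega^*=vW_v$. Set $$\Sigma(k_1,k_2)=\{(v,w)\in\sigma_{\rm pp}(U_\omega)\times\sigma_{\rm pp}(U_\omega): v^{k_1}w^{k_2}=1\}.$$ The partial isometry $V$ is given by the strongly convergent sum $$V=\sum_{(v,w)\in\Sigma(k_1,k_2)}\langle\,\cdot\,,V_v\Omega\otimes W_w\Omega\rangle\,V_vW_w\Omega .$$ *)

theory Defs
  imports "HOL-Analysis.Analysis"
begin

section \<open>Complex normed spaces, Hilbert spaces and unital C*-algebras\<close>

class complex_normed_vector = real_normed_vector +
  fixes scaleC :: "complex \<Rightarrow> 'a \<Rightarrow> 'a" (infixr \<open>*\<^sub>C\<close> 75)
  assumes scaleC_add_right: "c *\<^sub>C (x + y) = c *\<^sub>C x + c *\<^sub>C y"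
    and scaleC_add_left: "(c + d) *\<^sub>C x = c *\<^sub>C x + d *\<^sub>C x"
    and scaleC_scaleC: "c *\<^sub>C d *\<^sub>C x = (c * d) *\<^sub>C x"
    and scaleR_scaleC: "r *\<^sub>R x = complex_of_real r *\<^sub>C x"
    and norm_scaleC: "norm (c *\<^sub>C x) = cmod c * norm x"

text \<open>The inner product is linear in the first variable. The class \<open>real_inner\<close>
  only supplies the real part of the inner product and the norm defined by it.\<close>

class complex_hilbert = complex_normed_vector + real_inner + banach +
  fixes cinner :: "'a \<Rightarrow> 'a \<Rightarrow> complex"
  assumes cinner_add_left: "cinner (x + y) z = cinner x z + cinner y z"
    and cinner_scaleC_left: "cinner (c *\<^sub>C x) y = c * cinner x y"
    and cinner_commute: "cinner x y = cnj (cinner y x)"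
    and inner_eq_Re_cinner: "inner x y = Re (cinner x y)"

class unital_cstar_algebra = complex_normed_vector + real_normed_algebra_1 + banach +
  fixes star :: "'a \<Rightarrow> 'a" (\<open>_\<^sup>\<star>\<close> [1000] 999)
  assumes mult_scaleC_left: "(c *\<^sub>C x) * y = c *\<^sub>C (x * y)"
    and mult_scaleC_right: "x * (c *\<^sub>C y) = c *\<^sub>C (x * y)"
    and star_star: "(x\<^sup>\<star>)\<^sup>\<star> = x"
    and star_add: "(x + y)\<^sup>\<star> = x\<^sup>\<star> + y\<^sup>\<star>"
    and star_scaleC: "(c *\<^sub>C x)\<^sup>\<star> = cnj c *\<^sub>C x\<^sup>\<star>"
    and star_mult: "(x * y)\<^sup>\<star> = y\<^sup>\<star> * x\<^sup>\<star>"
    and cstar_identity: "norm (x\<^sup>\<star> * x) = (norm x)\<^sup>2"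

instantiation complex :: complex_normed_vector
begin
definition "scaleC (c::complex) (x::complex) = c * x"
instance
  by standard (auto simp: scaleC_complex_def algebra_simps scaleR_conv_of_real norm_mult)
end

lemma norm_star: "norm (x\<^sup>\<star>) = norm (x::'a::unital_cstar_algebra)"
proof -
  have *: "norm y \<le> norm (y\<^sup>\<star>)" for y :: 'a
  proof (cases "y = 0")
    case False
    have "norm y * norm y \<le> norm (y\<^sup>\<star>) * norm y"
      using cstar_identity[of y] norm_mult_ineq[of "y\<^sup>\<star>" y] by (simp add: power2_eq_square)
    then show ?thesis using False by simp
  qed simp
  show ?thesis using *[of x] *[of "x\<^sup>\<star>"] by (simp add: star_star)
qed

section \<open>Bounded complex-linear maps\<close>

definition bounded_clinear ::
    "('a::complex_normed_vector \<Rightarrow> 'b::complex_normed_vector) \<Rightarrow> bool" where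
  "bounded_clinear f \<longleftrightarrow> bounded_linear f \<and> (\<forall>c x. f (c *\<^sub>C x) = c *\<^sub>C f x)"

lemma bounded_clinearI:
  assumes "\<And>x y. f (x + y) = f x + f y" "\<And>c x. f (c *\<^sub>C x) = c *\<^sub>C f x"
    "\<And>x. norm (f x) \<le> norm x * K"
  shows "bounded_clinear f"
  unfolding bounded_clinear_def using assms
  by (auto intro!: bounded_linear_intro[where K = K] simp: scaleR_scaleC)

lemma scaleC_zero_right: "c *\<^sub>C (0::'a::complex_normed_vector) = 0"
  using norm_scaleC[of c "0::'a"] by simp

lemma bounded_clinear_zero: "bounded_clinear (\<lambda>_. 0)"
  by (rule bounded_clinearI[where K = 0]) (auto simp: scaleC_zero_right)

typedef (overloaded) ('a, 'b) cblinfun (\<open>(_ \<Rightarrow>\<^sub>C\<^sub>L /_)\<close> [22, 21] 21) =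
  "{f :: 'a::complex_normed_vector \<Rightarrow> 'b::complex_normed_vector. bounded_clinear f}"
  morphisms cblinfun_apply Cblinfun
  using bounded_clinear_zero by blast

declare [[coercion cblinfun_apply]]

setup_lifting type_definition_cblinfun

lemma bounded_clinear_apply: "bounded_clinear (cblinfun_apply f)"
  using cblinfun_apply by auto

lemma bounded_linear_apply: "bounded_linear (cblinfun_apply f)"
  using bounded_clinear_apply bounded_clinear_def by blast

lemma cblinfun_eqI: "(\<And>x. cblinfun_apply f x = cblinfun_apply g x) \<Longrightarrow> f = g"
  by transfer auto

lemma cblinfun_add_right: "cblinfun_apply f (x + y) = cblinfun_apply f x + cblinfun_apply f y"
  by (rule linear_simps(1)[OF bounded_linear_apply])

lemma cblinfun_scaleC_right: "cblinfun_apply f (c *\<^sub>C x) = c *\<^sub>C cblinfun_apply f x"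
  using bounded_clinear_apply bounded_clinear_def by blast

instantiation cblinfun :: (complex_normed_vector, complex_normed_vector) complex_normed_vector
begin

lift_definition norm_cblinfun :: "'a \<Rightarrow>\<^sub>C\<^sub>L 'b \<Rightarrow> real" is onorm .

lift_definition zero_cblinfun :: "'a \<Rightarrow>\<^sub>C\<^sub>L 'b" is "\<lambda>_. 0"
  by (rule bounded_clinear_zero)

lift_definition plus_cblinfun :: "'a \<Rightarrow>\<^sub>C\<^sub>L 'b \<Rightarrow> 'a \<Rightarrow>\<^sub>C\<^sub>L 'b \<Rightarrow> 'a \<Rightarrow>\<^sub>C\<^sub>L 'b" is "\<lambda>f g x. f x + g x"
  by (simp add: bounded_clinear_def bounded_linear_add scaleC_add_right)

lift_definition scaleC_cblinfun :: "complex \<Rightarrow> 'a \<Rightarrow>\<^sub>C\<^sub>L 'b \<Rightarrow> 'a \<Rightarrow>\<^sub>C\<^sub>L 'b" is "\<lambda>c f x. c *\<^sub>C f x"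
proof -
  fix c and f :: "'a \<Rightarrow> 'b" assume f: "bounded_clinear f"
  then obtain K where "\<And>x. norm (f x) \<le> norm x * K"
    using bounded_linear.bounded unfolding bounded_clinear_def by blast
  then have "norm (c *\<^sub>C f x) \<le> norm x * (cmod c * K)" for x
    using mult_left_mono[of "norm (f x)" "norm x * K" "cmod c"] by (simp add: norm_scaleC ac_simps)
  moreover have "f (x + y) = f x + f y" "f (d *\<^sub>C x) = d *\<^sub>C f x" for x y d
    using f linear_simps(1) unfolding bounded_clinear_def by blast+
  ultimately show "bounded_clinear (\<lambda>x. c *\<^sub>C f x)"
    by (intro bounded_clinearI[where K = "cmod c * K"])
      (auto simp: scaleC_add_right scaleC_scaleC mult.commute)
qed

definition "scaleR_cblinfun r f = complex_of_real r *\<^sub>C (f :: 'a \<Rightarrow>\<^sub>C\<^sub>L 'b)"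
definition "uminus_cblinfun f = (-1 :: real) *\<^sub>R (f :: 'a \<Rightarrow>\<^sub>C\<^sub>L 'b)"
definition "minus_cblinfun f g = f + - (g :: 'a \<Rightarrow>\<^sub>C\<^sub>L 'b)"
definition "dist_cblinfun f g = norm (f - (g :: 'a \<Rightarrow>\<^sub>C\<^sub>L 'b))"
definition "sgn_cblinfun f = inverse (norm f) *\<^sub>R (f :: 'a \<Rightarrow>\<^sub>C\<^sub>L 'b)"
definition [code del]:
  "(uniformity :: (('a \<Rightarrow>\<^sub>C\<^sub>L 'b) \<times> ('a \<Rightarrow>\<^sub>C\<^sub>L 'b)) filter) = (INF e\<in>{0 <..}. principal {(x, y). dist x y < e})"
definition open_cblinfun :: "('a \<Rightarrow>\<^sub>C\<^sub>L 'b) set \<Rightarrow> bool" where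
  [code del]: "open_cblinfun S = (\<forall>x\<in>S. \<forall>\<^sub>F (x', y) in uniformity. x' = x \<longrightarrow> y \<in> S)"

lemma scaleR_cblinfun_apply: "cblinfun_apply (r *\<^sub>R f) x = r *\<^sub>R cblinfun_apply f x"
  unfolding scaleR_cblinfun_def by transfer (simp add: scaleR_scaleC)

lemma uminus_cblinfun_apply: "cblinfun_apply (- f) x = - cblinfun_apply f x"
  unfolding uminus_cblinfun_def by (simp add: scaleR_cblinfun_apply)

instance
proof
  fix f g h :: "'a \<Rightarrow>\<^sub>C\<^sub>L 'b" and r s :: real and c d :: complex
  show "f + g + h = f + (g + h)" "f + g = g + f" "0 + f = f"
    by (auto intro!: cblinfun_eqI simp: plus_cblinfun.rep_eq zero_cblinfun.rep_eq)
  show "- f + f = 0"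
    by (rule cblinfun_eqI) (simp add: plus_cblinfun.rep_eq zero_cblinfun.rep_eq uminus_cblinfun_apply)
  show "f - g = f + - g" by (simp add: minus_cblinfun_def)
  show "dist f g = norm (f - g)" by (simp add: dist_cblinfun_def)
  show "sgn f = inverse (norm f) *\<^sub>R f" by (simp add: sgn_cblinfun_def)
  show "r *\<^sub>R (f + g) = r *\<^sub>R f + r *\<^sub>R g" "(r + s) *\<^sub>R f = r *\<^sub>R f + s *\<^sub>R f"
    "r *\<^sub>R s *\<^sub>R f = (r * s) *\<^sub>R f" "1 *\<^sub>R f = f"
    by (auto intro!: cblinfun_eqI simp: plus_cblinfun.rep_eq scaleR_cblinfun_apply algebra_simps)
  show "c *\<^sub>C (f + g) = c *\<^sub>C f + c *\<^sub>C g" "(c + d) *\<^sub>C f = c *\<^sub>C f + d *\<^sub>C f"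
    "c *\<^sub>C d *\<^sub>C f = (c * d) *\<^sub>C f"
    by (auto intro!: cblinfun_eqI simp: plus_cblinfun.rep_eq scaleC_cblinfun.rep_eq
        scaleC_add_right scaleC_add_left scaleC_scaleC)
  show "r *\<^sub>R f = complex_of_real r *\<^sub>C f" by (simp add: scaleR_cblinfun_def)
  show "norm f = 0 \<longleftrightarrow> f = 0"
    using onorm_eq_0[OF bounded_linear_apply[of f]]
    by (auto simp: norm_cblinfun.rep_eq zero_cblinfun.rep_eq intro: cblinfun_eqI)
  show "norm (f + g) \<le> norm f + norm g"
    using onorm_triangle[OF bounded_linear_apply[of f] bounded_linear_apply[of g]]
    by (simp add: norm_cblinfun.rep_eq plus_cblinfun.rep_eq)
  have le: "norm (c *\<^sub>C f) \<le> cmod c * norm f" for c and f :: "'a \<Rightarrow>\<^sub>C\<^sub>L 'b"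
    unfolding norm_cblinfun.rep_eq scaleC_cblinfun.rep_eq
  proof (rule onorm_bound)
    show "0 \<le> cmod c * onorm (cblinfun_apply f)"
      by (simp add: onorm_pos_le[OF bounded_linear_apply])
    show "norm (c *\<^sub>C cblinfun_apply f x) \<le> cmod c * onorm (cblinfun_apply f) * norm x" for x
      using mult_left_mono[OF onorm[OF bounded_linear_apply[of f], of x] norm_ge_zero[of c]]
      by (simp add: norm_scaleC mult.assoc)
  qed
  show nC: "norm (c *\<^sub>C f) = cmod c * norm f" for c and f :: "'a \<Rightarrow>\<^sub>C\<^sub>L 'b"
  proof (cases "c = 0")
    case True
    then show ?thesis using le[of 0 f] onorm_pos_le[OF bounded_linear_apply[of "0 *\<^sub>C f"]]
      by (simp add: norm_cblinfun.rep_eq)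
  next
    case False
    have "1 *\<^sub>C f = f"
      using scaleR_cblinfun_apply[of 1 f] unfolding scaleR_cblinfun_def by (auto intro: cblinfun_eqI)
    moreover have "inverse c *\<^sub>C c *\<^sub>C f = (inverse c * c) *\<^sub>C f"
      by (auto intro!: cblinfun_eqI simp: scaleC_cblinfun.rep_eq scaleC_scaleC)
    ultimately have "norm f \<le> cmod (inverse c) * norm (c *\<^sub>C f)"
      using le[of "inverse c" "c *\<^sub>C f"] False by simp
    then have "cmod c * norm f \<le> norm (c *\<^sub>C f)"
      using False by (simp add: norm_inverse norm_divide field_simps)
    then show ?thesis using le[of c f] by simp
  qed
  show "norm (r *\<^sub>R f) = \<bar>r\<bar> * norm f"
    unfolding scaleR_cblinfun_def by (simp add: nC)
qed (simp_all add: uniformity_cblinfun_def open_cblinfun_def)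

end

lemma norm_cblinfun_apply_le: "norm (cblinfun_apply f x) \<le> norm x * norm f"
  using onorm[OF bounded_linear_apply[of f], of x] by (simp add: norm_cblinfun.rep_eq mult.commute)

lift_definition cblinfun_id :: "'a::complex_normed_vector \<Rightarrow>\<^sub>C\<^sub>L 'a" is "\<lambda>x. x"
  by (simp add: bounded_clinear_def)

lift_definition cblinfun_compose ::
    "'b::complex_normed_vector \<Rightarrow>\<^sub>C\<^sub>L 'c::complex_normed_vector \<Rightarrow> 'a::complex_normed_vector \<Rightarrow>\<^sub>C\<^sub>L 'b
      \<Rightarrow> 'a \<Rightarrow>\<^sub>C\<^sub>L 'c" (infixl \<open>o\<^sub>C\<close> 67) is "\<lambda>f g x. f (g x)"
  by (simp add: bounded_clinear_def bounded_linear_compose)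

section \<open>Operators on a Hilbert space\<close>

text \<open>The adjoint exists and is unique by the Riesz representation theorem.\<close>

definition cadjoint :: "'h::complex_hilbert \<Rightarrow>\<^sub>C\<^sub>L 'h \<Rightarrow> 'h \<Rightarrow>\<^sub>C\<^sub>L 'h" (\<open>_\<^sup>\<dagger>\<close> [1000] 999) where
  "T\<^sup>\<dagger> = (THE S :: 'h \<Rightarrow>\<^sub>C\<^sub>L 'h. \<forall>x y. cinner (T x) y = cinner x (S y))"

definition unitary :: "'h::complex_hilbert \<Rightarrow>\<^sub>C\<^sub>L 'h \<Rightarrow> bool" where
  "unitary T \<longleftrightarrow> T\<^sup>\<dagger> o\<^sub>C T = cblinfun_id \<and> T o\<^sub>C T\<^sup>\<dagger> = cblinfun_id"

definition commutant :: "('h::complex_hilbert \<Rightarrow>\<^sub>C\<^sub>L 'h) set \<Rightarrow> ('h \<Rightarrow>\<^sub>C\<^sub>L 'h) set" where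
  "commutant S = {T. \<forall>X\<in>S. T o\<^sub>C X = X o\<^sub>C T}"

definition eigenspace :: "'h::complex_hilbert \<Rightarrow>\<^sub>C\<^sub>L 'h \<Rightarrow> complex \<Rightarrow> 'h set" where
  "eigenspace T v = {x. T x = v *\<^sub>C x}"

definition point_spectrum :: "'h::complex_hilbert \<Rightarrow>\<^sub>C\<^sub>L 'h \<Rightarrow> complex set" where
  "point_spectrum T = {v. \<exists>x. x \<noteq> 0 \<and> T x = v *\<^sub>C x}"

text \<open>Hilbert space tensor products, determined up to a unique unitary compatible with
  elementary tensors; every complex Hilbert space \<open>'c\<close> with such a map is admitted.
  The real span below is already the complex span, as the elementary tensors are closed
  under complex multiples.\<close>

definition hilbert_tensor_product ::
    "('a::complex_hilbert \<Rightarrow> 'b::complex_hilbert \<Rightarrow> 'c::complex_hilbert) \<Rightarrow> bool" where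
  "hilbert_tensor_product tens \<longleftrightarrow>
     (\<forall>x x' y. tens (x + x') y = tens x y + tens x' y) \<and>
     (\<forall>x y y'. tens x (y + y') = tens x y + tens x y') \<and>
     (\<forall>c x y. tens (c *\<^sub>C x) y = c *\<^sub>C tens x y \<and> tens x (c *\<^sub>C y) = c *\<^sub>C tens x y) \<and>
     (\<forall>x y x' y'. cinner (tens x y) (tens x' y') = cinner x x' * cinner y y') \<and>
     closure (span {tens x y | x y. True}) = UNIV"

section \<open>The bidual of a C*-algebra\<close>

text \<open>The Arens product on \<open>A**\<close>, built in three stages:
  \<open>(\<phi>\<cdot>a)(b) = \<phi>(ab)\<close>, \<open>(G\<cdot>\<phi>)(a) = G(\<phi>\<cdot>a)\<close>, \<open>(FG)(\<phi>) = F(G\<cdot>\<phi>)\<close>.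
  For C*-algebras the two Arens products agree, and this is the product of the
  enveloping von Neumann algebra.\<close>

type_synonym 'a cdual = "'a \<Rightarrow>\<^sub>C\<^sub>L complex"
type_synonym 'a cbidual = "'a cdual \<Rightarrow>\<^sub>C\<^sub>L complex"

definition dual_act :: "'a::unital_cstar_algebra cdual \<Rightarrow> 'a \<Rightarrow> 'a cdual" where
  "dual_act \<phi> a = Cblinfun (\<lambda>b. \<phi> (a * b))"

definition bidual_act :: "'a::unital_cstar_algebra cbidual \<Rightarrow> 'a cdual \<Rightarrow> 'a cdual" where
  "bidual_act G \<phi> = Cblinfun (\<lambda>a. G (dual_act \<phi> a))"

definition arens :: "'a::unital_cstar_algebra cbidual \<Rightarrow> 'a cbidual \<Rightarrow> 'a cbidual"
    (infixl \<open>\<box>\<close> 70) where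
  "F \<box> G = Cblinfun (\<lambda>\<phi>. F (bidual_act G \<phi>))"

definition dual_star :: "'a::unital_cstar_algebra cdual \<Rightarrow> 'a cdual" where
  "dual_star \<phi> = Cblinfun (\<lambda>a. cnj (\<phi> (a\<^sup>\<star>)))"

definition bidual_star :: "'a::unital_cstar_algebra cbidual \<Rightarrow> 'a cbidual" where
  "bidual_star F = Cblinfun (\<lambda>\<phi>. cnj (F (dual_star \<phi>)))"

definition bidual_one :: "'a::unital_cstar_algebra cbidual" where
  "bidual_one = Cblinfun (\<lambda>\<phi>. cblinfun_apply \<phi> 1)"

text \<open>The functions passed to \<open>Cblinfun\<close> above are bounded and complex linear,
  so the definitions mean what they say.\<close>

lemma norm_cblinfun_le:
  assumes "\<And>x. norm (cblinfun_apply f x) \<le> norm x * K" "0 \<le> K"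
  shows "norm f \<le> K"
  unfolding norm_cblinfun.rep_eq
  by (rule onorm_bound) (use assms in \<open>auto simp: mult.commute\<close>)

lemma dual_act_bound:
  fixes a b :: "'a::unital_cstar_algebra"
  shows "norm (cblinfun_apply \<phi> (a * b)) \<le> norm b * (norm a * norm \<phi>)"
proof -
  have "norm (cblinfun_apply \<phi> (a * b)) \<le> norm (a * b) * norm \<phi>"
    by (rule norm_cblinfun_apply_le)
  also have "\<dots> \<le> (norm a * norm b) * norm \<phi>"
    by (intro mult_right_mono norm_mult_ineq) simp
  finally show ?thesis by (simp add: ac_simps)
qed

lemma dual_act_apply: "dual_act \<phi> a b = \<phi> (a * b)"
proof -
  have "bounded_clinear (\<lambda>b. \<phi> (a * b))"
    by (rule bounded_clinearI[OF _ _ dual_act_bound])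
      (auto simp: distrib_left cblinfun_add_right mult_scaleC_right cblinfun_scaleC_right)
  then show ?thesis by (simp add: dual_act_def Cblinfun_inverse)
qed

lemma norm_dual_act: "norm (dual_act \<phi> a) \<le> norm a * norm \<phi>"
  by (rule norm_cblinfun_le) (auto simp: dual_act_apply dual_act_bound)

lemma dual_act_linear:
  "dual_act \<phi> (a + b) = dual_act \<phi> a + dual_act \<phi> b"
  "dual_act \<phi> (c *\<^sub>C a) = c *\<^sub>C dual_act \<phi> a"
  "dual_act (\<phi> + \<psi>) a = dual_act \<phi> a + dual_act \<psi> a"
  "dual_act (c *\<^sub>C \<phi>) a = c *\<^sub>C dual_act \<phi> a"
  by (auto intro!: cblinfun_eqI simp: dual_act_apply plus_cblinfun.rep_eq scaleC_cblinfun.rep_eq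
      distrib_right cblinfun_add_right mult_scaleC_left cblinfun_scaleC_right)

lemma bidual_act_bound: "norm (cblinfun_apply G (dual_act \<phi> a)) \<le> norm a * (norm \<phi> * norm G)"
  using norm_cblinfun_apply_le[of G "dual_act \<phi> a"]
    mult_right_mono[OF norm_dual_act[of \<phi> a] norm_ge_zero[of G]] by (simp add: ac_simps)

lemma bidual_act_apply: "bidual_act G \<phi> a = G (dual_act \<phi> a)"
proof -
  have "bounded_clinear (\<lambda>a. G (dual_act \<phi> a))"
    by (rule bounded_clinearI[OF _ _ bidual_act_bound])
      (auto simp: dual_act_linear cblinfun_add_right cblinfun_scaleC_right)
  then show ?thesis by (simp add: bidual_act_def Cblinfun_inverse)
qed

lemma norm_bidual_act: "norm (bidual_act G \<phi>) \<le> norm \<phi> * norm G"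
  by (rule norm_cblinfun_le) (auto simp: bidual_act_apply bidual_act_bound)

lemma bidual_act_linear:
  "bidual_act G (\<phi> + \<psi>) = bidual_act G \<phi> + bidual_act G \<psi>"
  "bidual_act G (c *\<^sub>C \<phi>) = c *\<^sub>C bidual_act G \<phi>"
  by (auto intro!: cblinfun_eqI simp: bidual_act_apply dual_act_linear plus_cblinfun.rep_eq
      scaleC_cblinfun.rep_eq cblinfun_add_right cblinfun_scaleC_right)

lemma arens_apply: "(F \<box> G) \<phi> = F (bidual_act G \<phi>)"
proof -
  have "norm (cblinfun_apply F (bidual_act G \<phi>)) \<le> norm \<phi> * (norm G * norm F)" for \<phi>
    using norm_cblinfun_apply_le[of F "bidual_act G \<phi>"]
      mult_right_mono[OF norm_bidual_act[of G \<phi>] norm_ge_zero[of F]] by (simp add: ac_simps)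
  then have "bounded_clinear (\<lambda>\<phi>. F (bidual_act G \<phi>))"
    by (intro bounded_clinearI[where K = "norm G * norm F"])
      (auto simp: bidual_act_linear cblinfun_add_right cblinfun_scaleC_right)
  then show ?thesis by (simp add: arens_def Cblinfun_inverse)
qed

lemma dual_star_apply: "dual_star \<phi> a = cnj (\<phi> (a\<^sup>\<star>))"
proof -
  have "norm (cnj (cblinfun_apply \<phi> (a\<^sup>\<star>))) \<le> norm a * norm \<phi>" for a
    using norm_cblinfun_apply_le[of \<phi> "a\<^sup>\<star>"] by (simp add: norm_star)
  then have "bounded_clinear (\<lambda>a. cnj (\<phi> (a\<^sup>\<star>)))"
    by (intro bounded_clinearI[where K = "norm \<phi>"])
      (auto simp: star_add star_scaleC cblinfun_add_right cblinfun_scaleC_right scaleC_complex_def)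
  then show ?thesis by (simp add: dual_star_def Cblinfun_inverse)
qed

lemma norm_dual_star: "norm (dual_star \<phi>) \<le> norm \<phi>"
  by (rule norm_cblinfun_le)
    (use norm_cblinfun_apply_le[of \<phi> "_\<^sup>\<star>"] in \<open>auto simp: dual_star_apply norm_star\<close>)

lemma dual_star_linear:
  "dual_star (\<phi> + \<psi>) = dual_star \<phi> + dual_star \<psi>"
  "dual_star (c *\<^sub>C \<phi>) = cnj c *\<^sub>C dual_star \<phi>"
  by (auto intro!: cblinfun_eqI simp: dual_star_apply plus_cblinfun.rep_eq
      scaleC_cblinfun.rep_eq scaleC_complex_def)

lemma bidual_star_apply: "bidual_star F \<phi> = cnj (F (dual_star \<phi>))"
proof -
  have "norm (cblinfun_apply F (dual_star \<phi>)) \<le> norm \<phi> * norm F" for \<phi>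
    using norm_cblinfun_apply_le[of F "dual_star \<phi>"]
      mult_right_mono[OF norm_dual_star[of \<phi>] norm_ge_zero[of F]] by simp
  then have "bounded_clinear (\<lambda>\<phi>. cnj (F (dual_star \<phi>)))"
    by (intro bounded_clinearI[where K = "norm F"])
      (auto simp: dual_star_linear cblinfun_add_right cblinfun_scaleC_right scaleC_complex_def)
  then show ?thesis by (simp add: bidual_star_def Cblinfun_inverse)
qed

lemma bidual_one_apply: "bidual_one \<phi> = cblinfun_apply \<phi> 1"
proof -
  have "bounded_clinear (\<lambda>\<phi>. cblinfun_apply \<phi> (1::'a::unital_cstar_algebra) :: complex)"
    by (rule bounded_clinearI[where K = 1])
      (use norm_cblinfun_apply_le[of _ "1::'a"] in
        \<open>auto simp: plus_cblinfun.rep_eq scaleC_cblinfun.rep_eq\<close>)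
  then show ?thesis by (simp add: bidual_one_def Cblinfun_inverse)
qed

definition bidual_projection :: "'a::unital_cstar_algebra cbidual \<Rightarrow> bool" where
  "bidual_projection p \<longleftrightarrow> p \<box> p = p \<and> bidual_star p = p"

definition bidual_centre :: "'a::unital_cstar_algebra cbidual set" where
  "bidual_centre = {F. \<forall>G. F \<box> G = G \<box> F}"

text \<open>The support of \<open>\<omega>\<close>, regarded as a normal functional \<open>F \<mapsto> F \<omega>\<close> on \<open>A**\<close>:
  its left kernel \<open>{F. \<omega>(F*F) = 0}\<close> equals \<open>A**(1 - p)\<close>.\<close>

definition support_projection ::
    "'a::unital_cstar_algebra cdual \<Rightarrow> 'a cbidual \<Rightarrow> bool" where
  "support_projection \<omega> p \<longleftrightarrow>
     bidual_projection p \<and> (\<forall>F. (bidual_star F \<box> F) \<omega> = 0 \<longleftrightarrow> F \<box> p = 0)"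

text \<open>In particular, \<open>p\<close> is the least projection on which \<open>\<omega>\<close> takes the value 1.\<close>

lemma cblinfun_diff_right: "cblinfun_apply f (x - y) = cblinfun_apply f x - cblinfun_apply f y"
  by (rule linear_simps(2)[OF bounded_linear_apply])

lemma cblinfun_diff_apply: "cblinfun_apply (f - g) x = cblinfun_apply f x - cblinfun_apply g x"
  unfolding minus_cblinfun_def plus_cblinfun.rep_eq uminus_cblinfun_apply by simp

lemma support_projection_least:
  assumes p: "support_projection \<omega> p" and one: "\<omega> 1 = 1"
  shows "p \<omega> = 1" and "\<And>q. bidual_projection q \<Longrightarrow> q \<omega> = 1 \<Longrightarrow> q \<box> p = p"
proof -
  have diff: "(F - G) \<box> H = F \<box> H - G \<box> H" for F G H :: "'a cbidual"
    by (rule cblinfun_eqI) (simp add: arens_apply cblinfun_diff_apply)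
  have act_diff: "bidual_act (G - H) \<phi> = bidual_act G \<phi> - bidual_act H \<phi>" for G H :: "'a cbidual" and \<phi>
    by (rule cblinfun_eqI) (simp add: bidual_act_apply cblinfun_diff_apply)
  have diff': "F \<box> (G - H) = F \<box> G - F \<box> H" for F G H :: "'a cbidual"
    by (rule cblinfun_eqI) (simp add: arens_apply cblinfun_diff_apply act_diff cblinfun_diff_right)
  have act_one: "bidual_act bidual_one \<phi> = \<phi>" for \<phi> :: "'a cdual"
    by (rule cblinfun_eqI) (simp add: bidual_act_apply bidual_one_apply dual_act_apply)
  have one_r: "F \<box> bidual_one = F" for F :: "'a cbidual"
    by (rule cblinfun_eqI) (simp add: arens_apply act_one)
  have one_act: "dual_act \<phi> 1 = \<phi>" for \<phi> :: "'a cdual"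
    by (rule cblinfun_eqI) (simp add: dual_act_apply)
  have one_l: "bidual_one \<box> F = F" for F :: "'a cbidual"
    by (rule cblinfun_eqI) (simp add: arens_apply bidual_one_apply bidual_act_apply one_act)
  have "1\<^sup>\<star> = (1\<^sup>\<star>)\<^sup>\<star> * (1::'a)\<^sup>\<star>" by (simp only: star_star mult_1_left)
  also have "\<dots> = (1::'a)" by (subst star_mult[symmetric]) (simp only: mult_1_left star_star)
  finally have star1: "(1::'a)\<^sup>\<star> = 1" .
  have star: "bidual_star (bidual_one - q) = bidual_one - q" if "bidual_projection q" for q :: "'a cbidual"
  proof (rule cblinfun_eqI)
    fix \<phi>
    have "cnj (q (dual_star \<phi>)) = q \<phi>"
      using that bidual_star_apply[of q \<phi>] by (simp add: bidual_projection_def)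
    then show "bidual_star (bidual_one - q) \<phi> = (bidual_one - q) \<phi>"
      by (simp add: bidual_star_apply bidual_one_apply cblinfun_diff_apply dual_star_apply star1)
  qed
  have proj: "(bidual_one - q) \<box> (bidual_one - q) = bidual_one - q"
    if "bidual_projection q" for q :: "'a cbidual"
    using that by (simp add: bidual_projection_def diff diff' one_l one_r)
  have ker: "(bidual_star F \<box> F) \<omega> = 0 \<longleftrightarrow> F \<box> p = 0" for F
    using p by (simp add: support_projection_def)
  have pp: "bidual_projection p" using p by (simp add: support_projection_def)
  have "(bidual_one - p) \<box> p = 0"
    using pp by (simp add: diff one_l bidual_projection_def)
  then have "(bidual_one - p) \<omega> = 0"
    using ker[of "bidual_one - p"] star[OF pp] proj[OF pp] by simp
  then show "p \<omega> = 1" by (simp add: cblinfun_diff_apply bidual_one_apply one)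
  fix q :: "'a cbidual" assume q: "bidual_projection q" "q \<omega> = 1"
  have "(bidual_one - q) \<omega> = 0"
    using q by (simp add: cblinfun_diff_apply bidual_one_apply one)
  then have "(bidual_one - q) \<box> p = 0"
    using ker[of "bidual_one - q"] star[OF q(1)] proj[OF q(1)] by simp
  then show "q \<box> p = p" by (simp add: diff one_l)
qed

section \<open>C*-dynamical systems\<close>

definition star_automorphism :: "('a::unital_cstar_algebra \<Rightarrow> 'a) \<Rightarrow> bool" where
  "star_automorphism \<alpha> \<longleftrightarrow> bij \<alpha> \<and>
     (\<forall>a b. \<alpha> (a + b) = \<alpha> a + \<alpha> b) \<and> (\<forall>c a. \<alpha> (c *\<^sub>C a) = c *\<^sub>C \<alpha> a) \<and>
     (\<forall>a b. \<alpha> (a * b) = \<alpha> a * \<alpha> b) \<and> (\<forall>a. \<alpha> (a\<^sup>\<star>) = (\<alpha> a)\<^sup>\<star>)"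

definition state :: "'a::unital_cstar_algebra cdual \<Rightarrow> bool" where
  "state \<phi> \<longleftrightarrow> (\<forall>a. \<phi> (a\<^sup>\<star> * a) \<in> \<real>\<^sub>\<ge>\<^sub>0) \<and> \<phi> 1 = 1"

definition invariant_states ::
    "('a::unital_cstar_algebra \<Rightarrow> 'a) \<Rightarrow> 'a cdual set" where
  "invariant_states \<beta> = {\<phi>. state \<phi> \<and> (\<forall>a. \<phi> (\<beta> a) = \<phi> a)}"

definition ergodic :: "('a::unital_cstar_algebra \<Rightarrow> 'a) \<Rightarrow> 'a cdual \<Rightarrow> bool" where
  "ergodic \<beta> \<omega> \<longleftrightarrow> \<omega> extreme_point_of invariant_states \<beta>"

definition cstar_dynamical_system ::
    "('a::unital_cstar_algebra \<Rightarrow> 'a) \<Rightarrow> 'a cdual \<Rightarrow> bool" where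
  "cstar_dynamical_system \<alpha> \<omega> \<longleftrightarrow> star_automorphism \<alpha> \<and> \<omega> \<in> invariant_states \<alpha>"

definition int_iterate :: "('a \<Rightarrow> 'a) \<Rightarrow> int \<Rightarrow> 'a \<Rightarrow> 'a" where
  "int_iterate \<alpha> k = (if 0 \<le> k then \<alpha> ^^ nat k else inv \<alpha> ^^ nat (- k))"

text \<open>The covariant GNS representation is determined up to unitary equivalence.\<close>

definition covariant_GNS ::
    "('a::unital_cstar_algebra \<Rightarrow> 'a) \<Rightarrow> 'a cdual \<Rightarrow>
     ('a \<Rightarrow> 'h::complex_hilbert \<Rightarrow>\<^sub>C\<^sub>L 'h) \<Rightarrow> ('h \<Rightarrow>\<^sub>C\<^sub>L 'h) \<Rightarrow> 'h \<Rightarrow> bool" where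
  "covariant_GNS \<alpha> \<omega> \<pi> U \<Omega> \<longleftrightarrow>
     (\<forall>a b. \<pi> (a + b) = \<pi> a + \<pi> b) \<and> (\<forall>c a. \<pi> (c *\<^sub>C a) = c *\<^sub>C \<pi> a) \<and>
     (\<forall>a b. \<pi> (a * b) = \<pi> a o\<^sub>C \<pi> b) \<and> (\<forall>a. \<pi> (a\<^sup>\<star>) = (\<pi> a)\<^sup>\<dagger>) \<and> \<pi> 1 = cblinfun_id \<and>
     closure (range (\<lambda>a. \<pi> a \<Omega>)) = UNIV \<and>
     (\<forall>a. \<omega> a = cinner (\<pi> a \<Omega>) \<Omega>) \<and>
     unitary U \<and> U \<Omega> = \<Omega> \<and> (\<forall>a. U o\<^sub>C \<pi> a o\<^sub>C U\<^sup>\<dagger> = \<pi> (\<alpha> a))"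

section \<open>The partial isometry\<close>

text \<open>A unitary of the von Neumann algebra \<open>N\<close> that generates the eigenspace of \<open>U\<close> for \<open>v\<close>
  from \<open>\<Omega>\<close>. It is unique only up to a phase; the operator defined from these unitaries below
  does not depend on the phases.\<close>

definition eigen_unitary ::
    "('h::complex_hilbert \<Rightarrow>\<^sub>C\<^sub>L 'h) set \<Rightarrow> ('h \<Rightarrow>\<^sub>C\<^sub>L 'h) \<Rightarrow> 'h \<Rightarrow> complex \<Rightarrow> 'h \<Rightarrow>\<^sub>C\<^sub>L 'h" where
  "eigen_unitary N U \<Omega> v =
     (SOME T. T \<in> N \<and> unitary T \<and> eigenspace U v = range (\<lambda>c. c *\<^sub>C T \<Omega>) \<and>
        U o\<^sub>C T o\<^sub>C U\<^sup>\<dagger> = v *\<^sub>C T)"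

definition resonance_set ::
    "('h::complex_hilbert \<Rightarrow>\<^sub>C\<^sub>L 'h) \<Rightarrow> int \<Rightarrow> int \<Rightarrow> (complex \<times> complex) set" where
  "resonance_set U k1 k2 =
     {(v, w). v \<in> point_spectrum U \<and> w \<in> point_spectrum U \<and> v powi k1 * w powi k2 = 1}"

text \<open>The infinite sum is taken in \<open>'h\<close> for each vector \<open>\<xi>\<close> separately, i.e. in the strong
  operator topology.\<close>

definition resonance_isometry ::
    "('a::unital_cstar_algebra \<Rightarrow> 'h::complex_hilbert \<Rightarrow>\<^sub>C\<^sub>L 'h) \<Rightarrow> ('h \<Rightarrow>\<^sub>C\<^sub>L 'h) \<Rightarrow> 'h \<Rightarrow>
     ('h \<Rightarrow> 'h \<Rightarrow> 'k::complex_hilbert) \<Rightarrow> int \<Rightarrow> int \<Rightarrow> 'k \<Rightarrow> 'h" where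
  "resonance_isometry \<pi> U \<Omega> tens k1 k2 \<xi> =
     (let V = eigen_unitary (commutant (commutant (range \<pi>))) U \<Omega>;
          W = eigen_unitary (commutant (range \<pi>)) U \<Omega>
      in \<Sum>\<^sub>\<infinity>(v, w)\<in>resonance_set U k1 k2.
           cinner \<xi> (tens (V v \<Omega>) (W w \<Omega>)) *\<^sub>C V v (W w \<Omega>))"

end

theory Submission
  imports Defs "HOL-Computational_Algebra.Fundamental_Theorem_Algebra"
begin

text \<open>
  Write \<open>M\<close> for the bicommutant of \<open>\<pi>(A)\<close>, \<open>M'\<close> for its commutant and \<open>m = k2 - k1\<close>.
  Centrality of the support makes \<open>M'\<Omega>\<close> dense: for \<open>y\<close> orthogonal to \<open>M'\<Omega>\<close>, a bounded sequence in the
  algebra tending to \<open>0\<close> at \<open>\<Omega>\<close> and to the identity at \<open>y\<close> (double commutant and Kaplansky density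
  arguments) has a weak* cluster point \<open>F\<close> in the bidual with \<open>\<omega>(F\<^sup>*F) = 0\<close>, hence \<open>Fp = 0\<close> for the
  central support \<open>p\<close>, and this forces \<open>F\<close> to act as \<open>0\<close>.
  Extremality of \<open>\<omega>\<close> then gives that \<open>U\<^sup>m\<close> fixes only multiples of \<open>\<Omega>\<close>.
  A unit eigenvector \<open>x\<close> of \<open>U\<close> induces an invariant normal state, which must be that of \<open>\<Omega>\<close>, so
  \<open>B\<Omega> \<mapsto> Bx\<close> extends to the required unitary.

  For \<open>B\<close> in \<open>M'\<close> put \<open>X(n, x) = U\<^bsup>n k2\<^esup> B U\<^bsup>- n m\<^esup> x\<close>. If \<open>x\<close> is an eigenvector, the averages of
  \<open>X(n, x)\<close> reduce to geometric averages. If \<open>x\<close> is orthogonal to all eigenvectors, the van der Corput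
  argument bounds them by the averages of \<open>U\<^bsup>n k1\<^esup>x \<otimes> U\<^bsup>n k2\<^esup>B\<Omega>\<close>. These tend to a fixed vector of
  \<open>U\<^bsup>k1\<^esup> \<otimes> U\<^bsup>k2\<^esup>\<close>, which vanishes, as it is the kernel of a Hilbert-Schmidt operator intertwining
  \<open>U\<^bsup>k1\<^esup>\<close> and \<open>U\<^bsup>k2\<^esup>\<close> that annihilates all eigenvectors of \<open>U\<close>. The general case follows from the
  density of \<open>M'\<Omega>\<close>.
\<close>

section \<open>Inner products, adjoints and projections\<close>

text \<open>The vectors \<open>\<pi>(\<alpha>^(n k1)(A1)) U^(n k2) \<pi>(A2)\<Omega>\<close> depend
  on the operator \<open>\<pi>(A1)\<close>, not only on the vector \<open>\<pi>(A1)\<Omega>\<close>,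
  so splitting a vector into eigenvectors and a remainder does not apply to them. This is the reason
  for the commutant: with \<open>\<pi>(A2)\<Omega>\<close> replaced by \<open>B\<Omega>\<close>, a
  conjugate of \<open>B\<close> can be moved past \<open>\<pi>(A1)\<close>, and what remains,
  \<open>X(n, x)\<close> at \<open>x = \<pi>(A1)\<Omega>\<close>, is linear in \<open>x\<close> and
  bounded by \<open>norm B * norm x\<close> uniformly in \<open>n\<close>. The exponent
  \<open>m\<close> comes from the correlations: in the inner product of \<open>X(n+h, x)\<close> and
  \<open>X(n+h', x)\<close> the outer powers \<open>U^(n k2)\<close> cancel, and an element of
  \<open>M'\<close> conjugated by \<open>U^(n m)\<close> is left. Its averages tend strongly to a
  scalar because \<open>U^m\<close> fixes only multiples of \<Omega>, so the limiting correlation is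
  a product of two inner products, that is, an inner product of elementary tensors. Spectral
  measures are avoided: vectors are shown to vanish by producing a linear relation in their
  orbit.\<close>

lemma scaleC_zero_left [simp]: "(0::complex) *\<^sub>C (x::'a::complex_normed_vector) = 0"
  using scaleR_scaleC[of 0 x] by simp

lemma scaleC_one [simp]: "(1::complex) *\<^sub>C (x::'a::complex_normed_vector) = x"
  using scaleR_scaleC[of 1 x] by simp

declare scaleC_zero_right [simp]

lemma scaleC_minus_left: "(- c) *\<^sub>C (x::'a::complex_normed_vector) = - (c *\<^sub>C x)"
  using scaleC_add_left[of "- c" c x] by (simp add: add_eq_0_iff2)

lemma scaleC_minus_right: "c *\<^sub>C (- x::'a::complex_normed_vector) = - (c *\<^sub>C x)"
  using scaleC_add_right[of c "- x" x] by (simp add: add_eq_0_iff2)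

lemma scaleC_diff_left: "(c - d) *\<^sub>C (x::'a::complex_normed_vector) = c *\<^sub>C x - d *\<^sub>C x"
  using scaleC_add_left[of c "- d" x] by (simp add: scaleC_minus_left)

lemma scaleC_diff_right: "c *\<^sub>C (x - y::'a::complex_normed_vector) = c *\<^sub>C x - c *\<^sub>C y"
  using scaleC_add_right[of c x "- y"] by (simp add: scaleC_minus_right)

lemma scaleC_sum_right: "c *\<^sub>C (sum f A::'a::complex_normed_vector) = (\<Sum>i\<in>A. c *\<^sub>C f i)"
  by (induction A rule: infinite_finite_induct) (auto simp: scaleC_add_right)

lemma scaleC_sum_left: "sum f A *\<^sub>C (x::'a::complex_normed_vector) = (\<Sum>i\<in>A. f i *\<^sub>C x)"
  by (induction A rule: infinite_finite_induct) (auto simp: scaleC_add_left)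

lemma scaleC_eq_0_iff [simp]: "c *\<^sub>C (x::'a::complex_normed_vector) = 0 \<longleftrightarrow> c = 0 \<or> x = 0"
  using norm_scaleC[of c x] by (metis mult_eq_0_iff norm_eq_zero)

lemma scaleR_scaleC_commute: "r *\<^sub>R c *\<^sub>C (x::'a::complex_normed_vector) = c *\<^sub>C r *\<^sub>R x"
  by (simp add: scaleR_scaleC scaleC_scaleC mult.commute)

lemma scaleC_cancel [simp]: "c \<noteq> 0 \<Longrightarrow> inverse c *\<^sub>C c *\<^sub>C (x::'a::complex_normed_vector) = x"
  by (simp add: scaleC_scaleC)

lemma bounded_bilinear_scaleC:
  "bounded_bilinear (scaleC :: complex \<Rightarrow> 'a::complex_normed_vector \<Rightarrow> 'a)"
proof
  show "\<exists>K. \<forall>a (b::'a). norm (a *\<^sub>C b) \<le> norm a * norm b * K"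
    by (rule exI[of _ 1]) (simp add: norm_scaleC)
qed (auto simp: scaleC_add_left scaleC_add_right scaleR_scaleC scaleR_conv_of_real scaleC_scaleC
    scaleC_complex_def mult.commute)

lemmas tendsto_scaleC [tendsto_intros] = bounded_bilinear.tendsto[OF bounded_bilinear_scaleC]

context
  fixes x y z :: "'a::complex_hilbert"
begin

lemma cinner_add_right: "cinner x (y + z) = cinner x y + cinner x z"
  by (metis cinner_add_left cinner_commute complex_cnj_add)

lemma cinner_scaleC_right: "cinner x (c *\<^sub>C y) = cnj c * cinner x y"
  by (metis cinner_scaleC_left cinner_commute complex_cnj_mult)

lemma cinner_zero_left [simp]: "cinner 0 y = 0"
  using cinner_scaleC_left[of 0 x y] by simp

lemma cinner_zero_right [simp]: "cinner y 0 = 0"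
  by (subst cinner_commute) (simp add: cinner_scaleC_left[of 0 x y, simplified])

lemma cinner_minus_right: "cinner x (- y) = - cinner x y"
  using cinner_scaleC_right[of "-1"] by (simp add: scaleC_minus_left)

lemma cinner_diff_left: "cinner (x - y) z = cinner x z - cinner y z"
  using cinner_add_left[of x "- y" z] cinner_scaleC_left[of "-1" y z]
  by (simp add: scaleC_minus_left)

lemma cinner_scaleR_left: "cinner (r *\<^sub>R x) y = of_real r * cinner x y"
  by (simp add: scaleR_scaleC cinner_scaleC_left)

lemma cinner_scaleR_right: "cinner x (r *\<^sub>R y) = of_real r * cinner x y"
  by (simp add: scaleR_scaleC cinner_scaleC_right)

lemma cinner_self: "cinner x x = of_real ((norm x)\<^sup>2)"
proof -
  have "Im (cinner x x) = 0"
    using cinner_commute[of x x] by (metis complex_cnj_cancel_iff complex_In_mult_cnj_zero 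
      Reals_cnj_iff complex_is_Real_iff)
  moreover have "Re (cinner x x) = (norm x)\<^sup>2"
    by (simp add: inner_eq_Re_cinner[symmetric] power2_norm_eq_inner)
  ultimately show ?thesis by (simp add: complex_eq_iff)
qed

end

lemma cinner_diff_right: "cinner x (y - z) = cinner x y - cinner x (z::'a::complex_hilbert)"
  using cinner_add_right[of x y "- z"] by (simp add: cinner_minus_right)

lemma cinner_sum_left: "cinner (sum f A) (y::'a::complex_hilbert) = (\<Sum>i\<in>A. cinner (f i) y)"
  by (induction A rule: infinite_finite_induct) (auto simp: cinner_add_left)

lemma cinner_sum_right: "cinner (y::'a::complex_hilbert) (sum f A) = (\<Sum>i\<in>A. cinner y (f i))"
  by (induction A rule: infinite_finite_induct) (auto simp: cinner_add_right)

lemma cinner_self_eq_0 [simp]: "cinner x x = 0 \<longleftrightarrow> x = (0::'a::complex_hilbert)"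
  by (simp add: cinner_self)

lemma cinner_sym_0: "cinner x y = 0 \<longleftrightarrow> cinner y x = (0::complex)" for x y :: "'a::complex_hilbert"
  by (metis cinner_commute complex_cnj_zero_iff)

lemma norm_eq_iff_cinner: "norm x = norm y \<longleftrightarrow> cinner x x = cinner y y"
  for x y :: "'a::complex_hilbert"
  unfolding cinner_self of_real_eq_iff by (simp add: power2_eq_iff_nonneg)

text \<open>Multiplying \<open>x\<close> by the unimodular \<open>c\<close> makes the inner product
  real and nonnegative, which reduces the claim to the real Cauchy-Schwarz inequality.\<close>

lemma cinner_norm_le: "cmod (cinner x y) \<le> norm x * norm (y::'a::complex_hilbert)"
proof (cases "cinner x y = 0")
  case False
  define c where "c = cnj (cinner x y) / of_real (cmod (cinner x y))"
  have "c * cinner x y = of_real (cmod (cinner x y))"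
    using False by (simp add: c_def complex_norm_square[symmetric] power2_eq_square mult.commute)
  then have "cmod (cinner x y) = inner (c *\<^sub>C x) y"
    by (simp add: inner_eq_Re_cinner cinner_scaleC_left)
  also have "\<dots> \<le> norm (c *\<^sub>C x) * norm y" by (rule norm_cauchy_schwarz)
  also have "norm (c *\<^sub>C x) = norm x"
    using False by (simp add: norm_scaleC c_def norm_divide)
  finally show ?thesis .
qed simp

lemma bounded_bilinear_cinner:
  "bounded_bilinear (cinner :: 'a::complex_hilbert \<Rightarrow> 'a \<Rightarrow> complex)"
proof
  show "\<exists>K. \<forall>a (b::'a). cmod (cinner a b) \<le> norm a * norm b * K"
    by (rule exI[of _ 1]) (simp add: cinner_norm_le)
qed (auto simp: cinner_add_left cinner_add_right cinner_scaleR_left cinner_scaleR_right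
    scaleR_conv_of_real)

lemmas tendsto_cinner [tendsto_intros] = bounded_bilinear.tendsto[OF bounded_bilinear_cinner]

lemma cinner_eqI: "x = y" if "\<And>z. cinner x z = cinner y z" for x y :: "'a::complex_hilbert"
proof -
  have "cinner (x - y) (x - y) = 0" unfolding cinner_diff_left using that[of "x - y"] by simp
  then show ?thesis by simp
qed

lemma cinner_eqI_right: "x = y" if "\<And>z. cinner z x = cinner z y" for x y :: "'a::complex_hilbert"
  by (rule cinner_eqI) (metis cinner_commute that)

lemma norm_add_sq: "(norm (x + y))\<^sup>2 = (norm x)\<^sup>2 + (norm y)\<^sup>2 + 2 * Re (cinner x y)"
  for x y :: "'a::complex_hilbert"
  by (simp add: power2_norm_eq_inner inner_add_left inner_add_right inner_commute
      inner_eq_Re_cinner[symmetric])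

lemma norm_diff_sq: "(norm (x - y))\<^sup>2 = (norm x)\<^sup>2 + (norm y)\<^sup>2 - 2 * Re (cinner x y)"
  for x y :: "'a::complex_hilbert"
  using norm_add_sq[of x "- y"] by (simp add: cinner_minus_right)

lemma norm_sum_sq: "complex_of_real ((norm (sum f A))\<^sup>2) = (\<Sum>i\<in>A. \<Sum>j\<in>A. cinner (f i) (f j))"
  for f :: "_ \<Rightarrow> 'a::complex_hilbert"
  unfolding cinner_self[symmetric] cinner_sum_left by (simp add: cinner_sum_right)

lemma cblinfun_zero_right [simp]: "cblinfun_apply f 0 = 0"
  using cblinfun_scaleC_right[of f 0 0] by simp

lemma cblinfun_scaleR_right: "cblinfun_apply f (r *\<^sub>R x) = r *\<^sub>R cblinfun_apply f x"
  by (simp add: scaleR_scaleC cblinfun_scaleC_right)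

lemma cblinfun_sum_right: "cblinfun_apply f (sum g A) = (\<Sum>i\<in>A. cblinfun_apply f (g i))"
  by (induction A rule: infinite_finite_induct) (auto simp: cblinfun_add_right)

lemma cblinfun_apply_le: "norm (cblinfun_apply f x) \<le> norm f * norm x"
  using norm_cblinfun_apply_le[of f x] by (simp add: mult.commute)

lemmas tendsto_cblinfun [tendsto_intros] = bounded_linear.tendsto[OF bounded_linear_apply]

lemma continuous_on_cblinfun [continuous_intros]:
  "continuous_on S f \<Longrightarrow> continuous_on S (\<lambda>x. cblinfun_apply T (f x))"
  by (rule bounded_linear.continuous_on[OF bounded_linear_apply])

lemma continuous_on_cinner [continuous_intros]:
  "continuous_on S f \<Longrightarrow> continuous_on S g \<Longrightarrow> continuous_on S (\<lambda>x. cinner (f x) (g x :: 'a::complex_hilbert))"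
  by (rule bounded_bilinear.continuous_on[OF bounded_bilinear_cinner])

lemma cblinfun_id_apply [simp]: "cblinfun_apply cblinfun_id x = x"
  by (simp add: cblinfun_id.rep_eq)

lemma cblinfun_compose_apply [simp]: "cblinfun_apply (S o\<^sub>C T) x = cblinfun_apply S (cblinfun_apply T x)"
  by (simp add: cblinfun_compose.rep_eq)

lemma cblinfun_scaleC_apply [simp]: "cblinfun_apply (c *\<^sub>C T) x = c *\<^sub>C cblinfun_apply T x"
  by (simp add: scaleC_cblinfun.rep_eq)

lemma cblinfun_plus_apply [simp]: "cblinfun_apply (S + T) x = cblinfun_apply S x + cblinfun_apply T x"
  by (simp add: plus_cblinfun.rep_eq)

declare cblinfun_diff_apply [simp] uminus_cblinfun_apply [simp] scaleR_cblinfun_apply [simp]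

lemma cblinfun_zero_apply [simp]: "cblinfun_apply 0 x = 0"
  by (simp add: zero_cblinfun.rep_eq)

lemma cblinfun_eqI_dense:
  assumes "closure D = UNIV" and "\<And>x. x \<in> D \<Longrightarrow> cblinfun_apply S x = cblinfun_apply T x"
  shows "S = T"
proof (rule cblinfun_eqI)
  fix x
  have "closed {x. cblinfun_apply S x = cblinfun_apply T x}"
    by (intro closed_Collect_eq continuous_intros)
  then have "closure D \<subseteq> {x. cblinfun_apply S x = cblinfun_apply T x}"
    by (rule closure_minimal[rotated]) (use assms in auto)
  then show "cblinfun_apply S x = cblinfun_apply T x" using assms by auto
qed

lemma Cblinfun_exists:
  fixes f :: "'a::complex_normed_vector \<Rightarrow> 'b::complex_normed_vector"
  assumes "\<And>x y. f (x + y) = f x + f y" "\<And>c x. f (c *\<^sub>C x) = c *\<^sub>C f x"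
    "\<And>x. norm (f x) \<le> K * norm x"
  shows "\<exists>T :: 'a \<Rightarrow>\<^sub>C\<^sub>L 'b. \<forall>x. T x = f x"
proof -
  have "bounded_clinear f" by (rule bounded_clinearI[of f K]) (use assms in \<open>simp_all add: mult.commute\<close>)
  then show ?thesis by (intro exI[of _ "Cblinfun f"]) (simp add: Cblinfun_inverse)
qed

text \<open>By convexity the midpoint of \<open>y m\<close> and \<open>y n\<close> has norm at least
  \<open>d\<close>, so the parallelogram law bounds their distance. This serves both for nearest
  points in subspaces and for the mean ergodic theorem.\<close>

lemma Cauchy_norm_minimizing:
  fixes y :: "nat \<Rightarrow> 'a::real_inner"
  assumes C: "convex C" and d: "\<And>c. c \<in> C \<Longrightarrow> d \<le> norm c" "0 \<le> d"
    and y: "\<And>n. y n \<in> C" "(\<lambda>n. norm (y n)) \<longlonglongrightarrow> d"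
  shows "Cauchy y"
proof (rule metric_CauchyI)
  fix e :: real assume e: "0 < e"
  have par: "(norm (y m - y n))\<^sup>2 \<le> 2 * (norm (y m))\<^sup>2 + 2 * (norm (y n))\<^sup>2 - 4 * d\<^sup>2" for m n
  proof -
    have "(1/2) *\<^sub>R y m + (1/2) *\<^sub>R y n \<in> C"
      using C y(1) by (intro convexD) auto
    then have "d \<le> norm ((1/2) *\<^sub>R (y m + y n))"
      using d by (simp add: scaleR_add_right)
    then have "2 * d \<le> norm (y m + y n)" by simp
    then have "(2 * d)\<^sup>2 \<le> (norm (y m + y n))\<^sup>2" using d(2) by (intro power_mono) auto
    then show ?thesis
      by (simp add: power2_norm_eq_inner inner_add_left inner_add_right inner_diff_left
          inner_diff_right inner_commute power_mult_distrib)
  qed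
  have "(\<lambda>n. (norm (y n))\<^sup>2) \<longlonglongrightarrow> d\<^sup>2" by (intro tendsto_intros y)
  then have "\<forall>\<^sub>F n in sequentially. dist ((norm (y n))\<^sup>2) (d\<^sup>2) < e\<^sup>2 / 4"
    using e by (intro tendstoD) auto
  then obtain N where N: "\<And>n. n \<ge> N \<Longrightarrow> \<bar>(norm (y n))\<^sup>2 - d\<^sup>2\<bar> < e\<^sup>2 / 4"
    by (auto simp: eventually_sequentially dist_real_def)
  have "dist (y m) (y n) < e" if "m \<ge> N" "n \<ge> N" for m n
  proof -
    have "(norm (y m - y n))\<^sup>2 < e\<^sup>2"
      using par[of m n] N[OF that(1)] N[OF that(2)] by linarith
    then show ?thesis using e by (simp add: dist_norm power2_less_imp_less)
  qed
  then show "\<exists>M. \<forall>m\<ge>M. \<forall>n\<ge>M. dist (y m) (y n) < e" by blast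
qed

section \<open>Complex subspaces and orthogonal projections\<close>

definition csubspace :: "'a::complex_normed_vector set \<Rightarrow> bool" where
  "csubspace E \<longleftrightarrow> 0 \<in> E \<and> (\<forall>x\<in>E. \<forall>y\<in>E. x + y \<in> E) \<and> (\<forall>c. \<forall>x\<in>E. c *\<^sub>C x \<in> E)"

lemma csubspaceD:
  assumes "csubspace E"
  shows "0 \<in> E" "x \<in> E \<Longrightarrow> y \<in> E \<Longrightarrow> x + y \<in> E" "x \<in> E \<Longrightarrow> c *\<^sub>C x \<in> E"
    "x \<in> E \<Longrightarrow> r *\<^sub>R x \<in> E" "x \<in> E \<Longrightarrow> - x \<in> E" "x \<in> E \<Longrightarrow> y \<in> E \<Longrightarrow> x - y \<in> E"
proof -
  show add: "x \<in> E \<Longrightarrow> y \<in> E \<Longrightarrow> x + y \<in> E" and sc: "x \<in> E \<Longrightarrow> c *\<^sub>C x \<in> E" and "0 \<in> E" for x y c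
    using assms by (auto simp: csubspace_def)
  show "x \<in> E \<Longrightarrow> r *\<^sub>R x \<in> E" by (simp add: scaleR_scaleC sc)
  have m: "x \<in> E \<Longrightarrow> - x \<in> E" for x using sc[of x "-1"] by (simp add: scaleC_minus_left)
  then show "x \<in> E \<Longrightarrow> - x \<in> E" .
  show "x \<in> E \<Longrightarrow> y \<in> E \<Longrightarrow> x - y \<in> E" using add[of x "- y"] m by simp
qed

lemma csubspace_sum: "csubspace E \<Longrightarrow> (\<And>i. i \<in> A \<Longrightarrow> f i \<in> E) \<Longrightarrow> sum f A \<in> E"
  by (induction A rule: infinite_finite_induct) (auto dest: csubspaceD)

lemma csubspace_closure:
  assumes E: "csubspace E" shows "csubspace (closure E)"
  unfolding csubspace_def
proof (intro conjI ballI allI)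
  show "0 \<in> closure E" using csubspaceD(1)[OF E] closure_subset by blast
  fix x assume "x \<in> closure E"
  then obtain f where f: "\<And>n. f n \<in> E" "f \<longlonglongrightarrow> x" by (auto simp: closure_sequential)
  show "c *\<^sub>C x \<in> closure E" for c
    unfolding closure_sequential using f csubspaceD[OF E]
    by (intro exI[of _ "\<lambda>n. c *\<^sub>C f n"]) (auto intro!: tendsto_intros)
  fix y assume "y \<in> closure E"
  then obtain g where g: "\<And>n. g n \<in> E" "g \<longlonglongrightarrow> y" by (auto simp: closure_sequential)
  show "x + y \<in> closure E"
    unfolding closure_sequential using f g csubspaceD[OF E]
    by (intro exI[of _ "\<lambda>n. f n + g n"]) (auto intro!: tendsto_intros)
qed

text \<open>The remainder \<open>x - p\<close> is an element \<open>z\<close> of least norm in the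
  translate \<open>x - E\<close>; a direction \<open>e\<close> in \<open>E\<close> not orthogonal to
  \<open>z\<close> would allow it to be shortened.\<close>

lemma real_orthogonal_decomposition:
  fixes E :: "'a::{real_inner, banach} set"
  assumes E: "subspace E" "closed E"
  shows "\<exists>p\<in>E. \<forall>e\<in>E. inner (x - p) e = 0"
proof -
  define C where "C = (\<lambda>e. x - e) ` E"
  have conv: "convex C"
    unfolding C_def diff_conv_add_uminus image_image[symmetric, of "\<lambda>e. x + e" uminus]
    by (intro convex_translation convex_negations subspace_imp_convex E)
  have ne: "C \<noteq> {}" using subspace_0[OF E(1)] by (auto simp: C_def)
  define d where "d = Inf (norm ` C)"
  have bdd: "bdd_below (norm ` C)" by (rule bdd_belowI2[of _ 0]) simp
  have d: "d \<le> norm c" if "c \<in> C" for c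
    unfolding d_def by (rule cInf_lower) (use that bdd in auto)
  have d0: "0 \<le> d" unfolding d_def by (rule cInf_greatest) (use ne in auto)
  have "\<exists>c\<in>C. norm c < d + 1 / Suc n" for n
    using cInf_lessD[of "norm ` C" "d + 1 / Suc n"] ne by (auto simp: d_def)
  then obtain y where y: "\<And>n. y n \<in> C" "\<And>n. norm (y n) < d + 1 / Suc n" by metis
  have lim: "(\<lambda>n. norm (y n)) \<longlonglongrightarrow> d"
  proof (rule tendsto_sandwich[of "\<lambda>_. d" _ _ "\<lambda>n. d + 1 / real (Suc n)"])
    show "(\<lambda>n. d + 1 / real (Suc n)) \<longlonglongrightarrow> d"
      using tendsto_add[OF tendsto_const[of d] LIMSEQ_inverse_real_of_nat]
      by (simp add: inverse_eq_divide)
    show "\<forall>\<^sub>F n in sequentially. d \<le> norm (y n)"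
      "\<forall>\<^sub>F n in sequentially. norm (y n) \<le> d + 1 / real (Suc n)"
      using d[OF y(1)] less_imp_le[OF y(2)] by (auto intro!: always_eventually)
  qed simp
  have "Cauchy y" by (rule Cauchy_norm_minimizing[OF conv d d0 y(1) lim])
  then obtain z where z: "y \<longlonglongrightarrow> z" using Cauchy_convergent convergent_def by blast
  have "(\<lambda>n. x - y n) \<longlonglongrightarrow> x - z" by (intro tendsto_intros z)
  moreover have "x - y n \<in> E" for n using y(1)[of n] by (auto simp: C_def)
  ultimately have zE: "x - z \<in> E" by (rule closed_sequentially[OF E(2), rotated])
  have nz: "norm z = d" using LIMSEQ_unique[OF tendsto_norm[OF z] lim] .
  have "inner z e = 0" if e: "e \<in> E" for e
  proof (cases "e = 0")
    case False
    \<comment> \<open>The coefficient for which \<open>z - c *\<^sub>R e\<close> has the smallest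
      norm.\<close>
    define c where "c = inner z e / (norm e)\<^sup>2"
    have "x - z + c *\<^sub>R e \<in> E" using zE e E(1) by (intro subspace_add subspace_scale)
    then have "z - c *\<^sub>R e \<in> C" unfolding C_def by (rule rev_image_eqI) simp
    then have "(norm z)\<^sup>2 \<le> (norm (z - c *\<^sub>R e))\<^sup>2" using d nz d0 by (simp add: power_mono)
    also have "\<dots> = (norm z)\<^sup>2 + c\<^sup>2 * (norm e)\<^sup>2 - 2 * (c * inner z e)"
      by (simp add: power2_norm_eq_inner inner_diff_left inner_diff_right inner_commute
          power2_eq_square[of c])
    also have "c * inner z e = (inner z e)\<^sup>2 / (norm e)\<^sup>2"
      by (simp add: c_def power2_eq_square)
    also have "c\<^sup>2 * (norm e)\<^sup>2 = (inner z e)\<^sup>2 / (norm e)\<^sup>2"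
      using False by (simp add: c_def power2_eq_square)
    finally have "(inner z e)\<^sup>2 / (norm e)\<^sup>2 \<le> 0" by simp
    then show ?thesis using False by (simp add: divide_le_0_iff)
  qed simp
  then show ?thesis using zE by (intro bexI[of _ "x - z"]) auto
qed

text \<open>Real orthogonality to \<open>e\<close> and to \<open>\<i> *\<^sub>C e\<close> controls
  the real and the imaginary part of the complex inner product.\<close>

lemma orthogonal_decomposition:
  fixes E :: "'a::complex_hilbert set"
  assumes E: "csubspace E" "closed E"
  shows "\<exists>p\<in>E. \<forall>e\<in>E. cinner (x - p) e = 0"
proof -
  have "subspace E" using csubspaceD[OF E(1)] by (auto simp: subspace_def)
  from real_orthogonal_decomposition[OF this E(2), of x]
  obtain p where p: "p \<in> E" "\<And>e. e \<in> E \<Longrightarrow> inner (x - p) e = 0" by blast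
  have "cinner (x - p) e = 0" if e: "e \<in> E" for e
  proof -
    have "Re (cinner (x - p) (\<i> *\<^sub>C e)) = 0"
      using p(2)[OF csubspaceD(3)[OF E(1) e, of \<i>]] by (simp only: inner_eq_Re_cinner)
    moreover have "Re (cinner (x - p) e) = 0" using p(2)[OF e] by (simp only: inner_eq_Re_cinner)
    ultimately show ?thesis by (simp add: cinner_scaleC_right complex_eq_iff)
  qed
  then show ?thesis using p(1) by blast
qed

text \<open>The third property characterizes the values of \<open>P\<close>. Linearity is deduced
  from this uniqueness here, and commutation with operators in
  \<open>projection_in_commutant\<close>.\<close>

lemma orthogonal_projection:
  fixes E :: "'a::complex_hilbert set"
  assumes E: "csubspace E" "closed E"
  obtains P :: "'a \<Rightarrow>\<^sub>C\<^sub>L 'a" where "\<And>x. P x \<in> E" "\<And>x e. e \<in> E \<Longrightarrow> cinner (x - P x) e = 0"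
    "\<And>x p. p \<in> E \<Longrightarrow> (\<And>e. e \<in> E \<Longrightarrow> cinner (x - p) e = 0) \<Longrightarrow> P x = p"
proof -
  obtain p where p: "\<And>x. p x \<in> E" "\<And>x e. e \<in> E \<Longrightarrow> cinner (x - p x) e = 0"
    using orthogonal_decomposition[OF E] by metis
  have uniq: "p x = q" if q: "q \<in> E" "\<And>e. e \<in> E \<Longrightarrow> cinner (x - q) e = 0" for x q
  proof -
    have e: "q - p x \<in> E" using csubspaceD(6)[OF E(1)] q p by blast
    have "cinner (q - p x) (q - p x) = cinner (x - p x) (q - p x) - cinner (x - q) (q - p x)"
      by (simp add: cinner_diff_left)
    also have "\<dots> = 0" using p(2)[OF e] q(2)[OF e] by simp
    finally show ?thesis by simp
  qed
  have "p (x + y) = p x + p y" for x y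
  proof (rule uniq)
    show "p x + p y \<in> E" using csubspaceD(2)[OF E(1)] p by blast
    show "cinner (x + y - (p x + p y)) e = 0" if "e \<in> E" for e
      using p(2)[OF that, of x] p(2)[OF that, of y]
      by (simp add: cinner_diff_left cinner_add_left)
  qed
  moreover have "p (c *\<^sub>C x) = c *\<^sub>C p x" for c x
  proof (rule uniq)
    show "c *\<^sub>C p x \<in> E" using csubspaceD(3)[OF E(1)] p by blast
    show "cinner (c *\<^sub>C x - c *\<^sub>C p x) e = 0" if "e \<in> E" for e
      using p(2)[OF that, of x] unfolding scaleC_diff_right[symmetric] cinner_scaleC_left by simp
  qed
  moreover have "norm (p x) \<le> 1 * norm x" for x
  proof -
    have "(norm x)\<^sup>2 = (norm (x - p x))\<^sup>2 + (norm (p x))\<^sup>2"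
      using norm_add_sq[of "x - p x" "p x"] p by simp
    then have "(norm (p x))\<^sup>2 \<le> (norm x)\<^sup>2" by simp
    then show ?thesis using power2_le_imp_le[of "norm (p x)" "norm x"] by simp
  qed
  ultimately have "\<exists>P :: 'a \<Rightarrow>\<^sub>C\<^sub>L 'a. \<forall>x. P x = p x" by (rule Cblinfun_exists)
  then obtain P :: "'a \<Rightarrow>\<^sub>C\<^sub>L 'a" where "\<And>x. P x = p x" by blast
  then show ?thesis using p uniq that by metis
qed

lemma orthogonal_imp_dense:
  fixes E :: "'a::complex_hilbert set"
  assumes "csubspace E" "\<And>y. (\<And>e. e \<in> E \<Longrightarrow> cinner y e = 0) \<Longrightarrow> y = 0"
  shows "closure E = UNIV"
proof -
  have "x \<in> closure E" for x
  proof -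
    obtain p where p: "p \<in> closure E" "\<And>e. e \<in> closure E \<Longrightarrow> cinner (x - p) e = 0"
      using orthogonal_decomposition[OF csubspace_closure[OF assms(1)], of x] by auto
    have "x - p = 0" by (rule assms(2)) (use p(2) closure_subset in blast)
    then show ?thesis using p by simp
  qed
  then show ?thesis by auto
qed

section \<open>Riesz representation and adjoints\<close>

lemma riesz_representation:
  fixes f :: "'a::complex_hilbert \<Rightarrow> complex"
  assumes add: "\<And>x y. f (x + y) = f x + f y" and sc: "\<And>c x. f (c *\<^sub>C x) = c * f x"
    and bd: "\<And>x. cmod (f x) \<le> K * norm x"
  shows "\<exists>y. \<forall>x. f x = cinner x y"
proof -
  obtain F :: "'a \<Rightarrow>\<^sub>C\<^sub>L complex" where F: "\<And>x. F x = f x"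
    using Cblinfun_exists[of f K] assms by (auto simp: scaleC_complex_def)
  define E where "E = {x. F x = 0}"
  have E: "csubspace E" by (auto simp: csubspace_def E_def cblinfun_add_right cblinfun_scaleC_right)
  have "closed E" unfolding E_def by (intro closed_Collect_eq continuous_intros)
  note dec = orthogonal_decomposition[OF E this]
  show ?thesis
  proof (cases "\<forall>x. f x = 0")
    case True then show ?thesis by (intro exI[of _ 0]) simp
  next
    case False
    then obtain x0 where x0: "f x0 \<noteq> 0" by blast
    obtain p where p: "p \<in> E" "\<And>e. e \<in> E \<Longrightarrow> cinner (x0 - p) e = 0" using dec by blast
    define z where "z = x0 - p"
    have fz: "f z = f x0" using p(1) by (simp add: z_def E_def F[symmetric] cblinfun_diff_right)
    then have z: "z \<noteq> 0" using x0 F[of 0] by auto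
    have "f x = cinner x ((cnj (f z) / of_real ((norm z)\<^sup>2)) *\<^sub>C z)" for x
    proof -
      \<comment> \<open>This combination is killed by \<open>f\<close>, hence orthogonal to
        \<open>z\<close>; solving for \<open>f x\<close> gives the representing multiple of
        \<open>z\<close>.\<close>
      have "f z *\<^sub>C x - f x *\<^sub>C z \<in> E"
        by (simp add: E_def cblinfun_diff_right cblinfun_scaleC_right F[symmetric] scaleC_complex_def)
      then have "cinner (f z *\<^sub>C x - f x *\<^sub>C z) z = 0"
        using p(2) unfolding z_def[symmetric] by (subst cinner_sym_0) blast
      then have "f z * cinner x z = f x * of_real ((norm z)\<^sup>2)"
        by (simp add: cinner_diff_left cinner_scaleC_left cinner_self)
      then have "f x = f z * cinner x z / of_real ((norm z)\<^sup>2)" using z by simp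
      then show ?thesis by (simp add: cinner_scaleC_right)
    qed
    then show ?thesis by blast
  qed
qed

lemma adjoint_exists:
  fixes T :: "'h::complex_hilbert \<Rightarrow>\<^sub>C\<^sub>L 'h"
  obtains S :: "'h \<Rightarrow>\<^sub>C\<^sub>L 'h" where "\<And>x y. cinner (T x) y = cinner x (S y)"
proof -
  have "\<exists>z. \<forall>x. cinner (T x) y = cinner x z" for y
  proof (rule riesz_representation[where K = "norm T * norm y"])
    show "cmod (cinner (T x) y) \<le> norm T * norm y * norm x" for x
      using order_trans[OF cinner_norm_le mult_right_mono[OF cblinfun_apply_le norm_ge_zero]]
      by (simp add: ac_simps)
  qed (auto simp: cblinfun_add_right cinner_add_left cblinfun_scaleC_right cinner_scaleC_left)
  then obtain S where S: "\<And>x y. cinner (T x) y = cinner x (S y)" by metis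
  have "S (x + y) = S x + S y" for x y
    by (rule cinner_eqI_right) (simp add: S[symmetric] cinner_add_right)
  moreover have "S (c *\<^sub>C x) = c *\<^sub>C S x" for c x
    by (rule cinner_eqI_right) (simp add: S[symmetric] cinner_scaleC_right)
  moreover have "norm (S x) \<le> norm T * norm x" for x
  proof (cases "S x = 0")
    case False
    have "(norm (S x))\<^sup>2 = cmod (cinner (T (S x)) x)"
      unfolding S cinner_self norm_of_real by simp
    also have "\<dots> \<le> norm (T (S x)) * norm x" by (rule cinner_norm_le)
    also have "\<dots> \<le> (norm T * norm (S x)) * norm x"
      by (intro mult_right_mono cblinfun_apply_le) simp
    finally have "norm (S x) * norm (S x) \<le> (norm T * norm x) * norm (S x)"
      by (simp add: power2_eq_square ac_simps)
    then show ?thesis using False by simp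
  qed simp
  ultimately have "\<exists>S' :: 'h \<Rightarrow>\<^sub>C\<^sub>L 'h. \<forall>x. S' x = S x" by (rule Cblinfun_exists)
  then obtain S' :: "'h \<Rightarrow>\<^sub>C\<^sub>L 'h" where "\<And>x. S' x = S x" by blast
  then show ?thesis using that[of S'] by (simp add: S)
qed

text \<open>Existence and uniqueness together justify the definite description in
  \<open>cadjoint\<close>; later arguments about adjoints rest on this equation.\<close>

lemma cinner_adj_left: "cinner (T x) y = cinner x ((T\<^sup>\<dagger>) y)"
  for T :: "'h::complex_hilbert \<Rightarrow>\<^sub>C\<^sub>L 'h"
proof -
  obtain S :: "'h \<Rightarrow>\<^sub>C\<^sub>L 'h" where S: "\<And>x y. cinner (T x) y = cinner x (S y)"
    by (rule adjoint_exists) blast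
  have "\<forall>x y. cinner (T x) y = cinner x ((T\<^sup>\<dagger>) y)" unfolding cadjoint_def
  proof (rule theI[of _ S])
    fix R :: "'h \<Rightarrow>\<^sub>C\<^sub>L 'h" assume "\<forall>x y. cinner (T x) y = cinner x (R y)"
    then show "R = S" by (intro cblinfun_eqI cinner_eqI_right) (simp add: S[symmetric])
  qed (use S in blast)
  then show ?thesis by blast
qed

lemma cinner_adj_right: "cinner x (T y) = cinner ((T\<^sup>\<dagger>) x) y"
  for T :: "'h::complex_hilbert \<Rightarrow>\<^sub>C\<^sub>L 'h"
  by (metis cinner_commute cinner_adj_left)

lemma cadjoint_eqI: "(\<And>x y. cinner (T x) y = cinner x (S y)) \<Longrightarrow> T\<^sup>\<dagger> = S"
  for T S :: "'h::complex_hilbert \<Rightarrow>\<^sub>C\<^sub>L 'h"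
  by (intro cblinfun_eqI cinner_eqI_right) (simp add: cinner_adj_left[symmetric])

lemma cadjoint_cadjoint [simp]: "(T\<^sup>\<dagger>)\<^sup>\<dagger> = T" for T :: "'h::complex_hilbert \<Rightarrow>\<^sub>C\<^sub>L 'h"
  by (rule cadjoint_eqI) (simp add: cinner_adj_right)

lemma cadjoint_compose: "(S o\<^sub>C T)\<^sup>\<dagger> = T\<^sup>\<dagger> o\<^sub>C S\<^sup>\<dagger>" for S T :: "'h::complex_hilbert \<Rightarrow>\<^sub>C\<^sub>L 'h"
  by (rule cadjoint_eqI) (simp add: cinner_adj_left)

lemma unitaryI: "(\<And>x. (T\<^sup>\<dagger>) (T x) = x) \<Longrightarrow> (\<And>x. T ((T\<^sup>\<dagger>) x) = x) \<Longrightarrow> unitary T"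
  by (auto simp: unitary_def intro!: cblinfun_eqI)

lemma unitaryD:
  assumes "unitary T"
  shows "(T\<^sup>\<dagger>) (T x) = x" "T ((T\<^sup>\<dagger>) x) = x"
    "cinner (T x) (T y) = cinner x y" "norm (T x) = norm x"
proof -
  have *: "(T\<^sup>\<dagger>) (T x) = x" for x
    using assms unfolding unitary_def by (metis cblinfun_compose_apply cblinfun_id_apply)
  then show "(T\<^sup>\<dagger>) (T x) = x" .
  show "T ((T\<^sup>\<dagger>) x) = x"
    using assms unfolding unitary_def by (metis cblinfun_compose_apply cblinfun_id_apply)
  show **: "cinner (T x) (T y) = cinner x y" for x y by (simp add: cinner_adj_left *)
  show "norm (T x) = norm x" unfolding norm_eq_iff_cinner by (rule **)
qed

lemma unitary_cadjoint: "unitary T \<Longrightarrow> unitary (T\<^sup>\<dagger>)"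
  by (simp add: unitary_def)

section \<open>Integer powers of a unitary\<close>

lemma int_iterate_0 [simp]: "int_iterate f 0 = id"
  by (simp add: int_iterate_def)

lemma int_iterate_succ:
  assumes "bij f" shows "int_iterate f (k + 1) x = f (int_iterate f k x)"
proof (cases "0 \<le> k")
  case True
  then show ?thesis by (simp add: int_iterate_def nat_add_distrib)
next
  case False
  then have "nat (- k) = Suc (nat (- (k + 1)))" by linarith
  then have "int_iterate f k x = inv f ((inv f ^^ nat (- (k + 1))) x)"
    using False by (simp add: int_iterate_def)
  then have "f (int_iterate f k x) = (inv f ^^ nat (- (k + 1))) x"
    using assms by (simp add: bij_is_surj surj_f_inv_f)
  then show ?thesis using False by (auto simp: int_iterate_def)
qed

lemma int_iterate_pred:
  assumes "bij f" shows "int_iterate f (k - 1) x = inv f (int_iterate f k x)"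
  using int_iterate_succ[OF assms, of "k - 1" x] assms by (simp add: bij_is_inj inv_f_f)

text \<open>Negative powers are powers of the adjoint, which for a unitary is the inverse. The
  iteration takes place on operators, so that a power can again be conjugated, composed and
  adjoined.\<close>

definition upow :: "'h::complex_hilbert \<Rightarrow>\<^sub>C\<^sub>L 'h \<Rightarrow> int \<Rightarrow> 'h \<Rightarrow>\<^sub>C\<^sub>L 'h" where
  "upow U k = (if 0 \<le> k then ((\<lambda>T. U o\<^sub>C T) ^^ nat k) cblinfun_id
     else ((\<lambda>T. U\<^sup>\<dagger> o\<^sub>C T) ^^ nat (- k)) cblinfun_id)"

lemma upow_0 [simp]: "upow U 0 = cblinfun_id"
  by (simp add: upow_def)

lemma upow_1 [simp]: "upow U 1 = U"
  by (auto simp: upow_def intro!: cblinfun_eqI)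

lemma upow_succ:
  assumes "unitary U" shows "upow U (k + 1) x = U (upow U k x)"
proof (cases "0 \<le> k")
  case True
  then show ?thesis by (simp add: upow_def nat_add_distrib)
next
  case False
  then have "nat (- k) = Suc (nat (- (k + 1)))" by linarith
  then show ?thesis using False
    by (cases "k + 1 = 0") (auto simp: upow_def unitaryD[OF assms])
qed

lemma upow_Suc: "unitary U \<Longrightarrow> upow U (int (Suc n)) x = U (upow U (int n) x)"
  using upow_succ[of U "int n" x] by (simp add: add.commute)

lemma upow_pred:
  assumes "unitary U" shows "upow U (k - 1) x = (U\<^sup>\<dagger>) (upow U k x)"
  using upow_succ[OF assms, of "k - 1" x] by (simp add: unitaryD[OF assms])

lemma upow_add:
  assumes "unitary U" shows "upow U (j + k) x = upow U j (upow U k x)"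
proof (induction j rule: int_induct[where k = 0])
  case (step1 i)
  then show ?case using upow_succ[OF assms, of "i + k" x] upow_succ[OF assms, of i "upow U k x"]
    by (simp add: ac_simps)
next
  case (step2 i)
  then show ?case using upow_pred[OF assms, of "i + k" x] upow_pred[OF assms, of i "upow U k x"]
    by (simp add: algebra_simps)
qed simp

lemma upow_cancel:
  assumes "unitary U" shows "upow U (- k) (upow U k x) = x" "upow U k (upow U (- k) x) = x"
  using upow_add[OF assms, of "- k" k x] upow_add[OF assms, of k "- k" x] by auto

lemma norm_upow [simp]: "unitary U \<Longrightarrow> norm (upow U k x) = norm x"
  by (induction k rule: int_induct[where k = 0])
    (simp_all add: upow_succ upow_pred unitaryD(4) unitary_cadjoint)

lemma cinner_upow: "unitary U \<Longrightarrow> cinner (upow U k x) (upow U k y) = cinner x y"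
  by (induction k rule: int_induct[where k = 0])
    (simp_all add: upow_succ upow_pred unitaryD(3) unitary_cadjoint)

lemma cinner_upow_left: "unitary U \<Longrightarrow> cinner (upow U k x) y = cinner x (upow U (- k) y)"
  using cinner_upow[of U "- k" "upow U k x" y] by (simp add: upow_cancel)

lemma upow_cadjoint: "unitary U \<Longrightarrow> (upow U k)\<^sup>\<dagger> = upow U (- k)"
  by (rule cadjoint_eqI) (simp add: cinner_upow_left)

lemma unitary_upow: "unitary U \<Longrightarrow> unitary (upow U k)"
  by (rule unitaryI) (simp_all add: upow_cadjoint upow_cancel)

lemma upow_upow:
  assumes "unitary U" shows "upow (upow U k) j x = upow U (j * k) x"
proof (induction j rule: int_induct[where k = 0])
  case (step1 i)
  then show ?case
    using upow_succ[OF unitary_upow[OF assms], of k i x]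
    by (simp add: upow_add[OF assms, symmetric] algebra_simps)
next
  case (step2 i)
  then show ?case
    using upow_pred[OF unitary_upow[OF assms], of k i x]
    by (simp add: upow_cadjoint[OF assms] upow_add[OF assms, symmetric] algebra_simps)
qed simp

lemma upow_eigen:
  assumes U: "unitary U" and x: "U x = v *\<^sub>C x" and v: "cmod v = 1"
  shows "upow U k x = (v powi k) *\<^sub>C x"
proof -
  have v0: "v \<noteq> 0" using v by auto
  have adj: "(U\<^sup>\<dagger>) x = inverse v *\<^sub>C x"
    using unitaryD(1)[OF U, of x] v0 by (simp add: x cblinfun_scaleC_right) (metis scaleC_cancel)
  show ?thesis
  proof (induction k rule: int_induct[where k = 0])
    case (step1 i)
    then show ?case
      using v0 by (simp add: upow_succ[OF U] cblinfun_scaleC_right x scaleC_scaleC power_int_add)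
  next
    case (step2 i)
    then show ?case
      using v0 by (simp add: upow_pred[OF U] cblinfun_scaleC_right adj scaleC_scaleC
          power_int_diff divide_inverse)
  qed simp
qed

lemma eigenvalue_unimodular:
  assumes "unitary U" "U x = v *\<^sub>C x" "x \<noteq> 0" shows "cmod v = 1"
  using unitaryD(4)[OF assms(1), of x] assms by (simp add: norm_scaleC)

lemma eigenvectors_orthogonal:
  assumes U: "unitary U" and "U x = v *\<^sub>C x" "U y = w *\<^sub>C y" "v \<noteq> w"
  shows "cinner x y = 0"
proof (cases "x = 0 \<or> y = 0")
  case False
  then have v: "cmod v = 1" "cmod w = 1" using eigenvalue_unimodular assms by blast+
  have "w * cnj w = 1" using v(2) by (metis complex_norm_square mult.commute of_real_1 one_power2)
  have "cinner x y = cinner (v *\<^sub>C x) (w *\<^sub>C y)"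
    using unitaryD(3)[OF U, of x y] by (simp add: assms(2,3))
  also have "\<dots> = v * cnj w * cinner x y" by (simp add: cinner_scaleC_left cinner_scaleC_right)
  finally have "w * cinner x y = w * (v * cnj w * cinner x y)" by (rule arg_cong)
  then have "w * cinner x y = v * (w * cnj w) * cinner x y" by (simp add: ac_simps)
  then have "(w - v) * cinner x y = 0" using \<open>w * cnj w = 1\<close> by (simp add: algebra_simps)
  then show ?thesis using assms(4) by simp
qed auto

section \<open>Commutants\<close>

lemma commutantD:
  fixes T X :: "'h::complex_hilbert \<Rightarrow>\<^sub>C\<^sub>L 'h"
  shows "T \<in> commutant S \<Longrightarrow> X \<in> S \<Longrightarrow> T (X x) = X (T x)"
  unfolding commutant_def by (metis (mono_tags, lifting) cblinfun_compose_apply mem_Collect_eq)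

lemma commutantI:
  fixes T :: "'h::complex_hilbert \<Rightarrow>\<^sub>C\<^sub>L 'h" and S :: "('h \<Rightarrow>\<^sub>C\<^sub>L 'h) set"
  shows "(\<And>X x. X \<in> S \<Longrightarrow> T (X x) = X (T x)) \<Longrightarrow> T \<in> commutant S"
  by (auto simp: commutant_def intro!: cblinfun_eqI)

lemma commutant_bicommutant: "S \<subseteq> commutant (commutant S)"
  by (auto simp: commutant_def)

lemma commutant_cadjoint:
  fixes S :: "('h::complex_hilbert \<Rightarrow>\<^sub>C\<^sub>L 'h) set"
  assumes "\<And>X. X \<in> S \<Longrightarrow> X\<^sup>\<dagger> \<in> S" "T \<in> commutant S"
  shows "T\<^sup>\<dagger> \<in> commutant S"
proof (rule commutantI)
  fix X x assume X: "X \<in> S"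
  show "(T\<^sup>\<dagger>) (X x) = X ((T\<^sup>\<dagger>) x)"
    by (rule cinner_eqI_right)
      (simp add: cinner_adj_left[symmetric] cinner_adj_right commutantD[OF assms(2) assms(1)[OF X]])
qed

lemma commutant_compose: "S \<in> commutant X \<Longrightarrow> T \<in> commutant X \<Longrightarrow> S o\<^sub>C T \<in> commutant X"
  by (rule commutantI) (simp add: commutantD)

lemma commutant_id [simp]: "cblinfun_id \<in> commutant X"
  by (rule commutantI) simp

lemma commutant_add: "S \<in> commutant X \<Longrightarrow> T \<in> commutant X \<Longrightarrow> S + T \<in> commutant X"
  by (rule commutantI) (simp add: commutantD cblinfun_add_right)

lemma commutant_scaleC: "S \<in> commutant X \<Longrightarrow> c *\<^sub>C S \<in> commutant X"
  by (rule commutantI) (simp add: commutantD cblinfun_scaleC_right)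

lemma commutant_diff: "S \<in> commutant X \<Longrightarrow> T \<in> commutant X \<Longrightarrow> S - T \<in> commutant X"
  by (rule commutantI) (simp add: commutantD cblinfun_diff_right)

lemma csubspace_commutant_orbit: "csubspace ((\<lambda>T. cblinfun_apply T x) ` commutant X)"
  unfolding csubspace_def
proof (intro conjI ballI allI)
  show "0 \<in> (\<lambda>T. cblinfun_apply T x) ` commutant X"
    by (rule rev_image_eqI[of 0]) (auto intro: commutantI)
  fix a assume "a \<in> (\<lambda>T. cblinfun_apply T x) ` commutant X"
  then obtain S where S: "S \<in> commutant X" "a = S x" by blast
  show "c *\<^sub>C a \<in> (\<lambda>T. cblinfun_apply T x) ` commutant X" for c
    by (rule rev_image_eqI[OF commutant_scaleC[OF S(1)]]) (simp add: S(2))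
  fix b assume "b \<in> (\<lambda>T. cblinfun_apply T x) ` commutant X"
  then obtain T where T: "T \<in> commutant X" "b = T x" by blast
  show "a + b \<in> (\<lambda>T. cblinfun_apply T x) ` commutant X"
    by (rule rev_image_eqI[OF commutant_add[OF S(1) T(1)]]) (simp add: S(2) T(2))
qed

lemma commutant_conj:
  fixes S :: "('h::complex_hilbert \<Rightarrow>\<^sub>C\<^sub>L 'h) set"
  assumes U: "unitary U" and S: "\<And>X. X \<in> S \<Longrightarrow> U\<^sup>\<dagger> o\<^sub>C X o\<^sub>C U \<in> S" and T: "T \<in> commutant S"
  shows "U o\<^sub>C T o\<^sub>C U\<^sup>\<dagger> \<in> commutant S"
proof (rule commutantI)
  fix X x assume X: "X \<in> S"
  have "T ((U\<^sup>\<dagger>) (X x)) = T ((U\<^sup>\<dagger> o\<^sub>C X o\<^sub>C U) ((U\<^sup>\<dagger>) x))" by (simp add: unitaryD[OF U])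
  also have "\<dots> = (U\<^sup>\<dagger>) (X (U (T ((U\<^sup>\<dagger>) x))))" by (simp only: commutantD[OF T S[OF X]]) simp
  finally show "(U o\<^sub>C T o\<^sub>C U\<^sup>\<dagger>) (X x) = X ((U o\<^sub>C T o\<^sub>C U\<^sup>\<dagger>) x)" by (simp add: unitaryD[OF U])
qed

text \<open>For a set of operators closed under adjoints an invariant subspace is reducing:
  \<open>X (P x)\<close> lies in \<open>E\<close>, and moving \<open>X\<close> to the other side
  shows that it satisfies the characterization of \<open>P (X x)\<close>.\<close>

lemma projection_in_commutant:
  fixes P :: "'h::complex_hilbert \<Rightarrow>\<^sub>C\<^sub>L 'h" and S :: "('h \<Rightarrow>\<^sub>C\<^sub>L 'h) set"
  assumes E: "csubspace E" and S: "\<And>X. X \<in> S \<Longrightarrow> X\<^sup>\<dagger> \<in> S" "\<And>X e. X \<in> S \<Longrightarrow> e \<in> E \<Longrightarrow> X e \<in> E"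
    and P: "\<And>x. P x \<in> E" "\<And>x e. e \<in> E \<Longrightarrow> cinner (x - P x) e = 0"
      "\<And>x p. p \<in> E \<Longrightarrow> (\<And>e. e \<in> E \<Longrightarrow> cinner (x - p) e = 0) \<Longrightarrow> P x = p"
  shows "P \<in> commutant S"
proof (rule commutantI, rule P(3))
  fix X x assume X: "X \<in> S"
  show "X (P x) \<in> E" using S(2) X P(1) by blast
  show "cinner (X x - X (P x)) e = 0" if e: "e \<in> E" for e
  proof -
    have "(X\<^sup>\<dagger>) e \<in> E" using S X e by blast
    then show ?thesis using P(2) by (simp add: cblinfun_diff_right[symmetric] cinner_adj_left)
  qed
qed

section \<open>Ergodic averages\<close>

text \<open>At \<open>N = 0\<close> the factor \<open>1 / 0\<close> is \<open>0\<close>, so norm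
  bounds hold for every \<open>N\<close>, while averages of a constant need
  \<open>0 < N\<close>.\<close>

definition cesaro :: "(nat \<Rightarrow> 'a::real_vector) \<Rightarrow> nat \<Rightarrow> 'a" where
  "cesaro f N = (1 / real N) *\<^sub>R (\<Sum>n<N. f n)"

lemma cesaro_add: "cesaro (\<lambda>n. f n + g n) N = cesaro f N + cesaro g N"
  by (simp add: cesaro_def sum.distrib scaleR_add_right)

lemma cesaro_diff: "cesaro (\<lambda>n. f n - g n) N = cesaro f N - cesaro g N"
  by (simp add: cesaro_def sum_subtractf scaleR_diff_right)

lemma cesaro_scaleC: "cesaro (\<lambda>n. c *\<^sub>C f n) N = c *\<^sub>C cesaro f N"
  by (simp add: cesaro_def scaleC_sum_right[symmetric] scaleR_scaleC_commute)

lemma cesaro_scaleR: "cesaro (\<lambda>n. r *\<^sub>R f n) N = r *\<^sub>R cesaro f N"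
  by (simp add: cesaro_def scaleR_sum_right[symmetric] mult.commute)

lemma cesaro_sum: "cesaro (\<lambda>n. \<Sum>i\<in>A. f i n) N = (\<Sum>i\<in>A. cesaro (f i) N)"
  unfolding cesaro_def by (subst sum.swap) (simp add: scaleR_sum_right)

lemma cesaro_const: "0 < N \<Longrightarrow> cesaro (\<lambda>_. x) N = x"
  by (simp add: cesaro_def sum_constant_scaleR)

lemma cesaro_const_tendsto: "cesaro (\<lambda>_. x) \<longlonglongrightarrow> x" for x :: "'a::real_normed_vector"
  by (rule tendsto_eventually) (auto intro!: eventually_sequentiallyI[of 1] cesaro_const)

lemma cesaro_cblinfun: "cesaro (\<lambda>n. cblinfun_apply T (f n)) N = cblinfun_apply T (cesaro f N)"
  by (simp add: cesaro_def cblinfun_scaleR_right cblinfun_sum_right)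

lemma cesaro_cinner_left: "cesaro (\<lambda>n. cinner (f n) y) N = cinner (cesaro f N) y"
  by (simp add: cesaro_def cinner_scaleR_left cinner_sum_left scaleR_conv_of_real)

lemma cesaro_of_real: "cesaro (\<lambda>n. complex_of_real (f n)) N = complex_of_real (cesaro f N)"
  by (simp add: cesaro_def scaleR_conv_of_real)

lemma norm_cesaro_le:
  fixes f :: "nat \<Rightarrow> 'a::real_normed_vector"
  assumes "\<And>n. norm (f n) \<le> K" "0 \<le> K"
  shows "norm (cesaro f N) \<le> K"
proof (cases "N = 0")
  case False
  have "norm (\<Sum>n<N. f n) \<le> real N * K"
    using sum_norm_bound[of "{..<N}" f K] assms by simp
  then show ?thesis using False by (simp add: cesaro_def field_simps)
qed (use assms in \<open>simp add: cesaro_def\<close>)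

lemma cesaro_Suc_shift:
  "cesaro (\<lambda>n. f (Suc n)) N - cesaro f N = (1 / real N) *\<^sub>R (f N - f 0)"
  unfolding cesaro_diff[symmetric] by (simp add: cesaro_def sum_lessThan_telescope)

lemma norm_cesaro_Suc_shift:
  fixes f :: "nat \<Rightarrow> 'a::real_normed_vector"
  assumes "\<And>n. norm (f n) \<le> K"
  shows "norm (cesaro (\<lambda>n. f (Suc n)) N - cesaro f N) \<le> 2 * K / real N"
proof -
  have "norm (f N - f 0) \<le> 2 * K"
    using norm_triangle_ineq4[of "f N" "f 0"] assms[of N] assms[of 0] by linarith
  then show ?thesis unfolding cesaro_Suc_shift by (simp add: divide_right_mono)
qed

text \<open>A shift by one changes only the two boundary terms of the sum, an error of at most
  \<open>2 * K / N\<close>; \<open>h\<close> such errors add up.\<close>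

lemma cesaro_shift_tendsto:
  fixes f :: "nat \<Rightarrow> 'a::real_normed_vector"
  assumes "\<And>n. norm (f n) \<le> K"
  shows "(\<lambda>N. cesaro (\<lambda>n. f (n + h)) N - cesaro f N) \<longlonglongrightarrow> 0"
proof (induction h)
  case (Suc h)
  have "(\<lambda>N. cesaro (\<lambda>n. f (Suc n + h)) N - cesaro (\<lambda>n. f (n + h)) N) \<longlonglongrightarrow> 0"
  proof (rule Lim_null_comparison)
    show "\<forall>\<^sub>F N in sequentially. norm (cesaro (\<lambda>n. f (Suc n + h)) N - cesaro (\<lambda>n. f (n + h)) N)
        \<le> 2 * K / real N"
      using norm_cesaro_Suc_shift[of "\<lambda>n. f (n + h)"] assms by simp
  qed (rule lim_const_over_n)
  from tendsto_add[OF this Suc] show ?case by simp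
qed simp

text \<open>Whole sequences are kept instead of their values at one index: this makes stationarity
  and the comparison of averages provable by induction on how a combination is generated.\<close>

inductive_set shift_hull :: "(nat \<Rightarrow> 'a::real_vector) \<Rightarrow> (nat \<Rightarrow> 'a) set" for \<xi> where
  base: "\<xi> \<in> shift_hull \<xi>"
| shift: "g \<in> shift_hull \<xi> \<Longrightarrow> (\<lambda>n. g (Suc n)) \<in> shift_hull \<xi>"
| convex: "f \<in> shift_hull \<xi> \<Longrightarrow> g \<in> shift_hull \<xi> \<Longrightarrow> 0 \<le> t \<Longrightarrow> t \<le> 1 \<Longrightarrow>
    (\<lambda>n. (1 - t) *\<^sub>R f n + t *\<^sub>R g n) \<in> shift_hull \<xi>"

text \<open>Only inner products are required to be shift invariant. The ergodic theorem then applies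
  to sequences of tensors without a tensor product of unitaries being constructed as an
  operator.\<close>

definition stationary :: "(nat \<Rightarrow> 'a::complex_hilbert) \<Rightarrow> bool" where
  "stationary \<xi> \<longleftrightarrow> (\<forall>n m. cinner (\<xi> (Suc n)) (\<xi> (Suc m)) = cinner (\<xi> n) (\<xi> m))"

lemma stationary_inner: "stationary \<xi> \<Longrightarrow> inner (\<xi> (Suc n)) (\<xi> (Suc m)) = inner (\<xi> n) (\<xi> m)"
  by (simp add: stationary_def inner_eq_Re_cinner)

lemma shift_hull_stationary:
  assumes \<xi>: "stationary \<xi>" and "f \<in> shift_hull \<xi>" "g \<in> shift_hull \<xi>"
  shows "inner (f (Suc n)) (g (Suc m)) = inner (f n) (g m)"
proof -
  have *: "inner (\<xi> (Suc n)) (g (Suc m)) = inner (\<xi> n) (g m)" if "g \<in> shift_hull \<xi>" for g n m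
    using that by (induction arbitrary: n m)
      (simp_all add: stationary_inner[OF \<xi>] inner_add_right inner_scaleR_right)
  show ?thesis using assms(2,3)
    by (induction arbitrary: n m) (simp_all add: * inner_add_left inner_scaleR_left)
qed

lemma shift_hull_norm: "stationary \<xi> \<Longrightarrow> g \<in> shift_hull \<xi> \<Longrightarrow> norm (g n) = norm (g 0)"
  by (induction n) (simp_all add: norm_eq_sqrt_inner shift_hull_stationary)

lemma stationary_norm: "stationary \<xi> \<Longrightarrow> norm (\<xi> n) = norm (\<xi> 0)"
  by (rule shift_hull_norm[OF _ shift_hull.base])

text \<open>A shift costs a boundary term of order \<open>1 / N\<close> and a convex combination
  only averages the errors; the constant \<open>c\<close> depends on \<open>g\<close> but not on
  \<open>N\<close>.\<close>

lemma shift_hull_cesaro_diff: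
  assumes \<xi>: "stationary \<xi>" and g: "g \<in> shift_hull \<xi>"
  shows "\<exists>c. \<forall>N. norm (cesaro g N - cesaro \<xi> N) \<le> c / real N"
  using g
proof induction
  case base show ?case by (intro exI[of _ 0]) simp
next
  case (shift g)
  then obtain c where c: "\<And>N. norm (cesaro g N - cesaro \<xi> N) \<le> c / real N" by blast
  have "norm (cesaro (\<lambda>n. g (Suc n)) N - cesaro \<xi> N) \<le> (2 * norm (g 0) + c) / real N" for N
  proof -
    have "norm (cesaro (\<lambda>n. g (Suc n)) N - cesaro \<xi> N)
        \<le> norm (cesaro (\<lambda>n. g (Suc n)) N - cesaro g N) + norm (cesaro g N - cesaro \<xi> N)"
      by (rule norm_diff_triangle_le) auto
    also have "\<dots> \<le> 2 * norm (g 0) / real N + c / real N"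
      by (intro add_mono c norm_cesaro_Suc_shift) (rule eq_refl[OF shift_hull_norm[OF \<xi> shift.hyps]])
    finally show ?thesis by (simp add: add_divide_distrib)
  qed
  then show ?case by blast
next
  case (convex f g t)
  then obtain c d where c: "\<And>N. norm (cesaro f N - cesaro \<xi> N) \<le> c / real N"
    and d: "\<And>N. norm (cesaro g N - cesaro \<xi> N) \<le> d / real N" by blast
  have "norm (cesaro (\<lambda>n. (1 - t) *\<^sub>R f n + t *\<^sub>R g n) N - cesaro \<xi> N)
      \<le> ((1 - t) * c + t * d) / real N" for N
  proof -
    have "cesaro (\<lambda>n. (1 - t) *\<^sub>R f n + t *\<^sub>R g n) N - cesaro \<xi> N
        = (1 - t) *\<^sub>R (cesaro f N - cesaro \<xi> N) + t *\<^sub>R (cesaro g N - cesaro \<xi> N)"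
      unfolding cesaro_add cesaro_scaleR by (simp add: algebra_simps)
    also have "norm \<dots> \<le> (1 - t) * norm (cesaro f N - cesaro \<xi> N) + t * norm (cesaro g N - cesaro \<xi> N)"
      using norm_triangle_ineq convex.hyps by (metis abs_of_nonneg diff_ge_0_iff_ge norm_scaleR)
    also have "\<dots> \<le> (1 - t) * (c / real N) + t * (d / real N)"
      using convex.hyps by (intro add_mono mult_left_mono c d) auto
    finally show ?thesis by (simp add: add_divide_distrib)
  qed
  then show ?case by blast
qed

text \<open>The averages minimize the norm on the hull of the shifts: an average of shifts of \<open>g\<close> in the
  hull is no longer than \<open>g 0\<close> and asymptotically does not depend on \<open>g\<close>.\<close>

theorem mean_ergodic_stationary:
  assumes \<xi>: "stationary \<xi>"
  shows "convergent (cesaro \<xi>)"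
proof -
  define C where "C = (\<lambda>g. g 0) ` shift_hull \<xi>"
  define d where "d = Inf (norm ` C)"
  have ne: "C \<noteq> {}" using shift_hull.base by (auto simp: C_def)
  have d: "d \<le> norm c" if "c \<in> C" for c
    unfolding d_def by (rule cInf_lower) (use that in \<open>auto intro: bdd_belowI2[of _ 0]\<close>)
  have d0: "0 \<le> d" unfolding d_def by (rule cInf_greatest) (use ne in auto)
  have conv: "convex C"
  proof (rule convexI)
    fix x y and u v :: real assume "x \<in> C" "y \<in> C" and uv: "0 \<le> u" "0 \<le> v" "u + v = 1"
    then obtain f g where fg: "f \<in> shift_hull \<xi>" "g \<in> shift_hull \<xi>" "x = f 0" "y = g 0"
      by (auto simp: C_def)
    have "u = 1 - v" "v \<le> 1" using uv by auto
    then show "u *\<^sub>R x + v *\<^sub>R y \<in> C"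
      using shift_hull.convex[OF fg(1,2) uv(2)] by (force simp: C_def fg)
  qed
  have shifts: "(\<lambda>n. \<xi> (n + N)) \<in> shift_hull \<xi>" for N
    using shift_hull.shift by (induction N) (force simp: shift_hull.base)+
  have mem: "(\<lambda>n. cesaro (\<lambda>i. \<xi> (n + i)) (Suc N)) \<in> shift_hull \<xi>" for N
  proof (induction N)
    case 0 show ?case by (simp add: cesaro_def shift_hull.base)
  next
    case (Suc N)
    \<comment> \<open>The weight of the last summand in an average of \<open>N + 2\<close> terms;
      the first \<open>N + 1\<close> terms keep the weight \<open>1 - t\<close>.\<close>
    define t where "t = 1 / real (Suc (Suc N))"
    have t: "(1 - t) / real (Suc N) = t" by (simp add: t_def divide_simps)
    have "cesaro (\<lambda>i. \<xi> (n + i)) (Suc (Suc N))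
        = (1 - t) *\<^sub>R cesaro (\<lambda>i. \<xi> (n + i)) (Suc N) + t *\<^sub>R \<xi> (n + Suc N)" for n
      unfolding cesaro_def scaleR_scaleR
      by (simp add: t del: of_nat_Suc sum.lessThan_Suc) (simp add: t_def scaleR_add_right)
    then show ?case using shift_hull.convex[OF Suc shifts[of "Suc N"], of t]
      by (simp add: t_def del: of_nat_Suc)
  qed
  have inC: "cesaro \<xi> (Suc N) \<in> C" for N
    unfolding C_def by (rule rev_image_eqI[OF mem[of N]]) simp
  have lim: "(\<lambda>N. norm (cesaro \<xi> (Suc N))) \<longlonglongrightarrow> d"
  proof (rule LIMSEQ_I)
    fix r :: real assume r: "0 < r"
    then have "\<exists>x\<in>norm ` C. x < d + r / 2"
      using cInf_lessD[of "norm ` C" "d + r / 2"] ne by (auto simp: d_def)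
    then obtain g where g: "g \<in> shift_hull \<xi>" "norm (g 0) < d + r / 2" by (auto simp: C_def)
    obtain c where c: "\<And>N. norm (cesaro g N - cesaro \<xi> N) \<le> c / real N"
      using shift_hull_cesaro_diff[OF \<xi> g(1)] by blast
    have "(\<lambda>N. c / real (Suc N)) \<longlonglongrightarrow> 0"
      by (rule LIMSEQ_Suc[OF lim_const_over_n])
    then have "\<forall>\<^sub>F N in sequentially. dist (c / real (Suc N)) 0 < r / 2"
      using r by (intro tendstoD) auto
    then obtain N0 where N0: "\<And>N. N \<ge> N0 \<Longrightarrow> \<bar>c / real (Suc N)\<bar> < r / 2"
      by (auto simp: eventually_sequentially)
    have "norm (norm (cesaro \<xi> (Suc N)) - d) < r" if "N \<ge> N0" for N
    proof -
      have "norm (cesaro \<xi> (Suc N)) \<le> norm (cesaro g (Suc N)) + norm (cesaro g (Suc N) - cesaro \<xi> (Suc N))"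
        by (metis norm_minus_commute norm_triangle_sub)
      also have "\<dots> \<le> norm (g 0) + c / real (Suc N)"
        by (intro add_mono c norm_cesaro_le) (auto intro: eq_refl shift_hull_norm[OF \<xi> g(1)])
      finally have "norm (cesaro \<xi> (Suc N)) < d + r" using g(2) N0[OF that] by linarith
      then show ?thesis using d[OF inC[of N]] by simp
    qed
    then show "\<exists>no. \<forall>n\<ge>no. norm (norm (cesaro \<xi> (Suc n)) - d) < r" by blast
  qed
  have "Cauchy (\<lambda>N. cesaro \<xi> (Suc N))" by (rule Cauchy_norm_minimizing[OF conv d d0 inC lim])
  then have "convergent (\<lambda>N. cesaro \<xi> (Suc N))" by (rule Cauchy_convergent)
  then show ?thesis by (simp add: convergent_Suc_iff)
qed

text \<open>The limit is fixed because \<open>T\<close> acts on the averages as a shift. Pairing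
  with a fixed \<open>y\<close> is constant along the orbit, so the last property says that
  \<open>z\<close> is the projection of \<open>\<xi> 0\<close> to the fixed vectors.\<close>

theorem mean_ergodic_unitary:
  fixes \<xi> :: "nat \<Rightarrow> 'h::complex_hilbert"
  assumes T: "unitary T" and \<xi>: "\<And>n. \<xi> (Suc n) = T (\<xi> n)"
  obtains z where "cesaro \<xi> \<longlonglongrightarrow> z" "T z = z" "\<And>y. T y = y \<Longrightarrow> cinner z y = cinner (\<xi> 0) y"
proof -
  have st: "stationary \<xi>" by (simp add: stationary_def \<xi> unitaryD[OF T])
  then obtain z where z: "cesaro \<xi> \<longlonglongrightarrow> z"
    using mean_ergodic_stationary convergent_def by blast
  have "(\<lambda>N. cesaro (\<lambda>n. \<xi> (n + 1)) N - cesaro \<xi> N) \<longlonglongrightarrow> 0"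
    by (rule cesaro_shift_tendsto[where K = "norm (\<xi> 0)"]) (rule eq_refl[OF stationary_norm[OF st]])
  then have "(\<lambda>N. T (cesaro \<xi> N) - cesaro \<xi> N) \<longlonglongrightarrow> 0"
    by (simp add: \<xi> cesaro_cblinfun)
  moreover have "(\<lambda>N. T (cesaro \<xi> N) - cesaro \<xi> N) \<longlonglongrightarrow> T z - z" by (intro tendsto_intros z)
  ultimately have "T z - z = 0" by (rule LIMSEQ_unique[rotated])
  moreover have "cinner z y = cinner (\<xi> 0) y" if "T y = y" for y
  proof -
    have "cinner (\<xi> n) y = cinner (\<xi> 0) y" for n
      by (induction n) (simp, metis \<xi> that unitaryD(3)[OF T])
    then have "(\<lambda>_. cinner (\<xi> 0) y) = (\<lambda>n. cinner (\<xi> n) y)" by metis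
    then have "cesaro (\<lambda>_. cinner (\<xi> 0) y) = cesaro (\<lambda>n. cinner (\<xi> n) y)"
      by (rule arg_cong)
    also have "\<dots> = (\<lambda>N. cinner (cesaro \<xi> N) y)"
      by (rule ext) (rule cesaro_cinner_left)
    finally have "cesaro (\<lambda>_. cinner (\<xi> 0) y) = (\<lambda>N. cinner (cesaro \<xi> N) y)" .
    moreover have "(\<lambda>N. cinner (cesaro \<xi> N) y) \<longlonglongrightarrow> cinner z y" by (intro tendsto_intros z)
    ultimately show ?thesis using LIMSEQ_unique[OF cesaro_const_tendsto] by metis
  qed
  ultimately show ?thesis using z that by auto
qed

lemma mean_ergodic_one_dimensional:
  assumes U: "unitary U" and \<Omega>: "U \<Omega> = \<Omega>" "norm \<Omega> = 1"
    and fixed: "\<And>x. U x = x \<Longrightarrow> \<exists>c. x = c *\<^sub>C \<Omega>"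
  shows "cesaro (\<lambda>n. upow U (int n) x) \<longlonglongrightarrow> cinner x \<Omega> *\<^sub>C \<Omega>"
proof -
  obtain z where z: "cesaro (\<lambda>n. upow U (int n) x) \<longlonglongrightarrow> z" "U z = z"
    "\<And>y. U y = y \<Longrightarrow> cinner z y = cinner (upow U (int 0) x) y"
    by (rule mean_ergodic_unitary[OF U, of "\<lambda>n. upow U (int n) x"])
      (simp_all only: upow_Suc[OF U])
  obtain c where c: "z = c *\<^sub>C \<Omega>" using fixed[OF z(2)] by blast
  have "cinner z \<Omega> = cinner x \<Omega>" using z(3)[OF \<Omega>(1)] by simp
  then have "c = cinner x \<Omega>" using \<Omega>(2) by (simp add: c cinner_scaleC_left cinner_self)
  then show ?thesis using z(1) c by simp
qed

lemma norm_cesaro_squared_le: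
  fixes f :: "nat \<Rightarrow> 'a::real_normed_vector"
  shows "(norm (cesaro f N))\<^sup>2 \<le> cesaro (\<lambda>n. (norm (f n))\<^sup>2) N"
proof (cases "N = 0")
  case False
  have "(norm (\<Sum>n<N. f n))\<^sup>2 \<le> (\<Sum>n<N. norm (f n))\<^sup>2"
    by (intro power_mono norm_sum) simp
  also have "\<dots> \<le> (\<Sum>n<N. (norm (f n))\<^sup>2) * real N"
    using sum_squared_le_sum_of_squares[of "\<lambda>n. norm (f n)" "{..<N}"] by simp
  finally show ?thesis using False by (simp add: cesaro_def power_divide power2_eq_square field_simps)
qed (simp add: cesaro_def)

text \<open>Representing the limiting correlations of \<open>X\<close> as inner products in another Hilbert space
  avoids a separate averaging over the shift.\<close>

theorem van_der_Corput:
  fixes X :: "nat \<Rightarrow> 'h::complex_hilbert" and \<xi> :: "nat \<Rightarrow> 'k::complex_hilbert"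
  assumes bd: "\<And>n. norm (X n) \<le> K"
    and corr: "\<And>h h'. cesaro (\<lambda>n. cinner (X (n + h)) (X (n + h'))) \<longlonglongrightarrow> cinner (\<xi> h) (\<xi> h')"
    and \<xi>: "cesaro \<xi> \<longlonglongrightarrow> 0"
  shows "cesaro X \<longlonglongrightarrow> 0"
proof (rule LIMSEQ_I)
  fix r :: real assume r: "0 < r"
  have "\<forall>\<^sub>F H in sequentially. dist (cesaro \<xi> H) 0 < r / 2"
    using r by (intro tendstoD[OF \<xi>]) auto
  then obtain H0 where H0: "\<And>H. H \<ge> H0 \<Longrightarrow> norm (cesaro \<xi> H) < r / 2"
    by (auto simp: eventually_sequentially)
  define H where "H = Suc H0"
  have H: "0 < H" "norm (cesaro \<xi> H) < r / 2" using H0[of H] by (auto simp: H_def)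
  \<comment> \<open>Averaging over a window of fixed length \<open>H\<close> changes the Cesaro
    averages by an amount tending to \<open>0\<close> with \<open>N\<close>, but brings in the
    correlations.\<close>
  define Y where "Y n = cesaro (\<lambda>h. X (n + h)) H" for n
  have cY: "cesaro Y N = cesaro (\<lambda>h. cesaro (\<lambda>n. X (n + h)) N) H" for N
    unfolding Y_def cesaro_def scaleR_sum_right scaleR_scaleR
    by (subst sum.swap) (simp only: mult.commute)
  have "cesaro Y N - cesaro X N = cesaro (\<lambda>h. cesaro (\<lambda>n. X (n + h)) N - cesaro X N) H" for N
    using H(1) by (simp add: cY cesaro_diff cesaro_const)
  moreover have "(\<lambda>N. cesaro (\<lambda>h. cesaro (\<lambda>n. X (n + h)) N - cesaro X N) H) \<longlonglongrightarrow>
      (1 / real H) *\<^sub>R (\<Sum>h<H. 0)"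
    unfolding cesaro_def[of _ H] by (intro tendsto_intros cesaro_shift_tendsto[OF bd])
  ultimately have YX: "(\<lambda>N. cesaro Y N - cesaro X N) \<longlonglongrightarrow> 0" by simp
  \<comment> \<open>The same expansion is used twice: for the window average of \<open>X\<close>,
    where the limit in \<open>N\<close> is taken term by term, and for \<xi>, where the result is
    recognized as a norm again.\<close>
  have sq: "complex_of_real ((norm (cesaro f H))\<^sup>2)
      = (1 / real H) *\<^sub>R (\<Sum>h<H. (1 / real H) *\<^sub>R (\<Sum>h'<H. cinner (f h) (f h')))"
    for f :: "nat \<Rightarrow> 'x::complex_hilbert"
    unfolding cinner_self[symmetric] unfolding cesaro_def cinner_scaleR_left cinner_scaleR_right
      cinner_sum_left by (simp add: cinner_sum_right scaleR_conv_of_real sum_distrib_left)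
  have "cesaro (\<lambda>n. complex_of_real ((norm (Y n))\<^sup>2)) N
      = (1 / real H) *\<^sub>R (\<Sum>h<H. (1 / real H) *\<^sub>R
          (\<Sum>h'<H. cesaro (\<lambda>n. cinner (X (n + h)) (X (n + h'))) N))" for N
    unfolding Y_def sq by (simp add: cesaro_scaleR cesaro_sum)
  moreover have "(\<lambda>N. (1 / real H) *\<^sub>R (\<Sum>h<H. (1 / real H) *\<^sub>R
          (\<Sum>h'<H. cesaro (\<lambda>n. cinner (X (n + h)) (X (n + h'))) N)))
      \<longlonglongrightarrow> complex_of_real ((norm (cesaro \<xi> H))\<^sup>2)"
    unfolding sq by (intro tendsto_intros corr)
  ultimately have "(\<lambda>N. complex_of_real (cesaro (\<lambda>n. (norm (Y n))\<^sup>2) N))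
      \<longlonglongrightarrow> complex_of_real ((norm (cesaro \<xi> H))\<^sup>2)"
    by (simp only: cesaro_of_real)
  then have "cesaro (\<lambda>n. (norm (Y n))\<^sup>2) \<longlonglongrightarrow> (norm (cesaro \<xi> H))\<^sup>2"
    by (simp only: tendsto_of_real_iff)
  moreover have "(norm (cesaro \<xi> H))\<^sup>2 < (r / 2)\<^sup>2" using H by (intro power_strict_mono) auto
  ultimately have 1: "\<forall>\<^sub>F N in sequentially. cesaro (\<lambda>n. (norm (Y n))\<^sup>2) N < (r / 2)\<^sup>2"
    by (rule order_tendstoD)
  have 2: "\<forall>\<^sub>F N in sequentially. dist (cesaro Y N - cesaro X N) 0 < r / 2"
    using r by (intro tendstoD[OF YX]) auto
  have "\<forall>\<^sub>F N in sequentially. norm (cesaro X N - 0) < r"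
    using 1 2
  proof eventually_elim
    case (elim N)
    have "(norm (cesaro Y N))\<^sup>2 < (r / 2)\<^sup>2"
      using elim(1) norm_cesaro_squared_le[of Y N] by linarith
    then have "norm (cesaro Y N) < r / 2" using r power2_less_imp_less[of "norm (cesaro Y N)" "r / 2"] by simp
    moreover have "norm (cesaro X N) \<le> norm (cesaro Y N) + norm (cesaro Y N - cesaro X N)"
      by (metis norm_minus_commute norm_triangle_sub)
    ultimately show ?case using elim(2) by simp
  qed
  then show "\<exists>no. \<forall>n\<ge>no. norm (cesaro X n - 0) < r" by (simp add: eventually_sequentially)
qed

section \<open>Vectors orthogonal to all eigenvectors\<close>

text \<open>The subspace of continuous spectrum of \<open>U\<close>, described without spectral
  measures.\<close>

definition eigen_orthogonal :: "'h::complex_hilbert \<Rightarrow>\<^sub>C\<^sub>L 'h \<Rightarrow> 'h set" where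
  "eigen_orthogonal U = {x. \<forall>e v. U e = v *\<^sub>C e \<longrightarrow> cinner x e = 0}"

lemma eigen_orthogonalD: "x \<in> eigen_orthogonal U \<Longrightarrow> cblinfun_apply U e = v *\<^sub>C e \<Longrightarrow> cinner x e = 0"
  by (auto simp: eigen_orthogonal_def)

lemma csubspace_eigen_orthogonal: "csubspace (eigen_orthogonal U)"
  by (auto simp: csubspace_def eigen_orthogonal_def cinner_add_left cinner_scaleC_left)

lemma upow_eigen_orthogonal:
  assumes U: "unitary U" and x: "x \<in> eigen_orthogonal U"
  shows "upow U k x \<in> eigen_orthogonal U"
  unfolding eigen_orthogonal_def
proof (clarify)
  fix e v assume e: "U e = v *\<^sub>C e"
  show "cinner (upow U k x) e = 0"
  proof (cases "e = 0")
    case False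
    then have "cmod v = 1" using eigenvalue_unimodular[OF U e] by blast
    then show ?thesis
      using eigen_orthogonalD[OF x e]
      by (simp add: cinner_upow_left[OF U] upow_eigen[OF U e] cinner_scaleC_right)
  qed simp
qed

text \<open>A unitary and its adjoint have the same eigenvectors. This turns relations between
  negative powers of \<open>U\<close> into relations between positive powers of the adjoint.\<close>

lemma eigen_orthogonal_cadjoint:
  assumes U: "unitary U"
  shows "eigen_orthogonal U \<subseteq> eigen_orthogonal (U\<^sup>\<dagger>)"
proof
  fix x assume x: "x \<in> eigen_orthogonal U"
  have "cinner x e = 0" if e: "(U\<^sup>\<dagger>) e = v *\<^sub>C e" for e v
  proof (cases "e = 0")
    case False
    then have "v \<noteq> 0" using eigenvalue_unimodular[OF unitary_cadjoint[OF U] e] by auto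
    moreover have "e = v *\<^sub>C U e"
      using unitaryD(2)[OF U, of e] by (simp add: e cblinfun_scaleC_right)
    ultimately have "U e = inverse v *\<^sub>C e" by (metis scaleC_cancel)
    then show ?thesis using eigen_orthogonalD[OF x] by blast
  qed simp
  then show "x \<in> eigen_orthogonal (U\<^sup>\<dagger>)" unfolding eigen_orthogonal_def by blast
qed

section \<open>Polynomials in a unitary\<close>

definition poly_op :: "complex poly \<Rightarrow> 'h::complex_hilbert \<Rightarrow>\<^sub>C\<^sub>L 'h \<Rightarrow> 'h \<Rightarrow> 'h" where
  "poly_op p U x = (\<Sum>i\<le>degree p. coeff p i *\<^sub>C upow U (int i) x)"

lemma poly_op_eq: "degree p \<le> n \<Longrightarrow> poly_op p U x = (\<Sum>i\<le>n. coeff p i *\<^sub>C upow U (int i) x)"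
  unfolding poly_op_def by (rule sum.mono_neutral_left) (auto simp: coeff_eq_0)

text \<open>Multiplicativity of \<open>p \<mapsto> p(U)\<close> is needed only for linear factors,
  because the roots are split off singly.\<close>

lemma poly_op_linear_factor:
  assumes U: "unitary U"
  shows "poly_op ([:- z, 1:] * q) U x = U (poly_op q U x) - z *\<^sub>C poly_op q U x"
proof -
  let ?n = "degree q"
  have eq: "[:- z, 1:] * q = pCons 0 q - smult z q" by simp
  have "degree ([:- z, 1:] * q) \<le> Suc ?n"
    unfolding eq by (intro degree_diff_le degree_pCons_le order_trans[OF degree_smult_le]) simp
  then have "poly_op ([:- z, 1:] * q) U x
      = (\<Sum>i\<le>Suc ?n. coeff ([:- z, 1:] * q) i *\<^sub>C upow U (int i) x)" by (rule poly_op_eq)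
  also have "\<dots> = (\<Sum>i\<le>Suc ?n. coeff (pCons 0 q) i *\<^sub>C upow U (int i) x)
      - (\<Sum>i\<le>Suc ?n. z *\<^sub>C coeff q i *\<^sub>C upow U (int i) x)"
    unfolding eq coeff_diff coeff_smult scaleC_diff_left sum_subtractf by (simp only: scaleC_scaleC)
  also have "(\<Sum>i\<le>Suc ?n. z *\<^sub>C coeff q i *\<^sub>C upow U (int i) x) = z *\<^sub>C poly_op q U x"
    unfolding scaleC_sum_right[symmetric] by (subst poly_op_eq[of q "Suc ?n"]) simp_all
  also have "(\<Sum>i\<le>Suc ?n. coeff (pCons 0 q) i *\<^sub>C upow U (int i) x)
      = (\<Sum>i\<le>?n. coeff q i *\<^sub>C upow U (int (Suc i)) x)"
    by (subst sum.atMost_Suc_shift) simp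
  also have "\<dots> = U (poly_op q U x)"
    unfolding upow_Suc[OF U] poly_op_def cblinfun_sum_right cblinfun_scaleC_right ..
  finally show ?thesis .
qed

text \<open>If \<open>z\<close> is a root and \<open>q\<close> the quotient, then
  \<open>y = q(U) x\<close> satisfies \<open>U y = z y\<close> and is itself orthogonal to all
  eigenvectors. Hence it is orthogonal to itself, and \<open>q\<close> is an annihilating polynomial
  of smaller degree.\<close>

lemma poly_op_eigen_orthogonal_eq_0:
  assumes U: "unitary U" and x: "x \<in> eigen_orthogonal U" and "p \<noteq> 0" "poly_op p U x = 0"
  shows "x = 0"
  using assms(3,4)
proof (induction "degree p" arbitrary: p)
  case 0
  then have "coeff p 0 *\<^sub>C x = 0" "coeff p 0 \<noteq> 0"
    by (auto simp: poly_op_def leading_coeff_0_iff[symmetric] simp del: leading_coeff_0_iff)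
  then show ?case by simp
next
  case (Suc d)
  then have "\<not> constant (poly p)" by (simp add: constant_degree)
  then obtain z where "poly p z = 0" using fundamental_theorem_of_algebra by blast
  then obtain q where q: "p = [:- z, 1:] * q" by (auto simp: poly_eq_0_iff_dvd)
  have q0: "q \<noteq> 0" using Suc.prems(1) q by auto
  have dq: "d = degree q" using Suc.hyps(2) q0 unfolding q by (subst (asm) degree_mult_eq) auto
  define y where "y = poly_op q U x"
  have y: "y \<in> eigen_orthogonal U" unfolding y_def poly_op_def
    by (intro csubspace_sum csubspaceD[OF csubspace_eigen_orthogonal] csubspace_eigen_orthogonal
        upow_eigen_orthogonal U x)
  have "U y = z *\<^sub>C y"
    using Suc.prems(2) unfolding q poly_op_linear_factor[OF U] y_def by simp
  then have "y = 0" using eigen_orthogonalD[OF y] by fastforce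
  then show ?case using Suc.hyps(1)[OF dq q0] by (simp add: y_def)
qed

lemma orbit_relation_pos:
  assumes U: "unitary U" and x: "x \<in> eigen_orthogonal U" and k: "0 < k"
    and rel: "(\<Sum>j\<in>F. c j *\<^sub>C upow U (int j * k) x) = 0" and F: "finite F" "j0 \<in> F" "c j0 \<noteq> 0"
  shows "x = 0"
proof -
  define l where "l = nat k"
  have l: "0 < l" "k = int l" using k by (auto simp: l_def)
  \<comment> \<open>Since \<open>0 < l\<close>, distinct indices \<open>j\<close> give distinct
    exponents \<open>j * l\<close>, so no coefficients merge and \<open>p\<close> is not
    zero.\<close>
  define p where "p = (\<Sum>j\<in>F. monom (c j) (j * l))"
  have "coeff p (j0 * l) = (\<Sum>j\<in>F. if j = j0 then c j else 0)"
    unfolding p_def coeff_sum coeff_monom using l(1) by (intro sum.cong) auto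
  also have "\<dots> = c j0" using F by simp
  finally have p: "p \<noteq> 0" using F(3) by auto
  \<comment> \<open>A common bound for the degree of \<open>p\<close> and for all exponents, so that
    both sums may be extended to the same range.\<close>
  define n where "n = degree p + (\<Sum>j\<in>F. j * l)"
  have le: "j * l \<le> n" if "j \<in> F" for j
    using member_le_sum[of j F "\<lambda>j. j * l"] that F(1) by (simp add: n_def)
  have "poly_op p U x = (\<Sum>i\<le>n. coeff p i *\<^sub>C upow U (int i) x)"
    by (rule poly_op_eq) (simp add: n_def)
  also have "\<dots> = (\<Sum>j\<in>F. \<Sum>i\<le>n. (if j * l = i then c j else 0) *\<^sub>C upow U (int i) x)"
    unfolding p_def coeff_sum coeff_monom scaleC_sum_left by (rule sum.swap)
  also have "\<dots> = (\<Sum>j\<in>F. c j *\<^sub>C upow U (int j * k) x)"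
  proof (rule sum.cong[OF refl])
    fix j assume j: "j \<in> F"
    have "(\<Sum>i\<le>n. (if j * l = i then c j else 0) *\<^sub>C upow U (int i) x)
        = (\<Sum>i\<le>n. if j * l = i then c j *\<^sub>C upow U (int i) x else 0)"
      by (intro sum.cong) auto
    also have "\<dots> = c j *\<^sub>C upow U (int (j * l)) x" using le[OF j] by simp
    finally show "(\<Sum>i\<le>n. (if j * l = i then c j else 0) *\<^sub>C upow U (int i) x)
        = c j *\<^sub>C upow U (int j * k) x" by (simp add: l(2))
  qed
  finally show ?thesis using poly_op_eigen_orthogonal_eq_0[OF U x p] rel by simp
qed

text \<open>A linear relation in the orbit is a polynomial annihilating \<open>x\<close>; its linear factors can be
  cancelled one after the other.\<close>

lemma orbit_relation:
  assumes U: "unitary U" and x: "x \<in> eigen_orthogonal U" and k: "k \<noteq> 0"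
    and rel: "(\<Sum>j\<in>F. c j *\<^sub>C upow U (int j * k) x) = 0" and F: "finite F" "j0 \<in> F" "c j0 \<noteq> 0"
  shows "x = 0"
proof (cases "0 < k")
  case True
  then show ?thesis using orbit_relation_pos[OF U x _ rel F] by blast
next
  case False
  have "upow (U\<^sup>\<dagger>) j = upow U (- j)" for j by (auto simp: upow_def)
  then have "(\<Sum>j\<in>F. c j *\<^sub>C upow (U\<^sup>\<dagger>) (int j * (- k)) x) = 0" using rel by simp
  from orbit_relation_pos[OF unitary_cadjoint[OF U] _ _ this F] show ?thesis
    using False k x eigen_orthogonal_cadjoint[OF U] by auto
qed

section \<open>Fixed vectors of a tensor product of unitaries\<close>

lemma tensorD:
  assumes "hilbert_tensor_product tens"
  shows "tens (x + x') y = tens x y + tens x' y" "tens x (y + y') = tens x y + tens x y'"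
    "tens (c *\<^sub>C x) y = c *\<^sub>C tens x y" "tens x (c *\<^sub>C y) = c *\<^sub>C tens x y"
    "cinner (tens x y) (tens x' y') = cinner x x' * cinner y y'"
    "closure (span {tens x y | x y. True}) = UNIV"
  using assms unfolding hilbert_tensor_product_def by blast+

lemma norm_tensor:
  assumes "hilbert_tensor_product tens"
  shows "norm (tens x y) = norm x * norm y"
proof -
  have "complex_of_real ((norm (tens x y))\<^sup>2) = of_real ((norm x * norm y)\<^sup>2)"
    unfolding cinner_self[symmetric] tensorD(5)[OF assms] by (simp add: cinner_self power_mult_distrib)
  then have "(norm (tens x y))\<^sup>2 = (norm x * norm y)\<^sup>2" by (simp only: of_real_eq_iff)
  then show ?thesis by (simp add: power2_eq_iff_nonneg)
qed

lemma bounded_bilinear_tensor: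
  assumes t: "hilbert_tensor_product tens"
  shows "bounded_bilinear tens"
proof
  show "\<exists>K. \<forall>a b. norm (tens a b) \<le> norm a * norm b * K"
    by (rule exI[of _ 1]) (simp add: norm_tensor[OF t])
qed (simp_all add: tensorD[OF t] scaleR_scaleC)

text \<open>Stated for bare functions, since the operator to which it is applied is antilinear and
  therefore no \<open>cblinfun\<close>.\<close>

definition totally_bounded_image :: "('a::real_normed_vector \<Rightarrow> 'b::metric_space) \<Rightarrow> bool" where
  "totally_bounded_image T \<longleftrightarrow>
    (\<forall>\<epsilon>>0. \<exists>k. finite k \<and> T ` cball 0 1 \<subseteq> (\<Union>x\<in>k. ball x \<epsilon>))"

text \<open>Density of the elementary tensors makes \<open>T\<close> a norm limit of finite rank operators.\<close>

lemma tensor_kernel_compact: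
  fixes tens :: "'a::complex_hilbert \<Rightarrow> 'b::complex_hilbert \<Rightarrow> 'c::complex_hilbert"
  assumes t: "hilbert_tensor_product tens"
    and T: "\<And>a b. cinner (T a) b = cinner \<zeta> (tens a b)"
  shows "totally_bounded_image T"
  unfolding totally_bounded_image_def
proof (intro allI impI)
  fix \<epsilon> :: real assume \<epsilon>: "0 < \<epsilon>"
  define P where "P z \<longleftrightarrow> (\<exists>C. compact C \<and> (\<forall>a\<in>cball 0 1. \<exists>c\<in>C. \<forall>b. cinner c b = cinner z (tens a b)))"
    for z
  have P: "P z" if "z \<in> span {tens x y | x y. True}" for z
    using that
  proof (induction rule: span_induct)
    case base
    show ?case unfolding mem_Collect_eq
    proof (rule subspaceI)
      show "0 \<in> {x. P x}" unfolding P_def mem_Collect_eq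
        by (intro exI[of _ "{0}"]) auto
      fix z w assume "z \<in> {x. P x}"
      then obtain C where C: "compact C" "\<And>a. a \<in> cball 0 1 \<Longrightarrow> \<exists>c\<in>C. \<forall>b. cinner c b = cinner z (tens a b)"
        unfolding P_def by blast
      have "\<exists>c\<in>(*\<^sub>R) r ` C. \<forall>b. cinner c b = cinner (r *\<^sub>R z) (tens a b)" if "a \<in> cball 0 1" for a r
        using C(2)[OF that] by (auto simp: cinner_scaleR_left)
      then show "r *\<^sub>R z \<in> {x. P x}" for r
        unfolding P_def mem_Collect_eq using compact_scaling[OF C(1), of r] by blast
      assume "w \<in> {x. P x}"
      then obtain D where D: "compact D" "\<And>a. a \<in> cball 0 1 \<Longrightarrow> \<exists>c\<in>D. \<forall>b. cinner c b = cinner w (tens a b)"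
        unfolding P_def by blast
      have "\<exists>c\<in>{x + y |x y. x \<in> C \<and> y \<in> D}. \<forall>b. cinner c b = cinner (z + w) (tens a b)"
        if a: "a \<in> cball 0 1" for a
      proof -
        obtain c d where "c \<in> C" "\<And>b. cinner c b = cinner z (tens a b)"
          "d \<in> D" "\<And>b. cinner d b = cinner w (tens a b)" using C(2)[OF a] D(2)[OF a] by blast
        then show ?thesis by (intro bexI[of _ "c + d"]) (auto simp: cinner_add_left)
      qed
      then show "z + w \<in> {x. P x}"
        unfolding P_def mem_Collect_eq using compact_sums[OF C(1) D(1)] by blast
    qed
  next
    case (step z)
    then obtain x y where z: "z = tens x y" by blast
    \<comment> \<open>An elementary tensor is the kernel of
      \<open>a \<mapsto> cinner x a *\<^sub>C y\<close>; the unit ball is sent into this disc of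
      multiples of \<open>y\<close>.\<close>
    have "compact ((\<lambda>s. s *\<^sub>C y) ` cball (0::complex) (norm x))"
      by (intro compact_continuous_image bounded_bilinear.continuous_on[OF bounded_bilinear_scaleC]
          continuous_intros) simp
    moreover have "\<exists>c\<in>(\<lambda>s. s *\<^sub>C y) ` cball (0::complex) (norm x). \<forall>b. cinner c b = cinner z (tens a b)"
      if "a \<in> cball 0 1" for a
    proof -
      have "cmod (cinner x a) \<le> norm x * 1"
        by (rule order_trans[OF cinner_norm_le]) (use that in \<open>simp add: mult_left_le\<close>)
      then show ?thesis
        by (intro bexI[of _ "cinner x a *\<^sub>C y"]) (auto simp: z tensorD[OF t] cinner_scaleC_left)
    qed
    ultimately show ?case unfolding P_def mem_Collect_eq by blast
  qed
  have "\<zeta> \<in> closure (span {tens x y | x y. True})" using tensorD(6)[OF t] by auto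
  \<comment> \<open>One half of \<epsilon> pays for replacing \<zeta> by \<open>z\<close>, the other
    for the finite net of the compact set belonging to \<open>z\<close>.\<close>
  then obtain z where z: "z \<in> span {tens x y | x y. True}" "dist z \<zeta> < \<epsilon> / 2"
    using \<epsilon> by (meson closure_approachable half_gt_zero)
  obtain C where C: "compact C" "\<And>a. a \<in> cball 0 1 \<Longrightarrow> \<exists>c\<in>C. \<forall>b. cinner c b = cinner z (tens a b)"
    using P[OF z(1)] unfolding P_def by blast
  obtain k where k: "finite k" "C \<subseteq> (\<Union>x\<in>k. ball x (\<epsilon> / 2))"
    using C(1) \<epsilon> unfolding compact_eq_totally_bounded by (meson half_gt_zero)
  have "T a \<in> (\<Union>x\<in>k. ball x \<epsilon>)" if a: "a \<in> cball 0 1" for a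
  proof -
    obtain c where c: "c \<in> C" "\<And>b. cinner c b = cinner z (tens a b)" using C(2)[OF a] by blast
    obtain x where x: "x \<in> k" "dist x c < \<epsilon> / 2" using k c by auto
    have "norm (T a - c) \<le> \<epsilon> / 2"
    proof (cases "T a - c = 0")
      case False
      let ?b = "T a - c"
      have "(norm ?b)\<^sup>2 = cmod (cinner ?b ?b)" unfolding cinner_self norm_of_real by simp
      also have "\<dots> = cmod (cinner (\<zeta> - z) (tens a ?b))"
        by (simp add: cinner_diff_left T c(2))
      also have "\<dots> \<le> norm (\<zeta> - z) * (norm a * norm ?b)"
        using cinner_norm_le[of "\<zeta> - z" "tens a ?b"] by (simp add: norm_tensor[OF t])
      also have "\<dots> \<le> (\<epsilon> / 2) * (1 * norm ?b)"
        using z(2) a \<epsilon> by (intro mult_mono) (auto simp: dist_norm norm_minus_commute)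
      finally show ?thesis using False by (simp add: power2_eq_square)
    qed (use \<epsilon> in simp)
    then have "dist x (T a) < \<epsilon>"
      using x(2) dist_triangle_less_add[of x c "\<epsilon> / 2 " "T a" "\<epsilon> / 2"] dist_triangle[of x "T a" c]
      by (simp add: dist_norm norm_minus_commute)
    then show ?thesis using x by auto
  qed
  then show "\<exists>k. finite k \<and> T ` cball 0 1 \<subseteq> (\<Union>x\<in>k. ball x \<epsilon>)" using k by blast
qed

lemma totally_bounded_image_compact:
  fixes T :: "'a::real_normed_vector \<Rightarrow> 'b::complete_space"
  assumes "totally_bounded_image T"
  shows "compact (closure (T ` cball 0 1))"
  unfolding compact_eq_totally_bounded
proof (intro conjI allI impI)
  show "complete (closure (T ` cball 0 1))" by (simp add: complete_eq_closed)
  fix \<epsilon> :: real assume \<epsilon>: "0 < \<epsilon>"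
  then obtain k where k: "finite k" "T ` cball 0 1 \<subseteq> (\<Union>x\<in>k. ball x (\<epsilon> / 2))"
    using assms unfolding totally_bounded_image_def by (meson half_gt_zero)
  have "closure (T ` cball 0 1) \<subseteq> (\<Union>x\<in>k. cball x (\<epsilon> / 2))"
    by (rule closure_minimal) (use k in \<open>auto intro!: closed_UN dest!: subsetD\<close>)
  also have "\<dots> \<subseteq> (\<Union>x\<in>k. ball x \<epsilon>)" using \<epsilon> by force
  finally show "\<exists>k. finite k \<and> closure (T ` cball 0 1) \<subseteq> (\<Union>x\<in>k. ball x \<epsilon>)" using k(1) by blast
qed

text \<open>\<open>T\<close> sends orthonormal vectors of \<open>E\<close> to points at mutual
  distance \<open>c * sqrt 2\<close>, so a ball of radius \<open>c / 2\<close> contains the image of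
  at most one of them. The size of the net thus bounds the real dimension of
  \<open>E\<close>.\<close>

lemma independent_card_bound:
  fixes T :: "'a::real_inner \<Rightarrow> 'b::real_normed_vector"
  assumes iso: "\<And>a b. a \<in> E \<Longrightarrow> b \<in> E \<Longrightarrow> norm (T a - T b) = c * norm (a - b)"
    and E: "subspace E" and c: "0 < c"
    and k: "finite k" "T ` cball 0 1 \<subseteq> (\<Union>x\<in>k. ball x (c / 2))"
    and B: "finite B" "independent B" "B \<subseteq> E"
  shows "card B \<le> card k"
proof -
  obtain C where C: "finite C" "span C = span B" "pairwise orthogonal C"
    using basis_orthogonal[OF B(1)] by blast
  \<comment> \<open>Orthogonalization may produce the vector \<open>0\<close>; without it every
    element can be normalized, and the span is unchanged.\<close>
  define D where "D = C - {0}"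
  have sp: "span D = span B" unfolding D_def C(2)[symmetric] by (rule span_delete_0)
  have D: "finite D" using C(1) by (simp add: D_def)
  have "card B \<le> card D"
    using independent_span_bound[OF D B(2)] sp span_superset by blast
  also have "card D \<le> card k"
  proof -
    have DE: "D \<subseteq> E" using sp span_superset span_minimal[OF B(3) E] by blast
    define g where "g a = a /\<^sub>R norm a" for a :: 'a
    have g: "g a \<in> E" "norm (g a) = 1" if "a \<in> D" for a
      using that DE subspace_scale[OF E] by (auto simp: g_def D_def)
    have "\<exists>x\<in>k. T (g a) \<in> ball x (c / 2)" if "a \<in> D" for a
    proof -
      have "g a \<in> cball 0 1" using g(2)[OF that] by simp
      then show ?thesis using k(2) by blast
    qed
    then obtain h where h: "\<And>a. a \<in> D \<Longrightarrow> h a \<in> k \<and> T (g a) \<in> ball (h a) (c / 2)" by metis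
    have "inj_on h D"
    proof (rule inj_onI, rule ccontr)
      fix a b assume ab: "a \<in> D" "b \<in> D" "h a = h b" "a \<noteq> b"
      have "dist (T (g a)) (T (g b)) < c"
      proof (rule dist_triangle_half_r)
        show "dist (h a) (T (g a)) < c / 2" using h[OF ab(1)] by simp
        show "dist (h a) (T (g b)) < c / 2" using h[OF ab(2)] unfolding ab(3) by simp
      qed
      then have "c * norm (g a - g b) < c"
        using iso[OF g(1)[OF ab(1)] g(1)[OF ab(2)]] by (simp only: dist_norm)
      then have lt: "norm (g a - g b) < 1"
        using mult_less_cancel_left_pos[OF c, of "norm (g a - g b)" 1] by (simp only: mult_1_right)
      have "inner a b = 0" using C(3) ab by (auto simp: pairwise_def orthogonal_def D_def)
      then have "inner (g a) (g b) = 0" by (simp add: g_def)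
      then have "(norm (g a - g b))\<^sup>2 = 2"
        using g(2)[OF ab(1)] g(2)[OF ab(2)]
        by (simp add: power2_norm_eq_inner inner_diff_left inner_diff_right inner_commute norm_eq_1)
      moreover have "(norm (g a - g b))\<^sup>2 < 1\<^sup>2" using lt by (intro power_strict_mono) auto
      ultimately show False by simp
    qed
    then show ?thesis using card_inj_on_le[of h D k] h k(1) by blast
  qed
  finally show ?thesis .
qed

text \<open>A fixed vector \<open>\<zeta>\<close> of \<open>U\<^sup>k\<^sup>1 \<otimes> U\<^sup>k\<^sup>2\<close> is the kernel of a compact antilinear operator \<open>T\<close> with
  \<open>T U\<^sup>k\<^sup>1 = U\<^sup>k\<^sup>2 T\<close>. The top eigenspace of \<open>T\<^sup>* T\<close> is finite-dimensional and invariant under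
  \<open>U\<^sup>k\<^sup>1\<close>, so the orbit of each of its vectors satisfies a linear relation.\<close>

lemma fixed_tensor_eq_0:
  fixes tens :: "'h::complex_hilbert \<Rightarrow> 'h \<Rightarrow> 'k::complex_hilbert"
  assumes t: "hilbert_tensor_product tens" and U: "unitary U" and k1: "k1 \<noteq> 0"
    and inv: "\<And>a b. cinner \<zeta> (tens (upow U k1 a) (upow U k2 b)) = cinner \<zeta> (tens a b)"
    and orth: "\<And>e v b. U e = v *\<^sub>C e \<Longrightarrow> cinner \<zeta> (tens e b) = 0"
  shows "cinner \<zeta> (tens a b) = 0"
proof (rule ccontr)
  define f where "f a b = cinner \<zeta> (tens a b)" for a b
  assume "cinner \<zeta> (tens a b) \<noteq> 0"
  then have fab: "f a b \<noteq> 0" by (simp add: f_def)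
  have fle: "cmod (f a b) \<le> norm \<zeta> * norm a * norm b" for a b
    using cinner_norm_le[of \<zeta> "tens a b"] by (simp add: f_def norm_tensor[OF t] mult.assoc)
  \<comment> \<open>\<open>f\<close> is antilinear in both arguments, so it is the conjugate to
    which the representation theorem applies. \<open>T\<close> and \<open>R\<close> read the same
    form from its two sides.\<close>
  have "\<exists>y. \<forall>b. cnj (f a b) = cinner b y" for a
    by (rule riesz_representation[where K = "norm \<zeta> * norm a"])
      (simp_all add: fle, simp_all add: f_def tensorD[OF t] cinner_add_right cinner_scaleC_right)
  then obtain T where T': "\<And>a b. cnj (f a b) = cinner b (T a)" by metis
  have T: "cinner (T a) b = f a b" for a b by (metis T' cinner_commute complex_cnj_cnj)
  have "\<exists>y. \<forall>a. cnj (f a b) = cinner a y" for b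
    by (rule riesz_representation[where K = "norm \<zeta> * norm b"])
      (use fle in \<open>simp_all add: ac_simps\<close>, simp_all add: f_def tensorD[OF t] cinner_add_right cinner_scaleC_right)
  then obtain R where R': "\<And>a b. cnj (f a b) = cinner a (R b)" by metis
  have R: "cinner (R b) a = f a b" for a b by (metis R' cinner_commute complex_cnj_cnj)
  have T_diff: "T (x - y) = T x - T y" for x y
    by (rule cinner_eqI)
      (simp add: T cinner_diff_left f_def bounded_bilinear.diff_left[OF bounded_bilinear_tensor[OF t]]
        cinner_diff_right)
  have R_diff: "R (x - y) = R x - R y" for x y
    by (rule cinner_eqI)
      (simp add: R cinner_diff_left f_def bounded_bilinear.diff_right[OF bounded_bilinear_tensor[OF t]]
        cinner_diff_right)
  have T_scale: "T (r *\<^sub>R x) = r *\<^sub>R T x" for r x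
    by (rule cinner_eqI)
      (simp add: T cinner_scaleR_left f_def bounded_bilinear.scaleR_left[OF bounded_bilinear_tensor[OF t]]
        cinner_scaleR_right)
  have R_scale: "R (r *\<^sub>R x) = r *\<^sub>R R x" for r x
    by (rule cinner_eqI)
      (simp add: R cinner_scaleR_left f_def bounded_bilinear.scaleR_right[OF bounded_bilinear_tensor[OF t]]
        cinner_scaleR_right)
  \<comment> \<open>The operator norm of \<open>T\<close>. The aim is a vector \<open>w\<close> at
    which it is attained.\<close>
  define c where "c = (SUP a\<in>cball 0 1. norm (T a))"
  have T_le0: "norm (T a) \<le> norm \<zeta> * norm a" for a
  proof (cases "T a = 0")
    case False
    have "(norm (T a))\<^sup>2 = cmod (f a (T a))" unfolding T[symmetric] cinner_self norm_of_real by simp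
    also have "\<dots> \<le> norm \<zeta> * norm a * norm (T a)" by (rule fle)
    finally show ?thesis using False by (simp add: power2_eq_square)
  qed simp
  have bdd: "bdd_above ((\<lambda>a. norm (T a)) ` cball 0 1)"
  proof (rule bdd_aboveI2)
    fix a :: 'h assume "a \<in> cball 0 1"
    then have "norm \<zeta> * norm a \<le> norm \<zeta>" by (simp add: mult_left_le)
    then show "norm (T a) \<le> norm \<zeta>" using T_le0[of a] by linarith
  qed
  have T_le: "norm (T a) \<le> c * norm a" for a
  proof (cases "a = 0")
    case True then show ?thesis using T_le0[of a] by simp
  next
    case False
    have "norm (T (a /\<^sub>R norm a)) \<le> c" unfolding c_def
      by (rule cSUP_upper[OF _ bdd]) (use False in simp)
    then show ?thesis using False by (simp add: T_scale field_simps)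
  qed
  have "T a \<noteq> 0" using fab T[of a b] by auto
  then have c: "0 < c" using T_le[of a] by (metis norm_ge_zero norm_le_zero_iff not_less order_trans
        mult_nonpos_nonneg)
  have R_le: "norm (R b) \<le> c * norm b" for b
  proof (cases "R b = 0")
    case False
    have "(norm (R b))\<^sup>2 = cmod (cinner (T (R b)) b)"
      unfolding T R[symmetric] cinner_self norm_of_real by simp
    also have "\<dots> \<le> norm (T (R b)) * norm b" by (rule cinner_norm_le)
    also have "\<dots> \<le> c * norm (R b) * norm b" by (intro mult_right_mono T_le) simp
    finally show ?thesis using False by (simp add: power2_eq_square ac_simps)
  qed (use c in simp)
  have tendT: "(\<lambda>n. T (s n)) \<longlonglongrightarrow> T l" if "s \<longlonglongrightarrow> l" for s l
  proof (rule LIM_zero_cancel, rule Lim_null_comparison)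
    show "\<forall>\<^sub>F n in sequentially. norm (T (s n) - T l) \<le> c * norm (s n - l)"
      using T_le by (simp add: T_diff[symmetric])
    have "(\<lambda>n. c * norm (s n - l)) \<longlonglongrightarrow> c * norm (l - l)" by (intro tendsto_intros that)
    then show "(\<lambda>n. c * norm (s n - l)) \<longlonglongrightarrow> 0" by simp
  qed
  have tendR: "(\<lambda>n. R (s n)) \<longlonglongrightarrow> R l" if "s \<longlonglongrightarrow> l" for s l
  proof (rule LIM_zero_cancel, rule Lim_null_comparison)
    show "\<forall>\<^sub>F n in sequentially. norm (R (s n) - R l) \<le> c * norm (s n - l)"
      using R_le by (simp add: R_diff[symmetric])
    have "(\<lambda>n. c * norm (s n - l)) \<longlonglongrightarrow> c * norm (l - l)" by (intro tendsto_intros that)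
    then show "(\<lambda>n. c * norm (s n - l)) \<longlonglongrightarrow> 0" by simp
  qed
  have RT: "cinner (R (T x)) y = cinner (T y) (T x)" for x y by (simp add: R T)
  have "\<exists>x\<in>cball 0 1. c - 1 / Suc n < norm (T x)" for n
    using less_cSUP_iff[OF _ bdd, of "c - 1 / Suc n"] by (auto simp: c_def)
  then obtain s where s: "\<And>n. s n \<in> cball 0 1" "\<And>n. c - 1 / Suc n < norm (T (s n))" by metis
  have s_le: "norm (T (s n)) \<le> c" for n
    using T_le[of "s n"] s(1)[of n] c by (simp add: mult_left_le order_trans)
  have Ts: "(\<lambda>n. norm (T (s n))) \<longlonglongrightarrow> c"
  proof (rule tendsto_sandwich[of "\<lambda>n. c - 1 / real (Suc n)" _ _ "\<lambda>_. c"])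
    show "(\<lambda>n. c - 1 / real (Suc n)) \<longlonglongrightarrow> c"
      using tendsto_diff[OF tendsto_const[of c] LIMSEQ_inverse_real_of_nat]
      by (simp add: inverse_eq_divide)
    show "\<forall>\<^sub>F n in sequentially. c - 1 / real (Suc n) \<le> norm (T (s n))"
      using less_imp_le[OF s(2)] by simp
    show "\<forall>\<^sub>F n in sequentially. norm (T (s n)) \<le> c" using s_le by simp
  qed simp
  \<comment> \<open>A maximizing sequence consists of approximate eigenvectors: expanding the square
    leaves at most \<open>c\<^sup>2 * (c\<^sup>2 - (norm (T (s n)))\<^sup>2)\<close>.\<close>
  have "(\<lambda>n. R (T (s n)) - c\<^sup>2 *\<^sub>R s n) \<longlonglongrightarrow> 0"
  proof (rule tendsto_norm_zero_cancel)
    have le: "(norm (R (T (s n)) - c\<^sup>2 *\<^sub>R s n))\<^sup>2 \<le> c\<^sup>2 * (c\<^sup>2 - (norm (T (s n)))\<^sup>2)" for n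
    proof -
      have "(norm (R (T (s n)) - c\<^sup>2 *\<^sub>R s n))\<^sup>2
          = (norm (R (T (s n))))\<^sup>2 + (c\<^sup>2 * norm (s n))\<^sup>2 - 2 * (c\<^sup>2 * (norm (T (s n)))\<^sup>2)"
        unfolding norm_diff_sq cinner_scaleR_right RT cinner_self by (simp add: power_mult_distrib)
      moreover have "(norm (R (T (s n))))\<^sup>2 \<le> (c * norm (T (s n)))\<^sup>2"
        by (intro power_mono R_le) simp
      moreover have "(c\<^sup>2 * norm (s n))\<^sup>2 \<le> (c\<^sup>2)\<^sup>2"
        using s(1)[of n] by (intro power_mono) (auto simp: mult_left_le)
      moreover have "(c * norm (T (s n)))\<^sup>2 = c\<^sup>2 * (norm (T (s n)))\<^sup>2" by (rule power_mult_distrib)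
      moreover have "c\<^sup>2 * (c\<^sup>2 - (norm (T (s n)))\<^sup>2) = (c\<^sup>2)\<^sup>2 - c\<^sup>2 * (norm (T (s n)))\<^sup>2"
        by (simp add: power2_eq_square[of "c\<^sup>2"] right_diff_distrib)
      ultimately show ?thesis by linarith
    qed
    have "(\<lambda>n. c\<^sup>2 * (c\<^sup>2 - (norm (T (s n)))\<^sup>2)) \<longlonglongrightarrow> c\<^sup>2 * (c\<^sup>2 - c\<^sup>2)" by (intro tendsto_intros Ts)
    then have lim: "(\<lambda>n. c\<^sup>2 * (c\<^sup>2 - (norm (T (s n)))\<^sup>2)) \<longlonglongrightarrow> 0" by simp
    have "(\<lambda>n. (norm (R (T (s n)) - c\<^sup>2 *\<^sub>R s n))\<^sup>2) \<longlonglongrightarrow> 0"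
      by (rule tendsto_sandwich[OF _ _ tendsto_const lim]) (auto intro!: always_eventually le)
    from tendsto_real_sqrt[OF this]
    show "(\<lambda>n. norm (R (T (s n)) - c\<^sup>2 *\<^sub>R s n)) \<longlonglongrightarrow> 0"
      by (simp only: real_sqrt_abs abs_norm_cancel real_sqrt_zero)
  qed
  moreover have tb: "totally_bounded_image T"
    by (rule tensor_kernel_compact[OF t, of T \<zeta>]) (simp add: T f_def)
  \<comment> \<open>Compactness makes \<open>T (s n)\<close> converge along a subsequence; by
    continuity so does \<open>R (T (s n))\<close>, and then the multiples of \<open>s n\<close> that
    differ from it by a null sequence.\<close>
  have "\<forall>n. T (s n) \<in> closure (T ` cball 0 1)" using s(1) by (intro allI subsetD[OF closure_subset] imageI)
  then obtain l r where r: "strict_mono r" "((\<lambda>n. T (s n)) \<circ> r) \<longlonglongrightarrow> l"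
    using totally_bounded_image_compact[OF tb] unfolding compact_def by meson
  have lc: "norm l = c"
    using LIMSEQ_unique[OF tendsto_norm[OF r(2)]] LIMSEQ_subseq_LIMSEQ[OF Ts r(1)] by (simp add: o_def)
  define w where "w = R l"
  have Rw: "(\<lambda>n. R (T (s (r n)))) \<longlonglongrightarrow> w" unfolding w_def using tendR[OF r(2)] by (simp add: o_def)
  ultimately have "(\<lambda>n. R (T (s (r n))) - (R (T (s (r n))) - c\<^sup>2 *\<^sub>R s (r n))) \<longlonglongrightarrow> w - 0"
    by (intro tendsto_diff) (auto dest: LIMSEQ_subseq_LIMSEQ[OF _ r(1)] simp: o_def)
  then have sw: "(\<lambda>n. c\<^sup>2 *\<^sub>R s (r n)) \<longlonglongrightarrow> w" by simp
  have "(\<lambda>n. T (c\<^sup>2 *\<^sub>R s (r n))) \<longlonglongrightarrow> c\<^sup>2 *\<^sub>R l"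
    unfolding T_scale using r(2) by (intro tendsto_intros) (simp add: o_def)
  from LIMSEQ_unique[OF tendT[OF sw] this] have Tw: "T w = c\<^sup>2 *\<^sub>R l" .
  then have w0: "w \<noteq> 0" using lc c T_le[of w] by auto
  have RTw: "R (T w) = c\<^sup>2 *\<^sub>R w" by (simp only: Tw R_scale w_def[symmetric])
  \<comment> \<open>The eigenspace for the largest eigenvalue \<open>c\<^sup>2\<close>. On it
    \<open>T\<close> multiplies distances by \<open>c\<close>, which together with compactness
    bounds the dimension.\<close>
  define E where "E = {x. R (T x) = c\<^sup>2 *\<^sub>R x}"
  have addT: "T (x + y) = T x + T y" for x y using T_diff[of x "- y"] T_scale[of "-1" y] by simp
  have addR: "R (x + y) = R x + R y" for x y using R_diff[of x "- y"] R_scale[of "-1" y] by simp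
  have E: "subspace E"
    unfolding E_def subspace_def using T_scale[of 0 0] R_scale[of 0 0]
    by (auto simp: addT addR T_scale R_scale scaleR_add_right)
  have iso: "norm (T x - T y) = c * norm (x - y)" if "x \<in> E" "y \<in> E" for x y
  proof -
    have "x - y \<in> E" using subspace_diff[OF E] that by blast
    then have "cinner (c\<^sup>2 *\<^sub>R (x - y)) (x - y) = cinner (T (x - y)) (T (x - y))"
      using RT[of "x - y" "x - y"] by (simp add: E_def)
    then have "complex_of_real (c\<^sup>2 * (norm (x - y))\<^sup>2) = of_real ((norm (T (x - y)))\<^sup>2)"
      unfolding cinner_scaleR_left cinner_self by simp
    then have "(c * norm (x - y))\<^sup>2 = (norm (T (x - y)))\<^sup>2"
      by (simp only: of_real_eq_iff power_mult_distrib)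
    then show ?thesis using c by (simp add: T_diff power2_eq_iff_nonneg)
  qed
  have TU: "T (upow U k1 x) = upow U k2 (T x)" for x
  proof (rule cinner_eqI)
    show "cinner (T (upow U k1 x)) y = cinner (upow U k2 (T x)) y" for y
      using inv[of x "upow U (- k2) y"]
      by (simp add: T f_def cinner_upow_left[OF U] upow_cancel[OF U])
  qed
  have RU: "R (upow U k2 x) = upow U k1 (R x)" for x
  proof (rule cinner_eqI)
    show "cinner (R (upow U k2 x)) y = cinner (upow U k1 (R x)) y" for y
      using inv[of "upow U (- k1) y" x]
      by (simp add: R f_def cinner_upow_left[OF U] upow_cancel[OF U])
  qed
  define orb where "orb j = upow U (int j * k1) w" for j
  have orbSuc: "orb (Suc j) = upow U k1 (orb j)" for j
    unfolding orb_def by (simp add: upow_add[OF U, symmetric] algebra_simps)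
  have orbE: "orb j \<in> E" for j
  proof (induction j)
    case 0 then show ?case using RTw by (simp add: orb_def E_def)
  next
    case (Suc j) then show ?case by (simp add: orbSuc E_def TU RU cblinfun_scaleR_right)
  qed
  obtain k where k: "finite k" "T ` cball 0 1 \<subseteq> (\<Union>x\<in>k. ball x (c / 2))"
    using tb[unfolded totally_bounded_image_def, rule_format, of "c / 2"] c by auto
  have w: "w \<in> eigen_orthogonal U"
    using orth by (auto simp: eigen_orthogonal_def w_def R f_def)
  define d where "d = card k"
  \<comment> \<open>Either two orbit points coincide, or the \<open>d + 1\<close> points with index
    at most \<open>d\<close> exceed the bound \<open>d\<close> on independent vectors of
    \<open>E\<close>. A real relation is then read as a complex one.\<close>
  have "\<exists>F c j0. finite F \<and> j0 \<in> F \<and> c j0 \<noteq> 0 \<and> (\<Sum>j\<in>F. c j *\<^sub>C orb j) = 0"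
  proof (cases "inj_on orb {..d}")
    case False
    then obtain i j where ij: "i \<noteq> j" "orb i = orb j" by (auto simp: inj_on_def)
    then show ?thesis
      by (intro exI[of _ "{i, j}"] exI[of _ "\<lambda>k. if k = i then 1 else - 1"] exI[of _ i])
        (auto simp: scaleC_minus_left)
  next
    case True
    have "\<not> independent (orb ` {..d})"
    proof
      assume "independent (orb ` {..d})"
      then have "card (orb ` {..d}) \<le> card k"
        by (intro independent_card_bound[OF iso E c k]) (auto simp: orbE)
      then show False using card_image[OF True] by (simp add: d_def)
    qed
    then obtain u v where "(\<Sum>x\<in>orb ` {..d}. u x *\<^sub>R x) = 0" "v \<in> orb ` {..d}" "u v \<noteq> 0"
      using dependent_finite[of "orb ` {..d}"] by auto
    then obtain j0 where "(\<Sum>j\<le>d. u (orb j) *\<^sub>R orb j) = 0" "j0 \<le> d" "u (orb j0) \<noteq> 0"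
      using sum.reindex[OF True, of "\<lambda>x. u x *\<^sub>R x"] by (auto simp: orb_def[symmetric])
    then show ?thesis
      by (intro exI[of _ "{..d}"] exI[of _ "\<lambda>j. of_real (u (orb j))"] exI[of _ j0])
        (auto simp: scaleR_scaleC)
  qed
  then show False using orbit_relation[OF U w k1] w0 unfolding orb_def by blast
qed

text \<open>Stationarity alone gives a limit \<zeta>. Shift invariance of the averages makes its
  pairings with elementary tensors invariant, and they vanish on tensors with an eigenvector on the
  left. Hence all pairings vanish; \<zeta> is then orthogonal to every term of the sequence and, as
  a limit of their averages, to itself.\<close>

theorem tensor_average_tendsto_0:
  fixes tens :: "'h::complex_hilbert \<Rightarrow> 'h \<Rightarrow> 'k::complex_hilbert"
  assumes t: "hilbert_tensor_product tens" and U: "unitary U" and k1: "k1 \<noteq> 0"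
    and x: "x \<in> eigen_orthogonal U"
  shows "cesaro (\<lambda>n. tens (upow U (int n * k1) x) (upow U (int n * k2) y)) \<longlonglongrightarrow> 0"
proof -
  define \<xi> where "\<xi> n = tens (upow U (int n * k1) x) (upow U (int n * k2) y)" for n
  have shift: "cinner (\<xi> (Suc n)) (tens (upow U k1 a) (upow U k2 b)) = cinner (\<xi> n) (tens a b)" for n a b
  proof -
    have "\<xi> (Suc n) = tens (upow U k1 (upow U (int n * k1) x)) (upow U k2 (upow U (int n * k2) y))"
      by (simp add: \<xi>_def upow_add[OF U, symmetric] algebra_simps)
    then show ?thesis by (simp add: \<xi>_def tensorD(5)[OF t] cinner_upow[OF U])
  qed
  have st: "stationary \<xi>" unfolding stationary_def
  proof (intro allI)
    fix n m
    have eq: "\<xi> (Suc m) = tens (upow U k1 (upow U (int m * k1) x)) (upow U k2 (upow U (int m * k2) y))"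
      by (simp add: \<xi>_def upow_add[OF U, symmetric] algebra_simps)
    show "cinner (\<xi> (Suc n)) (\<xi> (Suc m)) = cinner (\<xi> n) (\<xi> m)"
      unfolding eq shift unfolding \<xi>_def ..
  qed
  then obtain \<zeta> where \<zeta>: "cesaro \<xi> \<longlonglongrightarrow> \<zeta>"
    using mean_ergodic_stationary convergent_def by blast
  have lim: "cesaro (\<lambda>n. cinner (\<xi> n) z) \<longlonglongrightarrow> cinner \<zeta> z" for z
  proof -
    have "(\<lambda>N. cinner (cesaro \<xi> N) z) \<longlonglongrightarrow> cinner \<zeta> z" by (intro tendsto_intros \<zeta>)
    then show ?thesis by (simp only: cesaro_cinner_left[symmetric])
  qed
  have "cinner \<zeta> (tens (upow U k1 a) (upow U k2 b)) = cinner \<zeta> (tens a b)" for a b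
  proof -
    let ?z = "tens (upow U k1 a) (upow U k2 b)"
    have "(\<lambda>N. cesaro (\<lambda>n. cinner (\<xi> (n + 1)) ?z) N - cesaro (\<lambda>n. cinner (\<xi> n) ?z) N) \<longlonglongrightarrow> 0"
      by (rule cesaro_shift_tendsto[where K = "norm (\<xi> 0) * norm ?z"])
        (rule order_trans[OF cinner_norm_le], rule eq_refl, subst stationary_norm[OF st], rule refl)
    from tendsto_add[OF this lim[of ?z]]
    have "cesaro (\<lambda>n. cinner (\<xi> n) (tens a b)) \<longlonglongrightarrow> cinner \<zeta> ?z" by (simp add: shift)
    then show ?thesis by (rule LIMSEQ_unique[OF _ lim])
  qed
  moreover have "cinner \<zeta> (tens e b) = 0" if e: "U e = v *\<^sub>C e" for e v b
  proof -
    have "cinner (\<xi> n) (tens e b) = 0" for n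
      using eigen_orthogonalD[OF upow_eigen_orthogonal[OF U x] e] by (simp add: \<xi>_def tensorD(5)[OF t])
    then have "cesaro (\<lambda>_. 0) \<longlonglongrightarrow> cinner \<zeta> (tens e b)" using lim[of "tens e b"] by simp
    then show ?thesis by (rule LIMSEQ_unique[OF _ cesaro_const_tendsto])
  qed
  ultimately have "cinner \<zeta> (tens a b) = 0" for a b
    by (rule fixed_tensor_eq_0[OF t U k1])
  then have "cinner (\<xi> n) \<zeta> = 0" for n by (subst cinner_sym_0) (simp add: \<xi>_def)
  then have "cesaro (\<lambda>_. 0) \<longlonglongrightarrow> cinner \<zeta> \<zeta>" using lim[of \<zeta>] by simp
  then have "cinner \<zeta> \<zeta> = 0" by (rule LIMSEQ_unique[OF _ cesaro_const_tendsto])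
  then show ?thesis using \<zeta> by (simp add: \<xi>_def[abs_def])
qed

section \<open>Resolvents of self-adjoint elements\<close>

lemma neumann_inverse:
  fixes x :: "'a::{real_normed_algebra_1, banach}"
  assumes "norm x < 1"
  shows "\<exists>y. y * (1 - x) = 1 \<and> (1 - x) * y = 1"
proof (intro exI conjI)
  have s: "summable (\<lambda>n. x ^ n)" by (rule complete_algebra_summable_geometric[OF assms])
  have split: "(\<Sum>n. x ^ Suc n) = (\<Sum>n. x ^ n) - 1"
    using suminf_split_head[OF s] by simp
  have "x * (\<Sum>n. x ^ n) = (\<Sum>n. x ^ Suc n)" using suminf_mult[OF s, of x] by simp
  then show "(1 - x) * (\<Sum>n. x ^ n) = 1" by (simp only: left_diff_distrib split) simp
  have "(\<Sum>n. x ^ n) * x = (\<Sum>n. x ^ Suc n)"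
    using suminf_mult2[OF s, of x] by (simp add: power_commutes)
  then show "(\<Sum>n. x ^ n) * (1 - x) = 1" by (simp only: right_diff_distrib split) simp
qed

lemma star_zero [simp]: "0\<^sup>\<star> = (0::'a::unital_cstar_algebra)"
  using star_scaleC[of 0 "0::'a"] by simp

lemma star_minus: "(- x)\<^sup>\<star> = - (x::'a::unital_cstar_algebra)\<^sup>\<star>"
  using star_scaleC[of "-1" x] by (simp add: scaleC_minus_left)

lemma star_diff: "(x - y)\<^sup>\<star> = (x::'a::unital_cstar_algebra)\<^sup>\<star> - y\<^sup>\<star>"
  using star_add[of x "- y"] by (simp add: star_minus)

lemma star_one [simp]: "1\<^sup>\<star> = (1::'a::unital_cstar_algebra)"
  by (metis mult.right_neutral mult_1_left star_mult star_star)

lemma star_power: "(x ^ n)\<^sup>\<star> = (x::'a::unital_cstar_algebra)\<^sup>\<star> ^ n"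
  by (induction n) (simp_all add: star_mult power_commutes)

lemma norm_star_mult_self: "norm (x\<^sup>\<star> * x) = norm x * norm (x::'a::unital_cstar_algebra)"
  by (simp add: cstar_identity power2_eq_square)

text \<open>The bound comes from \<open>r - r\<^sup>\<star> = -2is r\<^sup>\<star> r\<close> and the C*-identity.\<close>

lemma resolvent_norm_le:
  fixes h r :: "'a::unital_cstar_algebra"
  assumes h: "h\<^sup>\<star> = h" and s: "0 < s"
    and r: "(h + (\<i> * of_real s) *\<^sub>C 1) * r = 1"
  shows "norm r \<le> 1 / s"
proof (cases "r = 0")
  case False
  let ?e = "(\<i> * of_real s) *\<^sub>C (1::'a)"
  have "((h + ?e) * r)\<^sup>\<star> = 1" by (simp add: r)
  then have r': "r\<^sup>\<star> * (h - ?e) = 1"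
    by (simp add: star_mult star_add h star_scaleC scaleC_minus_left)
  have "r - r\<^sup>\<star> = r\<^sup>\<star> * (h - ?e) * r - r\<^sup>\<star> * ((h + ?e) * r)"
    using r r' by simp
  also have "\<dots> = r\<^sup>\<star> * (- (2 * \<i> * of_real s) *\<^sub>C r)"
  proof -
    have "(h - ?e) * r - (h + ?e) * r = - (2 * \<i> * of_real s) *\<^sub>C r"
      by (simp add: left_diff_distrib distrib_right mult_scaleC_left scaleC_minus_left
          scaleC_add_left[symmetric] algebra_simps)
    then show ?thesis by (metis mult.assoc right_diff_distrib)
  qed
  finally have "r - r\<^sup>\<star> = - (2 * \<i> * of_real s) *\<^sub>C (r\<^sup>\<star> * r)"
    by (simp add: mult_scaleC_right)
  then have "norm (r - r\<^sup>\<star>) = 2 * s * (norm r * norm r)"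
    using s by (simp add: norm_scaleC norm_star_mult_self norm_mult)
  moreover have "norm (r - r\<^sup>\<star>) \<le> 2 * norm r"
    using norm_triangle_ineq4[of r "r\<^sup>\<star>"] by (simp add: norm_star)
  ultimately have "(s * norm r) * norm r \<le> 1 * norm r" by simp
  then have "s * norm r \<le> 1" using False by (simp only: mult_le_cancel_right_pos zero_less_norm_iff simp_thms)
  then show ?thesis using s by (simp add: field_simps)
qed (use s in simp)

text \<open>The Neumann series inverts \<open>h + \<i>s\<close> only for \<open>s\<close> above
  \<open>norm h\<close>. For \<open>s = norm h + 1\<close> the bound \<open>1 / s\<close> on that
  inverse allows one more perturbation, from \<open>\<i>s\<close> to \<open>\<i>\<close>, because
  the two points are only \<open>s - 1\<close> apart.\<close>

lemma resolvent_exists: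
  fixes h :: "'a::unital_cstar_algebra"
  assumes h: "h\<^sup>\<star> = h"
  obtains r where "r * (h + \<i> *\<^sub>C 1) = 1" "(h + \<i> *\<^sub>C 1) * r = 1" "norm r \<le> 1"
proof -
  define s where "s = norm h + 1"
  have s: "0 < s" "1 \<le> s" "norm h < s" by (simp_all add: s_def add_nonneg_pos)
  define z where "z = \<i> * complex_of_real s"
  have z: "z \<noteq> 0" "cmod z = s" using s by (auto simp: z_def norm_mult)
  define x where "x = (- inverse z) *\<^sub>C h"
  have "norm x < 1" using s z by (simp add: x_def norm_scaleC norm_inverse) (simp add: field_simps)
  then obtain y where y: "y * (1 - x) = 1" "(1 - x) * y = 1" using neumann_inverse by blast
  have hz: "h + z *\<^sub>C 1 = z *\<^sub>C (1 - x)"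
    using z by (simp add: x_def scaleC_diff_right scaleC_add_right scaleC_scaleC scaleC_minus_left
        add.commute)
  define r where "r = inverse z *\<^sub>C y"
  have r: "r * (h + z *\<^sub>C 1) = 1" "(h + z *\<^sub>C 1) * r = 1"
    using y z unfolding hz r_def by (simp_all add: mult_scaleC_left mult_scaleC_right scaleC_scaleC)
  have rn: "norm r \<le> 1 / s"
    by (rule resolvent_norm_le[OF h s(1)]) (use r in \<open>simp add: z_def\<close>)
  define w where "w = (z - \<i>) *\<^sub>C r"
  have "z - \<i> = \<i> * of_real (s - 1)" by (simp add: z_def algebra_simps)
  then have "cmod (z - \<i>) = s - 1" using s by (simp add: norm_mult del: of_real_diff)
  then have "norm w \<le> (s - 1) * (1 / s)" using mult_left_mono[OF rn, of "s - 1"] s by (simp add: w_def norm_scaleC)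
  also have "\<dots> < 1" using s by (simp add: field_simps)
  finally obtain v where v: "v * (1 - w) = 1" "(1 - w) * v = 1" using neumann_inverse by blast
  have e: "h + \<i> *\<^sub>C 1 = (h + z *\<^sub>C 1) - (z - \<i>) *\<^sub>C 1" by (simp add: scaleC_diff_left)
  have e1: "h + \<i> *\<^sub>C 1 = (1 - w) * (h + z *\<^sub>C 1)"
    unfolding e by (simp add: left_diff_distrib w_def mult_scaleC_left r)
  have e2: "h + \<i> *\<^sub>C 1 = (h + z *\<^sub>C 1) * (1 - w)"
    unfolding e by (simp add: right_diff_distrib w_def mult_scaleC_right r)
  have R: "(r * v) * (h + \<i> *\<^sub>C 1) = 1" unfolding e1 by (metis mult.assoc mult_1_right r(1) v(1))
  have L: "(h + \<i> *\<^sub>C 1) * (v * r) = 1" unfolding e2 by (metis mult.assoc mult_1_right r(2) v(2))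
  have "r * v = v * r" by (metis L R mult.assoc mult_1_left mult_1_right)
  then show ?thesis using that[of "r * v"] R L resolvent_norm_le[OF h, of 1 "r * v"] by simp
qed

section \<open>Cyclic representations\<close>

instantiation prod :: (complex_normed_vector, complex_normed_vector) complex_normed_vector
begin
definition "scaleC c p = (c *\<^sub>C fst p, c *\<^sub>C snd p)"
instance
proof
  fix c d :: complex and r :: real and p q :: "'a \<times> 'b"
  show "c *\<^sub>C (p + q) = c *\<^sub>C p + c *\<^sub>C q" "(c + d) *\<^sub>C p = c *\<^sub>C p + d *\<^sub>C p"
    "c *\<^sub>C d *\<^sub>C p = (c * d) *\<^sub>C p" "r *\<^sub>R p = complex_of_real r *\<^sub>C p"
    by (simp_all add: scaleC_prod_def scaleC_add_right scaleC_add_left scaleC_scaleC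
        scaleR_prod_def scaleR_scaleC)
  have "sqrt ((cmod c * a)\<^sup>2 + (cmod c * b)\<^sup>2) = cmod c * sqrt (a\<^sup>2 + b\<^sup>2)" for a b
    by (simp add: power_mult_distrib distrib_left[symmetric] real_sqrt_mult)
  then show "norm (c *\<^sub>C p) = cmod c * norm p"
    by (simp add: scaleC_prod_def norm_prod_def norm_scaleC)
qed
end

instantiation prod :: (complex_hilbert, complex_hilbert) complex_hilbert
begin
definition "cinner p q = cinner (fst p) (fst q) + cinner (snd p) (snd q)"
instance
proof
  fix c :: complex and p q r :: "'a \<times> 'b"
  show "cinner (p + q) r = cinner p r + cinner q r" "cinner (c *\<^sub>C p) q = c * cinner p q"
    "inner p q = Re (cinner p q)"
    by (simp_all add: cinner_prod_def cinner_add_left scaleC_prod_def cinner_scaleC_left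
        distrib_left inner_prod_def inner_eq_Re_cinner)
  show "cinner p q = cnj (cinner q p)"
    by (simp add: cinner_prod_def cinner_commute[of "fst p"] cinner_commute[of "snd p"])
qed
end

lift_definition amplify :: "('h::complex_hilbert \<Rightarrow>\<^sub>C\<^sub>L 'h) \<Rightarrow> ('h \<times> 'h) \<Rightarrow>\<^sub>C\<^sub>L ('h \<times> 'h)"
  is "\<lambda>T p. (T (fst p), T (snd p))"
proof -
  fix T :: "'h \<Rightarrow> 'h" assume T: "bounded_clinear T"
  then have b: "bounded_linear T" by (simp add: bounded_clinear_def)
  have "bounded_linear (\<lambda>p. (T (fst p), T (snd p)))"
    by (intro bounded_linear_Pair bounded_linear_compose[OF b] bounded_linear_fst bounded_linear_snd)
  then show "bounded_clinear (\<lambda>p. (T (fst p), T (snd p)))"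
    using T by (simp add: bounded_clinear_def scaleC_prod_def)
qed

lemma amplify_apply [simp]: "amplify T p = (T (fst p), T (snd p))"
  by (simp add: amplify.rep_eq)

lemma amplify_cadjoint: "(amplify T)\<^sup>\<dagger> = amplify (T\<^sup>\<dagger>)"
  by (rule cadjoint_eqI) (simp add: cinner_prod_def cinner_adj_left)

text \<open>Unital *-algebras of operators without any closedness, so that the images of the
  algebra, their amplifications and commutants are all covered.\<close>

definition operator_algebra :: "('h::complex_hilbert \<Rightarrow>\<^sub>C\<^sub>L 'h) set \<Rightarrow> bool" where
  "operator_algebra S \<longleftrightarrow> cblinfun_id \<in> S \<and> (\<forall>X\<in>S. \<forall>Y\<in>S. X + Y \<in> S) \<and> (\<forall>c. \<forall>X\<in>S. c *\<^sub>C X \<in> S) \<and>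
     (\<forall>X\<in>S. \<forall>Y\<in>S. X o\<^sub>C Y \<in> S) \<and> (\<forall>X\<in>S. X\<^sup>\<dagger> \<in> S)"

lemma operator_algebra_amplify:
  assumes "operator_algebra S" shows "operator_algebra (amplify ` S)"
proof -
  have "amplify X + amplify Y = amplify (X + Y)" "c *\<^sub>C amplify X = amplify (c *\<^sub>C X)"
    "amplify X o\<^sub>C amplify Y = amplify (X o\<^sub>C Y)" "cblinfun_id = amplify cblinfun_id" for c and X Y :: "'a \<Rightarrow>\<^sub>C\<^sub>L 'a"
    by (auto intro!: cblinfun_eqI simp: scaleC_prod_def)
  then show ?thesis using assms unfolding operator_algebra_def
    by (auto simp: amplify_cadjoint)
qed

text \<open>An operator commuting with the amplification of \<open>S\<close> is a two by two matrix
  whose entries commute with \<open>S\<close>, hence each with \<open>T\<close>.\<close>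

lemma amplify_bicommutant:
  assumes T: "T \<in> commutant (commutant S)"
  shows "amplify T \<in> commutant (commutant (amplify ` S))"
proof (rule commutantI)
  fix R :: "('a \<times> 'a) \<Rightarrow>\<^sub>C\<^sub>L ('a \<times> 'a)" and x :: "'a \<times> 'a"
  assume R: "R \<in> commutant (amplify ` S)"
  \<comment> \<open>The coordinate embeddings; with the coordinate projections in \<open>Q\<close>
    they cut out all four matrix entries of \<open>R\<close> at once.\<close>
  define J where "J = {\<lambda>x::'a. (x, 0::'a), \<lambda>x. (0, x)}"
  define Q where "Q = {fst, snd :: 'a \<times> 'a \<Rightarrow> 'a}"
  have entry: "T (q (R (j x))) = q (R (j (T x)))" if "j \<in> J" "q \<in> Q" for j q x
  proof -
    have j: "j (x + y) = j x + j y" "j (c *\<^sub>C x) = c *\<^sub>C j x" "norm (j x) = norm x"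
      "amplify X (j x) = j (X x)" for x y c and X :: "'a \<Rightarrow>\<^sub>C\<^sub>L 'a"
      using that(1) by (auto simp: J_def scaleC_prod_def norm_prod_def)
    have q: "q (x + y) = q x + q y" "q (c *\<^sub>C x) = c *\<^sub>C q x" "norm (q x) \<le> norm x"
      "q (amplify X x) = X (q x)" for x y :: "'a \<times> 'a" and c and X :: "'a \<Rightarrow>\<^sub>C\<^sub>L 'a"
      using that(2) norm_fst_le[of "fst x" "snd x"] norm_snd_le[of "snd x" "fst x"]
      by (auto simp: Q_def scaleC_prod_def)
    have "\<exists>P :: 'a \<Rightarrow>\<^sub>C\<^sub>L 'a. \<forall>x. P x = q (R (j x))"
    proof (rule Cblinfun_exists)
      show "norm (q (R (j x))) \<le> norm R * norm x" for x
        using order_trans[OF q(3) cblinfun_apply_le[of R "j x"]] by (simp add: j)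
    qed (simp_all add: j q cblinfun_add_right cblinfun_scaleC_right)
    then obtain P :: "'a \<Rightarrow>\<^sub>C\<^sub>L 'a" where P: "\<And>x. P x = q (R (j x))" by blast
    have "P \<in> commutant S"
    proof (rule commutantI)
      fix X x assume "X \<in> S"
      then have "R (amplify X (j x)) = amplify X (R (j x))" by (intro commutantD[OF R]) simp
      then show "P (X x) = X (P x)" by (simp only: P j(4) q(4))
    qed
    then show ?thesis using commutantD[OF T, of P x] by (simp add: P)
  qed
  have split: "R (a, b) = R (a, 0) + R (0, b)" for a b
    unfolding cblinfun_add_right[symmetric] by simp
  obtain a b where x: "x = (a, b)" by (cases x)
  show "amplify T (R x) = R (amplify T x)"
    unfolding x amplify_apply fst_conv snd_conv split[of a b] split[of "T a" "T b"]
    using entry[of "\<lambda>x. (x, 0)" fst a] entry[of "\<lambda>x. (x, 0)" snd a]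
      entry[of "\<lambda>x. (0, x)" fst b] entry[of "\<lambda>x. (0, x)" snd b]
    by (simp add: J_def Q_def cblinfun_add_right prod_eq_iff)
qed

text \<open>The projection onto the closure of \<open>S x\<close> commutes with \<open>S\<close>,
  hence with \<open>T\<close>, and it fixes \<open>x\<close> because \<open>S\<close> contains the
  identity. Several vectors are treated at once by amplification.\<close>

lemma bicommutant_closure_orbit:
  assumes S: "operator_algebra S" and T: "T \<in> commutant (commutant S)"
  shows "T x \<in> closure ((\<lambda>X. cblinfun_apply X x) ` S)"
proof -
  define E where "E = (\<lambda>X. cblinfun_apply X x) ` S"
  have S': "cblinfun_id \<in> S" "\<And>X Y. X \<in> S \<Longrightarrow> Y \<in> S \<Longrightarrow> X + Y \<in> S" "\<And>c X. X \<in> S \<Longrightarrow> c *\<^sub>C X \<in> S"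
    "\<And>X Y. X \<in> S \<Longrightarrow> Y \<in> S \<Longrightarrow> X o\<^sub>C Y \<in> S" "\<And>X. X \<in> S \<Longrightarrow> X\<^sup>\<dagger> \<in> S"
    using S by (auto simp: operator_algebra_def)
  have xE: "x \<in> E" unfolding E_def by (rule rev_image_eqI[OF S'(1)]) simp
  have "csubspace E" unfolding csubspace_def
  proof (intro conjI ballI allI)
    show "0 \<in> E" unfolding E_def by (rule rev_image_eqI[OF S'(3)[OF S'(1), of 0]]) simp
    fix a assume "a \<in> E"
    then obtain X where X: "X \<in> S" "a = X x" by (auto simp: E_def)
    show "c *\<^sub>C a \<in> E" for c
      unfolding E_def by (rule rev_image_eqI[OF S'(3)[OF X(1), of c]]) (simp add: X)
    fix b assume "b \<in> E"
    then obtain Y where Y: "Y \<in> S" "b = Y x" by (auto simp: E_def)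
    show "a + b \<in> E"
      unfolding E_def by (rule rev_image_eqI[OF S'(2)[OF X(1) Y(1)]]) (simp add: X Y)
  qed
  then have cE: "csubspace (closure E)" by (rule csubspace_closure)
  obtain P :: "'a \<Rightarrow>\<^sub>C\<^sub>L 'a" where P: "\<And>x. P x \<in> closure E" "\<And>x e. e \<in> closure E \<Longrightarrow> cinner (x - P x) e = 0"
    "\<And>x p. p \<in> closure E \<Longrightarrow> (\<And>e. e \<in> closure E \<Longrightarrow> cinner (x - p) e = 0) \<Longrightarrow> P x = p"
    using orthogonal_projection[OF cE closed_closure] by metis
  have inv: "X e \<in> closure E" if "X \<in> S" "e \<in> closure E" for X e
  proof -
    obtain f where f: "\<And>n. f n \<in> E" "f \<longlonglongrightarrow> e" using \<open>e \<in> closure E\<close> by (auto simp: closure_sequential)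
    have "X (f n) \<in> E" for n
    proof -
      obtain Y where Y: "Y \<in> S" "f n = Y x" using f(1)[of n] by (auto simp: E_def)
      show ?thesis unfolding E_def
        by (rule rev_image_eqI[OF S'(4)[OF \<open>X \<in> S\<close> Y(1)]]) (simp add: Y)
    qed
    then show ?thesis unfolding closure_sequential
      by (intro exI[of _ "\<lambda>n. X (f n)"]) (auto intro!: tendsto_intros f)
  qed
  have "P \<in> commutant S" by (rule projection_in_commutant[OF cE S'(5) inv P])
  then have "T (P x) = P (T x)" by (rule commutantD[OF T])
  moreover have "P x = x" using xE closure_subset by (intro P(3)) auto
  ultimately have "T x = P (T x)" by simp
  then show ?thesis using P(1) by (metis E_def)
qed

lemma subspace_closure:
  fixes E :: "'a::real_normed_vector set"
  assumes E: "subspace E" shows "subspace (closure E)"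
  unfolding subspace_def
proof (intro conjI ballI allI)
  show "0 \<in> closure E" using subspace_0[OF E] closure_subset by blast
  fix x assume "x \<in> closure E"
  then obtain f where f: "\<And>n. f n \<in> E" "f \<longlonglongrightarrow> x" by (auto simp: closure_sequential)
  show "c *\<^sub>R x \<in> closure E" for c
    unfolding closure_sequential using f subspace_scale[OF E]
    by (intro exI[of _ "\<lambda>n. c *\<^sub>R f n"]) (auto intro!: tendsto_intros)
  fix y assume "y \<in> closure E"
  then obtain g where g: "\<And>n. g n \<in> E" "g \<longlonglongrightarrow> y" by (auto simp: closure_sequential)
  show "x + y \<in> closure E"
    unfolding closure_sequential using f g subspace_add[OF E]
    by (intro exI[of _ "\<lambda>n. f n + g n"]) (auto intro!: tendsto_intros)
qed

section \<open>Contractivity, self-adjoint approximation and truncation\<close>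

locale cyclic_representation =
  fixes \<omega> :: "'a::unital_cstar_algebra cdual" and \<pi> :: "'a \<Rightarrow> 'h::complex_hilbert \<Rightarrow>\<^sub>C\<^sub>L 'h" and \<Omega> :: 'h
  assumes pi_add: "\<pi> (a + b) = \<pi> a + \<pi> b"
    and pi_scaleC: "\<pi> (c *\<^sub>C a) = c *\<^sub>C \<pi> a"
    and pi_mult: "\<pi> (a * b) = \<pi> a o\<^sub>C \<pi> b"
    and pi_star: "\<pi> (a\<^sup>\<star>) = (\<pi> a)\<^sup>\<dagger>"
    and pi_one: "\<pi> 1 = cblinfun_id"
    and cyclic: "closure (range (\<lambda>a. \<pi> a \<Omega>)) = UNIV"
    and omega_eq: "\<omega> a = cinner (\<pi> a \<Omega>) \<Omega>"
begin

lemma pi_adj_left: "cinner (\<pi> a x) y = cinner x (\<pi> (a\<^sup>\<star>) y)"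
  by (simp add: pi_star cinner_adj_left)

lemma pi_adj_right: "cinner x (\<pi> a y) = cinner (\<pi> (a\<^sup>\<star>) x) y"
  by (simp add: pi_adj_left star_star)

lemma operator_algebra_pi: "operator_algebra (range \<pi>)"
  unfolding operator_algebra_def
  by (auto simp: pi_one[symmetric] pi_add[symmetric] pi_scaleC[symmetric] pi_mult[symmetric]
      pi_star[symmetric])

lemma range_pi_cadjoint: "X \<in> range \<pi> \<Longrightarrow> X\<^sup>\<dagger> \<in> range \<pi>"
  by (auto simp: pi_star[symmetric])

lemma commutant_pi_cadjoint: "B \<in> commutant (range \<pi>) \<Longrightarrow> B\<^sup>\<dagger> \<in> commutant (range \<pi>)"
  by (rule commutant_cadjoint[OF range_pi_cadjoint])

lemma commutant_piD: "B \<in> commutant (range \<pi>) \<Longrightarrow> B (\<pi> a x) = \<pi> a (B x)"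
  by (rule commutantD) auto

text \<open>Iterating the Cauchy-Schwarz inequality and comparing with the boundedness of \<open>\<omega>\<close>.\<close>

lemma pi_contractive_aux:
  assumes x: "x = \<pi> c \<Omega>" "x \<noteq> 0" and h: "h\<^sup>\<star> = h"
  shows "cmod (cinner (\<pi> h x) x) \<le> norm h * (norm x)\<^sup>2"
proof (cases "h = 0")
  case True
  have "\<pi> h x = 0" using pi_scaleC[of 0 h] by (simp add: True)
  then show ?thesis by simp
next
  case False
  define \<psi> where "\<psi> a = cinner (\<pi> a x) x" for a
  define K where "K = norm c * norm c * norm \<omega>"
  \<comment> \<open>This crude bound depends on \<open>c\<close> only through the constant
    \<open>K\<close>; repeated squaring followed by roots removes the constant.\<close>
  have psi_le: "cmod (\<psi> a) \<le> K * norm a" for a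
  proof -
    have "\<psi> a = \<omega> (c\<^sup>\<star> * a * c)"
      unfolding \<psi>_def x omega_eq pi_mult by (simp add: pi_adj_left star_star)
    then have "cmod (\<psi> a) \<le> norm (c\<^sup>\<star> * a * c) * norm \<omega>" by (simp add: norm_cblinfun_apply_le)
    also have "norm (c\<^sup>\<star> * a * c) \<le> norm c * norm a * norm c"
      using order_trans[OF norm_mult_ineq mult_right_mono[OF norm_mult_ineq norm_ge_zero], of "c\<^sup>\<star>" a c]
      by (simp add: norm_star)
    finally show ?thesis by (simp add: K_def mult_right_mono ac_simps)
  qed
  define n2 where "n2 = (norm x)\<^sup>2"
  have n2: "0 < n2" using x by (simp add: n2_def)
  have CS: "(cmod (\<psi> h) / n2) ^ (2 ^ n) \<le> cmod (\<psi> (h ^ (2 ^ n))) / n2" for n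
  proof (induction n)
    case (Suc n)
    let ?k = "h ^ (2 ^ n)"
    have "(cmod (\<psi> ?k))\<^sup>2 \<le> (norm (\<pi> ?k x) * norm x)\<^sup>2"
      unfolding \<psi>_def by (intro power_mono cinner_norm_le) simp
    also have "\<dots> = (norm (\<pi> ?k x))\<^sup>2 * n2" by (simp add: power_mult_distrib n2_def)
    also have "(norm (\<pi> ?k x))\<^sup>2 = cmod (cinner (\<pi> ?k x) (\<pi> ?k x))"
      unfolding cinner_self norm_of_real by simp
    also have "cinner (\<pi> ?k x) (\<pi> ?k x) = \<psi> (h ^ (2 ^ Suc n))"
      unfolding \<psi>_def pi_adj_right by (simp add: star_power h mult_2 power_add pi_mult)
    finally have le: "(cmod (\<psi> ?k))\<^sup>2 \<le> cmod (\<psi> (h ^ (2 ^ Suc n))) * n2" .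
    have "(cmod (\<psi> h) / n2) ^ (2 ^ Suc n) = ((cmod (\<psi> h) / n2) ^ (2 ^ n))\<^sup>2"
      by (simp add: power_mult[symmetric] mult.commute)
    also have "\<dots> \<le> (cmod (\<psi> ?k) / n2)\<^sup>2"
      using n2 by (intro power_mono Suc) simp
    also have "\<dots> \<le> cmod (\<psi> (h ^ (2 ^ Suc n))) / n2"
      using le n2 by (simp add: power_divide power2_eq_square[of n2] divide_simps)
    finally show ?case .
  qed simp
  \<comment> \<open>The claim is \<open>q \<le> 1\<close>. The powers \<open>q ^ (2 ^ n)\<close> are
    at most \<open>K / n2\<close>, so all powers are bounded, which excludes
    \<open>q > 1\<close>.\<close>
  define q where "q = cmod (\<psi> h) / (n2 * norm h)"
  have q0: "0 \<le> q" using n2 by (simp add: q_def)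
  have bound: "q ^ n \<le> max 1 (K / n2)" for n
  proof (cases "q \<le> 1")
    case True
    then have "q ^ n \<le> 1" using q0 by (simp add: power_le_one)
    then show ?thesis by simp
  next
    case q1: False
    have "n \<le> 2 ^ n" by (simp add: less_imp_le)
    then have "q ^ n \<le> q ^ (2 ^ n)" using q1 by (intro power_increasing) auto
    also have "\<dots> = (cmod (\<psi> h) / n2) ^ (2 ^ n) / norm h ^ (2 ^ n)"
      by (simp add: q_def power_divide power_mult_distrib)
    also have "\<dots> \<le> (K * norm (h ^ (2 ^ n)) / n2) / norm h ^ (2 ^ n)"
      using order_trans[OF CS divide_right_mono[OF psi_le]] n2 by (intro divide_right_mono) auto
    also have "\<dots> \<le> (K * norm h ^ (2 ^ n) / n2) / norm h ^ (2 ^ n)"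
      using n2 by (intro divide_right_mono mult_left_mono norm_power_ineq) (auto simp: K_def)
    also have "\<dots> = K / n2" using False by simp
    finally show ?thesis by simp
  qed
  have "q \<le> 1"
  proof (rule ccontr)
    assume "\<not> q \<le> 1"
    then obtain n where "max 1 (K / n2) < q ^ n" 
      using real_arch_pow[of q "max 1 (K / n2)"] by (auto simp: not_le simp del: max_less_iff_conj)
    then show False using bound[of n] by linarith
  qed
  then have "cmod (\<psi> h) \<le> n2 * norm h" using n2 False by (simp add: q_def divide_le_eq)
  then show ?thesis by (simp add: \<psi>_def n2_def mult.commute)
qed

text \<open>The C*-identity converts the estimate for the self-adjoint element
  \<open>a\<^sup>\<star> * a\<close> into one for \<open>a\<close>, and cyclicity extends it to all
  vectors.\<close>

lemma pi_contractive: "norm (\<pi> a x) \<le> norm a * norm x"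
proof -
  have *: "norm (\<pi> a x) \<le> norm a * norm x" if x: "x \<in> range (\<lambda>c. \<pi> c \<Omega>)" for x
  proof (cases "x = 0")
    case False
    obtain c where c: "x = \<pi> c \<Omega>" using x by blast
    have "(norm (\<pi> a x))\<^sup>2 = cmod (cinner (\<pi> a x) (\<pi> a x))"
      unfolding cinner_self norm_of_real by simp
    also have "cinner (\<pi> a x) (\<pi> a x) = cinner (\<pi> (a\<^sup>\<star> * a) x) x"
      unfolding pi_adj_right by (simp add: pi_mult)
    also have "cmod \<dots> \<le> norm (a\<^sup>\<star> * a) * (norm x)\<^sup>2"
      by (rule pi_contractive_aux[OF c False]) (simp add: star_mult star_star)
    also have "\<dots> = (norm a * norm x)\<^sup>2" by (simp add: cstar_identity power_mult_distrib)
    finally show ?thesis by (rule power2_le_imp_le) simp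
  qed simp
  have "closed {x. norm (\<pi> a x) \<le> norm a * norm x}"
    by (intro closed_Collect_le continuous_intros)
  then have "closure (range (\<lambda>c. \<pi> c \<Omega>)) \<subseteq> {x. norm (\<pi> a x) \<le> norm a * norm x}"
    by (rule closure_minimal[rotated]) (use * in blast)
  then show ?thesis using cyclic by auto
qed

text \<open>Real orthogonality to the self-adjoint elements is a complex linear condition on four vectors,
  to which the double commutant theorem applies after amplification.\<close>

lemma selfadjoint_approximation:
  assumes T: "T \<in> commutant (commutant (range \<pi>))" "T\<^sup>\<dagger> = T"
  shows "(T x, T y) \<in> closure {(\<pi> h x, \<pi> h y) | h. h\<^sup>\<star> = h}"
proof -
  define G where "G = {(\<pi> h x, \<pi> h y) | h. h\<^sup>\<star> = h}"
  have "subspace G" unfolding subspace_def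
  proof (intro conjI ballI allI)
    have "\<pi> 0 = 0" using pi_scaleC[of 0 0] by (auto intro: cblinfun_eqI)
    then show "0 \<in> G" unfolding G_def by (intro CollectI exI[of _ 0]) (simp add: zero_prod_def)
    fix p assume "p \<in> G"
    then obtain h where h: "h\<^sup>\<star> = h" "p = (\<pi> h x, \<pi> h y)" by (auto simp: G_def)
    show "r *\<^sub>R p \<in> G" for r
      unfolding G_def using h
      by (intro CollectI exI[of _ "of_real r *\<^sub>C h"])
        (simp add: pi_scaleC star_scaleC scaleR_scaleC scaleC_prod_def)
    fix q assume "q \<in> G"
    then obtain k where k: "k\<^sup>\<star> = k" "q = (\<pi> k x, \<pi> k y)" by (auto simp: G_def)
    show "p + q \<in> G"
      unfolding G_def using h k by (intro CollectI exI[of _ "h + k"]) (simp add: pi_add star_add)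
  qed
  then have "subspace (closure G)" by (rule subspace_closure)
  from real_orthogonal_decomposition[OF this closed_closure, of "(T x, T y)"]
  obtain p where p: "p \<in> closure G" "\<And>e. e \<in> closure G \<Longrightarrow> inner ((T x, T y) - p) e = 0" by blast
  obtain u w where uw: "(T x, T y) - p = (u, w)" by (cases "(T x, T y) - p")
  define \<phi> where "\<phi> a = cinner (\<pi> a x) u + cinner (\<pi> a y) w" for a
  have re: "Re (\<phi> h) = 0" if "h\<^sup>\<star> = h" for h
  proof -
    have "(\<pi> h x, \<pi> h y) \<in> closure G" using that closure_subset by (force simp: G_def)
    from p(2)[OF this] have "inner (\<pi> h x, \<pi> h y) (u, w) = 0"
      by (simp only: uw inner_commute[of "(\<pi> h x, \<pi> h y)"])
    then show ?thesis by (simp add: \<phi>_def inner_eq_Re_cinner cinner_prod_def)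
  qed
  have phi_add: "\<phi> (a + b) = \<phi> a + \<phi> b" "\<phi> (c *\<^sub>C a) = c * \<phi> a" for a b c
    by (simp_all add: \<phi>_def pi_add pi_scaleC cinner_add_left cinner_scaleC_left distrib_left)
  \<comment> \<open>The real part of \<phi> vanishes on self-adjoint elements; applied to
    \<open>a + a\<^sup>\<star>\<close> and to \<open>\<i> *\<^sub>C (a - a\<^sup>\<star>)\<close>
    this yields a relation for arbitrary \<open>a\<close>.\<close>
  have zero: "\<phi> a + cnj (\<phi> (a\<^sup>\<star>)) = 0" for a
  proof -
    have "Re (\<phi> (a + a\<^sup>\<star>)) = 0" by (rule re) (simp add: star_add star_star add.commute)
    moreover have "Re (\<phi> (\<i> *\<^sub>C (a + (- 1) *\<^sub>C a\<^sup>\<star>))) = 0"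
      by (rule re) (simp add: star_diff star_star star_scaleC scaleC_diff_right scaleC_minus_left)
    ultimately show ?thesis unfolding phi_add by (simp add: complex_eq_iff)
  qed
  \<comment> \<open>The pairs appear crosswise in \<open>Z\<close> and \<open>?X\<close>: pairing
    the amplified \<open>\<pi> a\<close> at \<open>?X\<close> with \<open>Z\<close> gives exactly
    \<open>\<phi> a + cnj (\<phi> (a\<^sup>\<star>))\<close>, which is zero and survives passage to
    \<open>T\<close>.\<close>
  define Z where "Z = ((u, w), (x, y))"
  let ?X = "((x, y), (u, w))"
  let ?S = "amplify ` amplify ` range \<pi>"
  have "closed {p. cinner p Z = 0}" by (intro closed_Collect_eq continuous_intros)
  moreover have "cinner (X ?X) Z = 0" if X: "X \<in> ?S" for X
  proof -
    obtain a where a: "X = amplify (amplify (\<pi> a))" using X by blast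
    have "cinner (\<pi> a u) x = cnj (cinner (\<pi> (a\<^sup>\<star>) x) u)" "cinner (\<pi> a w) y = cnj (cinner (\<pi> (a\<^sup>\<star>) y) w)"
      by (subst pi_adj_left, subst cinner_commute, simp)+
    then have "cinner (X ?X) Z = \<phi> a + cnj (\<phi> (a\<^sup>\<star>))"
      by (simp add: a Z_def cinner_prod_def \<phi>_def)
    then show ?thesis using zero by simp
  qed
  then have "(\<lambda>X. cblinfun_apply X ?X) ` ?S \<subseteq> {p. cinner p Z = 0}" by blast
  ultimately have sub: "closure ((\<lambda>X. cblinfun_apply X ?X) ` ?S) \<subseteq> {p. cinner p Z = 0}"
    by (intro closure_minimal)
  have "amplify (amplify T) ?X \<in> closure ((\<lambda>X. cblinfun_apply X ?X) ` ?S)"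
    by (intro bicommutant_closure_orbit operator_algebra_amplify operator_algebra_pi
        amplify_bicommutant T(1))
  then have "cinner (amplify (amplify T) ?X) Z = 0" using sub by blast
  then have "cinner (T x) u + cinner (T y) w + (cinner (T u) x + cinner (T w) y) = 0"
    by (simp add: Z_def cinner_prod_def)
  moreover have "cinner (T u) x = cnj (cinner (T x) u)" "cinner (T w) y = cnj (cinner (T y) w)"
    by (subst cinner_adj_left, subst cinner_commute, simp add: T(2))+
  ultimately have "Re (cinner (T x) u) + Re (cinner (T y) w) = 0"
    by (simp add: complex_eq_iff)
  then have "inner (T x, T y) (u, w) = 0"
    by (simp add: inner_eq_Re_cinner cinner_prod_def)
  moreover have "inner p (u, w) = 0" using p uw by (metis inner_commute)
  ultimately have "inner (u, w) (u, w) = 0" unfolding uw[symmetric] by (simp add: inner_diff_left)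
  then have "(T x, T y) = p" unfolding inner_eq_zero_iff uw[symmetric] by simp
  then show ?thesis using p(1) by (simp add: G_def)
qed

text \<open>For self-adjoint \<open>h\<close> the cross term in the squared norm of
  \<open>\<pi> h y + z *\<^sub>C y\<close> disappears when \<open>z\<close> is \<open>\<i>\<close>
  or \<open>- \<i>\<close>, so that vector is at least as long as \<open>y\<close>.\<close>

lemma pi_resolvent:
  assumes h: "h\<^sup>\<star> = h" and r: "r * (h + z *\<^sub>C 1) = 1" "(h + z *\<^sub>C 1) * r = 1" and z: "z = \<i> \<or> z = - \<i>"
  shows "norm (\<pi> r x) \<le> norm x" "\<pi> r (\<pi> h x) = x - z *\<^sub>C \<pi> r x"
proof -
  have "\<pi> r (\<pi> h x + z *\<^sub>C x) = x" for x
    using arg_cong[OF r(1), of "\<lambda>a. \<pi> a x"] by (simp add: pi_mult pi_add pi_scaleC pi_one)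
  then show "\<pi> r (\<pi> h x) = x - z *\<^sub>C \<pi> r x"
    by (simp add: cblinfun_add_right cblinfun_scaleC_right eq_diff_eq)
  define y where "y = \<pi> r x"
  have xy: "x = \<pi> h y + z *\<^sub>C y"
    using arg_cong[OF r(2), of "\<lambda>a. \<pi> a x"] by (simp add: y_def pi_mult pi_add pi_scaleC pi_one)
  have "cinner (\<pi> h y) y = cnj (cinner (\<pi> h y) y)"
    by (subst pi_adj_left, subst cinner_commute) (simp add: h)
  then have "Im (cinner (\<pi> h y) y) = 0" by (simp add: complex_eq_iff)
  then have "(norm x)\<^sup>2 = (norm (\<pi> h y))\<^sup>2 + (norm y)\<^sup>2"
    unfolding xy norm_add_sq cinner_scaleC_right using z by (auto simp: norm_scaleC)
  then have "(norm y)\<^sup>2 \<le> (norm x)\<^sup>2" by simp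
  then show "norm (\<pi> r x) \<le> norm x" unfolding y_def by (rule power2_le_imp_le) simp
qed

text \<open>Kaplansky's truncation \<open>b = 2h / (1 + h\<^sup>2) = (h + i)\<^sup>-\<^sup>1 + (h - i)\<^sup>-\<^sup>1\<close> fixes vectors with
  \<open>h y = y\<close> and kills those with \<open>h x = 0\<close>.\<close>

lemma kaplansky_truncation:
  assumes h: "h\<^sup>\<star> = h"
  obtains b where "norm b \<le> 2" "\<And>x. norm (\<pi> b x) \<le> 2 * norm (\<pi> h x)"
    "\<And>y. norm (\<pi> b y - y) \<le> 2 * norm (\<pi> h y - y)"
proof -
  obtain r where r: "r * (h + \<i> *\<^sub>C 1) = 1" "(h + \<i> *\<^sub>C 1) * r = 1" "norm r \<le> 1"
    by (rule resolvent_exists[OF h])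
  have s: "r\<^sup>\<star> * (h + (- \<i>) *\<^sub>C 1) = 1" "(h + (- \<i>) *\<^sub>C 1) * r\<^sup>\<star> = 1"
    using arg_cong[OF r(2), of star] arg_cong[OF r(1), of star]
    by (simp_all add: star_mult star_add star_scaleC h)
  have rp: "norm (\<pi> r x) \<le> norm x" "\<pi> r (\<pi> h x) = x - \<i> *\<^sub>C \<pi> r x" for x
    using pi_resolvent[OF h r(1,2)] by auto
  have sp: "norm (\<pi> (r\<^sup>\<star>) x) \<le> norm x" "\<pi> (r\<^sup>\<star>) (\<pi> h x) = x + \<i> *\<^sub>C \<pi> (r\<^sup>\<star>) x" for x
    using pi_resolvent[OF h s] by (auto simp: scaleC_minus_left)
  show ?thesis
  proof (rule that[of "r + r\<^sup>\<star>"])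
    show "norm (r + r\<^sup>\<star>) \<le> 2" using norm_triangle_ineq[of r "r\<^sup>\<star>"] r(3) by (simp add: norm_star)
    fix x
    \<comment> \<open>Both summands on the right contain \<open>\<i> *\<^sub>C x\<close>, and the
      difference cancels it. This makes \<open>\<pi> b x\<close> small where
      \<open>\<pi> h x\<close> is.\<close>
    have "\<pi> (r + r\<^sup>\<star>) x = \<i> *\<^sub>C \<pi> r (\<pi> h x) - \<i> *\<^sub>C \<pi> (r\<^sup>\<star>) (\<pi> h x)"
      by (simp add: rp sp pi_add scaleC_diff_right scaleC_add_right scaleC_scaleC scaleC_minus_left)
    also have "norm \<dots> \<le> norm (\<pi> h x) + norm (\<pi> h x)"
    proof (rule order_trans[OF norm_triangle_ineq4 add_mono])
      show "norm (\<i> *\<^sub>C \<pi> r (\<pi> h x)) \<le> norm (\<pi> h x)"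
        "norm (\<i> *\<^sub>C \<pi> (r\<^sup>\<star>) (\<pi> h x)) \<le> norm (\<pi> h x)"
        unfolding norm_scaleC using rp(1)[of "\<pi> h x"] sp(1)[of "\<pi> h x"] by simp_all
    qed
    finally show "norm (\<pi> (r + r\<^sup>\<star>) x) \<le> 2 * norm (\<pi> h x)" by simp
    let ?d = "\<pi> h x - x"
    have 1: "\<pi> r ?d = x - (1 + \<i>) *\<^sub>C \<pi> r x"
      by (simp add: cblinfun_diff_right rp scaleC_add_left)
    have 2: "\<pi> (r\<^sup>\<star>) ?d = x - (1 - \<i>) *\<^sub>C \<pi> (r\<^sup>\<star>) x"
      by (simp add: cblinfun_diff_right sp scaleC_diff_left)
    have i: "inverse (1 + \<i>) = (1 - \<i>) / 2" "inverse (1 - \<i>) = (1 + \<i>) / 2"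
      by (simp_all add: complex_eq_iff)
    \<comment> \<open>The coefficients are chosen to leave \<open>\<pi> r x\<close> and its
      counterpart with factor one; they add up to \<open>1\<close> in front of
      \<open>x\<close>.\<close>
    have "x - \<pi> (r + r\<^sup>\<star>) x = inverse (1 + \<i>) *\<^sub>C \<pi> r ?d + inverse (1 - \<i>) *\<^sub>C \<pi> (r\<^sup>\<star>) ?d"
    proof -
      have "1 + \<i> \<noteq> 0" "1 - \<i> \<noteq> 0" by (simp_all add: complex_eq_iff)
      then have "inverse (1 + \<i>) *\<^sub>C \<pi> r ?d + inverse (1 - \<i>) *\<^sub>C \<pi> (r\<^sup>\<star>) ?d
          = (inverse (1 + \<i>) + inverse (1 - \<i>)) *\<^sub>C x - (\<pi> r x + \<pi> (r\<^sup>\<star>) x)"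
        unfolding 1 2 scaleC_diff_right scaleC_scaleC by (simp add: scaleC_add_left)
      moreover have "inverse (1 + \<i>) + inverse (1 - \<i>) = 1" unfolding i by (simp add: field_simps)
      ultimately show ?thesis by (simp add: pi_add)
    qed
    also have "norm \<dots> \<le> norm ?d + norm ?d"
    proof (rule order_trans[OF norm_triangle_ineq add_mono])
      have le: "cmod (inverse (1 + \<i>)) \<le> 1" "cmod (inverse (1 - \<i>)) \<le> 1"
        unfolding i by (simp_all add: cmod_def power2_eq_square real_le_lsqrt)
      show "norm (inverse (1 + \<i>) *\<^sub>C \<pi> r ?d) \<le> norm ?d"
        unfolding norm_scaleC using mult_mono[OF le(1) rp(1)] by simp
      show "norm (inverse (1 - \<i>) *\<^sub>C \<pi> (r\<^sup>\<star>) ?d) \<le> norm ?d"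
        unfolding norm_scaleC using mult_mono[OF le(2) sp(1)] by simp
    qed
    finally show "norm (\<pi> (r + r\<^sup>\<star>) x - x) \<le> 2 * norm ?d" by (simp add: norm_minus_commute)
  qed
qed

end

section \<open>Weak* limits in the bidual\<close>

text \<open>A Banach-Alaoglu argument: the evaluations at \<open>b n\<close> lie in a product of
  discs, compact by Tychonoff. A cluster point need not be a sequential limit, but where the values
  already converge it must agree with their limit.\<close>

lemma bidual_cluster_point:
  fixes b :: "nat \<Rightarrow> 'a::unital_cstar_algebra"
  assumes b: "\<And>n. norm (b n) \<le> K"
  obtains F :: "'a cbidual" where "\<And>\<phi> c. (\<lambda>n. cblinfun_apply \<phi> (b n)) \<longlonglongrightarrow> c \<Longrightarrow> F \<phi> = c"
    "\<And>\<phi>. cmod (F \<phi>) \<le> K * norm \<phi>"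
proof -
  have K: "0 \<le> K" using b[of 0] norm_ge_zero order_trans by blast
  define X where "X = (\<Pi>\<^sub>E \<phi>\<in>UNIV. cball (0::complex) (K * norm (\<phi> :: 'a cdual)))"
  have "compactin (product_topology (\<lambda>_. euclidean) UNIV) X"
    unfolding X_def by (subst compactin_PiE) simp
  then have X: "compact X" by (simp add: euclidean_product_topology)
  define e where "e n = (\<lambda>\<phi> :: 'a cdual. cblinfun_apply \<phi> (b n))" for n
  have e: "e n \<in> X" for n
    unfolding X_def e_def
    using order_trans[OF norm_cblinfun_apply_le mult_right_mono[OF b norm_ge_zero]] by auto
  define G0 where "G0 = filtermap e sequentially"
  have "G0 \<noteq> bot" by (simp add: G0_def filtermap_bot_iff)
  moreover have "eventually (\<lambda>x. x \<in> X) G0" by (simp add: G0_def eventually_filtermap e)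
  ultimately obtain f where f: "f \<in> X" "inf (nhds f) G0 \<noteq> bot"
    using X[unfolded compact_filter] by blast
  \<comment> \<open>A filter refining the sequence and converging to \<open>f\<close>: identities
    valid for every \<open>e n\<close> pass to \<open>f\<close> along it.\<close>
  define G where "G = inf (nhds f) G0"
  have G: "G \<noteq> bot" "G \<le> nhds f" "G \<le> G0" using f(2) by (auto simp: G_def)
  have ev: "((\<lambda>g. g \<phi>) \<longlongrightarrow> f \<phi>) G" for \<phi>
  proof -
    have "((\<lambda>g. g \<phi>) \<longlongrightarrow> f \<phi>) (nhds f)"
    proof (rule topological_tendstoI)
      fix S assume S: "open S" "f \<phi> \<in> S"
      have "open ((\<lambda>g. g \<phi>) -` S)"
        by (rule open_vimage[OF S(1) continuous_on_product_coordinates])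
      then show "eventually (\<lambda>g. g \<phi> \<in> S) (nhds f)"
        unfolding eventually_nhds using S(2) by (intro exI[of _ "(\<lambda>g. g \<phi>) -` S"]) auto
    qed
    then show ?thesis using G(2) by (rule tendsto_mono[rotated])
  qed
  have eventG: "eventually P G" if "\<And>n. P (e n)" for P
    using G(3) by (rule filter_leD) (simp add: G0_def eventually_filtermap that)
  have add: "f (\<phi> + \<psi>) = f \<phi> + f \<psi>" for \<phi> \<psi>
  proof (rule tendsto_unique[OF G(1) ev])
    show "((\<lambda>g. g (\<phi> + \<psi>)) \<longlongrightarrow> f \<phi> + f \<psi>) G"
      by (rule Lim_transform_eventually[OF tendsto_add[OF ev ev]], rule eventG) (simp add: e_def)
  qed
  have sc: "f (c *\<^sub>C \<phi>) = c *\<^sub>C f \<phi>" for c \<phi>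
  proof (rule tendsto_unique[OF G(1) ev])
    show "((\<lambda>g. g (c *\<^sub>C \<phi>)) \<longlongrightarrow> c *\<^sub>C f \<phi>) G"
      by (rule Lim_transform_eventually[OF tendsto_scaleC[OF tendsto_const ev]], rule eventG)
        (simp add: e_def)
  qed
  have bd: "norm (f \<phi>) \<le> K * norm \<phi>" for \<phi> using f(1) by (auto simp: X_def)
  obtain F :: "'a cbidual" where F: "\<And>\<phi>. F \<phi> = f \<phi>"
    using Cblinfun_exists[of f K, OF add sc bd] by blast
  show ?thesis
  proof (rule that)
    show "cmod (F \<phi>) \<le> K * norm \<phi>" for \<phi> using bd by (simp add: F)
    fix \<phi> :: "'a cdual" and c assume "(\<lambda>n. cblinfun_apply \<phi> (b n)) \<longlonglongrightarrow> c"
    then have "((\<lambda>g. g \<phi>) \<longlongrightarrow> c) G0" by (simp add: G0_def filterlim_filtermap e_def)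
    then have "((\<lambda>g. g \<phi>) \<longlongrightarrow> c) G" using G(3) by (rule tendsto_mono[rotated])
    then show "F \<phi> = c" unfolding F by (rule tendsto_unique[OF G(1) ev])
  qed
qed

lemma dual_act_dual_act: "dual_act (dual_act \<phi> a) b = dual_act \<phi> (a * b)"
  by (rule cblinfun_eqI) (simp add: dual_act_apply mult.assoc)

lemma dual_act_bidual_act: "dual_act (bidual_act H \<phi>) a = bidual_act H (dual_act \<phi> a)"
  by (rule cblinfun_eqI) (simp add: dual_act_apply bidual_act_apply dual_act_dual_act)

lemma bidual_act_arens: "bidual_act (G \<box> H) \<phi> = bidual_act G (bidual_act H \<phi>)"
  by (rule cblinfun_eqI) (simp add: bidual_act_apply arens_apply dual_act_bidual_act)

lemma arens_assoc: "(F \<box> G) \<box> H = F \<box> (G \<box> H)"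
  by (rule cblinfun_eqI) (simp add: arens_apply bidual_act_arens)

lemma canonical_embedding_exists:
  obtains C :: "'a::unital_cstar_algebra cbidual" where "\<And>\<phi>. C \<phi> = cblinfun_apply \<phi> c"
proof -
  have "\<exists>C :: 'a cbidual. \<forall>\<phi>. C \<phi> = cblinfun_apply \<phi> c"
    by (rule Cblinfun_exists[where K = "norm c"]) (simp_all add: norm_cblinfun_apply_le)
  then show ?thesis using that by blast
qed

section \<open>A central support makes the cyclic vector separating\<close>

context cyclic_representation
begin

lemma vector_functional_exists:
  "\<exists>\<phi> :: 'a cdual. (\<forall>a. cblinfun_apply \<phi> a = cinner (\<pi> a x) y) \<and> norm \<phi> \<le> norm x * norm y"
proof -
  have le: "cmod (cinner (\<pi> a x) y) \<le> norm x * norm y * norm a" for a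
    using order_trans[OF cinner_norm_le mult_right_mono[OF pi_contractive norm_ge_zero]]
    by (simp add: ac_simps)
  have "\<exists>\<phi> :: 'a cdual. \<forall>a. cblinfun_apply \<phi> a = cinner (\<pi> a x) y"
    by (rule Cblinfun_exists[OF _ _ le])
      (simp_all add: pi_add pi_scaleC cinner_add_left cinner_scaleC_left scaleC_complex_def)
  then obtain \<phi> :: "'a cdual" where \<phi>: "\<And>a. \<phi> a = cinner (\<pi> a x) y" by blast
  have "norm \<phi> \<le> norm x * norm y"
    by (rule norm_cblinfun_le) (use le in \<open>simp_all add: \<phi> mult.commute\<close>)
  then show ?thesis using \<phi> by blast
qed

text \<open>The values determine the functional, so \<open>SOME\<close> involves no real choice. It
  is linear in \<open>x\<close> and antilinear in \<open>y\<close>.\<close>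

definition vector_functional :: "'h \<Rightarrow> 'h \<Rightarrow> 'a cdual" where
  "vector_functional x y = (SOME \<phi>. (\<forall>a. cblinfun_apply \<phi> a = cinner (\<pi> a x) y) \<and> norm \<phi> \<le> norm x * norm y)"

lemma vector_functional_apply: "vector_functional x y a = cinner (\<pi> a x) y"
  and norm_vector_functional: "norm (vector_functional x y) \<le> norm x * norm y"
  unfolding vector_functional_def using someI_ex[OF vector_functional_exists[of x y]] by blast+

lemma vector_functional_linear:
  "vector_functional (x + x') y = vector_functional x y + vector_functional x' y"
  "vector_functional x (y + y') = vector_functional x y + vector_functional x y'"
  "vector_functional (c *\<^sub>C x) y = c *\<^sub>C vector_functional x y"
  "vector_functional x (c *\<^sub>C y) = cnj c *\<^sub>C vector_functional x y"
  by (rule cblinfun_eqI; simp add: vector_functional_apply cblinfun_add_right cinner_add_left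
      cinner_add_right cblinfun_scaleC_right cinner_scaleC_left cinner_scaleC_right scaleC_complex_def)+

text \<open>If \<open>\<omega>\<close> vanishes on \<open>F\<^sup>* F\<close>, then so it does on \<open>(Fc)\<^sup>* Fc\<close> for \<open>c\<close> in the algebra, because the
  support is central; the latter value is \<open>\<parallel>F \<pi>(c)\<Omega>\<parallel>\<^sup>2\<close>.\<close>

lemma central_support_annihilates:
  assumes p: "support_projection \<omega> p" "p \<in> bidual_centre" and F: "bidual_act F \<omega> = 0"
  shows "F (vector_functional x y) = 0"
proof -
  have Fz: "F (vector_functional x y) = 0" if x: "x \<in> range (\<lambda>c. \<pi> c \<Omega>)" for x y
  proof -
    obtain c where c: "x = \<pi> c \<Omega>" using x by blast
    obtain C :: "'a cbidual" where C: "\<And>\<phi>. C \<phi> = cblinfun_apply \<phi> c"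
      by (rule canonical_embedding_exists) blast
    have ker: "(bidual_star F \<box> F) \<omega> = 0 \<longleftrightarrow> F \<box> p = 0" for F
      using p(1) by (simp add: support_projection_def)
    have central: "p \<box> G = G \<box> p" for G using p(2) by (simp add: bidual_centre_def)
    have "(bidual_star F \<box> F) \<omega> = 0" by (simp add: arens_apply F)
    then have Fp: "F \<box> p = 0" by (simp add: ker)
    have "(F \<box> C) \<box> p = (F \<box> p) \<box> C" by (simp only: arens_assoc central)
    also have "\<dots> = 0" unfolding Fp by (rule cblinfun_eqI) (simp add: arens_apply)
    finally have zero: "(bidual_star (F \<box> C) \<box> (F \<box> C)) \<omega> = 0" by (simp add: ker)
    have act: "bidual_act C \<psi> a = \<psi> (a * c)" for \<psi> :: "'a cdual" and a
      by (simp add: bidual_act_apply C dual_act_apply)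
    \<comment> \<open>The vector \<open>z\<close> plays the role of \<open>F\<close> applied to
      \<open>x\<close>; the conjugate is there because \<open>y\<close> enters antilinearly.\<close>
    have "\<exists>z. \<forall>y. cnj (F (vector_functional x y)) = cinner y z"
    proof (rule riesz_representation)
      fix y
      have "cmod (F (vector_functional x y)) \<le> norm F * norm (vector_functional x y)"
        by (rule cblinfun_apply_le)
      also have "\<dots> \<le> norm F * (norm x * norm y)"
        by (intro mult_left_mono norm_vector_functional) simp
      finally show "cmod (cnj (F (vector_functional x y))) \<le> (norm F * norm x) * norm y"
        by (simp add: mult.assoc)
    qed (simp_all add: vector_functional_linear cblinfun_add_right cblinfun_scaleC_right scaleC_complex_def)
    then obtain z where z': "\<And>y. cnj (F (vector_functional x y)) = cinner y z" by blast
    have z: "F (vector_functional x y) = cinner z y" for y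
      by (metis z' cinner_commute complex_cnj_cnj)
    have FC: "bidual_act (F \<box> C) \<omega> a = cinner z (\<pi> (a\<^sup>\<star>) \<Omega>)" for a
    proof -
      have "bidual_act C (dual_act \<omega> a) = vector_functional x (\<pi> (a\<^sup>\<star>) \<Omega>)"
        by (rule cblinfun_eqI)
          (simp add: act dual_act_apply vector_functional_apply omega_eq pi_mult c pi_adj_right star_star)
      then show ?thesis by (simp add: bidual_act_apply arens_apply z)
    qed
    have "dual_star (bidual_act (F \<box> C) \<omega>) = vector_functional \<Omega> z"
      by (rule cblinfun_eqI)
        (simp add: dual_star_apply FC star_star vector_functional_apply cinner_commute[of "\<pi> _ \<Omega>" z])
    moreover have "bidual_act C (vector_functional \<Omega> z) = vector_functional x z"
      by (rule cblinfun_eqI) (simp add: act vector_functional_apply pi_mult c)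
    ultimately have "(bidual_star (F \<box> C) \<box> (F \<box> C)) \<omega> = cnj (cinner z z)"
      by (simp add: arens_apply[of "bidual_star _"] bidual_star_apply) (simp add: arens_apply z)
    then have "z = 0" using zero by simp
    then show ?thesis by (simp add: z)
  qed
  have "\<exists>T :: 'h \<Rightarrow>\<^sub>C\<^sub>L complex. \<forall>x. T x = F (vector_functional x y)"
  proof (rule Cblinfun_exists)
    fix x
    have "cmod (F (vector_functional x y)) \<le> norm F * norm (vector_functional x y)"
      by (rule cblinfun_apply_le)
    also have "\<dots> \<le> norm F * (norm x * norm y)"
      by (intro mult_left_mono norm_vector_functional) simp
    finally show "cmod (F (vector_functional x y)) \<le> (norm F * norm y) * norm x"
      by (simp add: ac_simps)
  qed (simp_all add: vector_functional_linear cblinfun_add_right cblinfun_scaleC_right)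
  then obtain T :: "'h \<Rightarrow>\<^sub>C\<^sub>L complex" where T: "\<And>x. T x = F (vector_functional x y)" by blast
  have "T = 0" by (rule cblinfun_eqI_dense[OF cyclic]) (simp add: T Fz)
  then show ?thesis using T[of x] by simp
qed

text \<open>If \<open>Q\<close> projects onto the closure of \<open>M'\<Omega>\<close>, then
  \<open>1 - Q\<close> lies in the bicommutant, kills \<Omega> and fixes \<open>y\<close>.
  Self-adjoint approximants have no norm bound; truncation supplies the bound \<open>2\<close>
  needed for a cluster point \<open>F\<close>, whose value at the functional of \<open>y\<close> is
  at once \<open>0\<close> and the squared norm of \<open>y\<close>.\<close>

theorem central_support_imp_separating:
  assumes p: "support_projection \<omega> p" "p \<in> bidual_centre"
  shows "closure ((\<lambda>B. cblinfun_apply B \<Omega>) ` commutant (range \<pi>)) = UNIV"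
proof (rule orthogonal_imp_dense[OF csubspace_commutant_orbit])
  let ?E = "(\<lambda>B. cblinfun_apply B \<Omega>) ` commutant (range \<pi>)"
  fix y assume y: "\<And>e. e \<in> ?E \<Longrightarrow> cinner y e = 0"
  have cE: "csubspace (closure ?E)" by (intro csubspace_closure csubspace_commutant_orbit)
  obtain Q :: "'h \<Rightarrow>\<^sub>C\<^sub>L 'h" where Q: "\<And>x. Q x \<in> closure ?E" "\<And>x e. e \<in> closure ?E \<Longrightarrow> cinner (x - Q x) e = 0"
    "\<And>x p. p \<in> closure ?E \<Longrightarrow> (\<And>e. e \<in> closure ?E \<Longrightarrow> cinner (x - p) e = 0) \<Longrightarrow> Q x = p"
    using orthogonal_projection[OF cE closed_closure] by metis
  have inv: "X e \<in> closure ?E" if X: "X \<in> commutant (range \<pi>)" and e: "e \<in> closure ?E" for X e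
  proof -
    obtain f where f: "\<And>n. f n \<in> ?E" "f \<longlonglongrightarrow> e" using e by (auto simp: closure_sequential)
    have "X (f n) \<in> ?E" for n
    proof -
      obtain B where B: "B \<in> commutant (range \<pi>)" "f n = B \<Omega>" using f(1)[of n] by blast
      show ?thesis by (rule rev_image_eqI[OF commutant_compose[OF X B(1)]]) (simp add: B)
    qed
    then show ?thesis unfolding closure_sequential
      by (intro exI[of _ "\<lambda>n. X (f n)"]) (auto intro!: tendsto_intros f)
  qed
  have QM: "Q \<in> commutant (commutant (range \<pi>))"
    by (rule projection_in_commutant[OF cE commutant_pi_cadjoint inv Q])
  have "\<Omega> \<in> ?E" by (rule rev_image_eqI[of cblinfun_id]) auto
  from subsetD[OF closure_subset this] have Q\<Omega>: "Q \<Omega> = \<Omega>" by (rule Q(3)) simp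
  have "closure ?E \<subseteq> {e. cinner y e = 0}"
    by (rule closure_minimal) (use y in \<open>auto intro!: closed_Collect_eq continuous_intros\<close>)
  then have Qy: "Q y = 0" using csubspaceD(1)[OF cE] by (intro Q(3)) auto
  have Qself: "cinner (Q x) z = cinner x (Q z)" for x z
  proof -
    have "cinner (Q x) z = cinner (Q x) (Q z)"
      using Q(2)[OF Q(1)[of x], of z] by (subst (asm) cinner_sym_0) (simp add: cinner_diff_right)
    also have "\<dots> = cinner x (Q z)" using Q(2)[OF Q(1)[of z], of x] by (simp add: cinner_diff_left)
    finally show ?thesis .
  qed
  define T where "T = cblinfun_id - Q"
  have T: "T \<in> commutant (commutant (range \<pi>))" unfolding T_def by (intro commutant_diff QM) simp
  have "T\<^sup>\<dagger> = T" by (rule cadjoint_eqI) (simp add: T_def cinner_diff_left cinner_diff_right Qself)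
  from selfadjoint_approximation[OF T this, of \<Omega> y]
  have "(0, y) \<in> closure {(\<pi> h \<Omega>, \<pi> h y) | h. h\<^sup>\<star> = h}" by (simp add: T_def Q\<Omega> Qy)
  then obtain g where g: "\<And>n. g n \<in> {(\<pi> h \<Omega>, \<pi> h y) | h. h\<^sup>\<star> = h}" "g \<longlonglongrightarrow> (0, y)"
    by (auto simp: closure_sequential)
  then have "\<forall>n. \<exists>h. h\<^sup>\<star> = h \<and> g n = (\<pi> h \<Omega>, \<pi> h y)" by auto
  then obtain h where h: "\<And>n. (h n)\<^sup>\<star> = h n" "\<And>n. g n = (\<pi> (h n) \<Omega>, \<pi> (h n) y)" by metis
  have h\<Omega>: "(\<lambda>n. \<pi> (h n) \<Omega>) \<longlonglongrightarrow> 0" and hy: "(\<lambda>n. \<pi> (h n) y) \<longlonglongrightarrow> y"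
    using tendsto_fst[OF g(2)] tendsto_snd[OF g(2)] by (simp_all add: h(2))
  have "\<exists>b. norm b \<le> 2 \<and> norm (\<pi> b \<Omega>) \<le> 2 * norm (\<pi> (h n) \<Omega>) \<and>
      norm (\<pi> b y - y) \<le> 2 * norm (\<pi> (h n) y - y)" for n
    by (rule kaplansky_truncation[OF h(1)[of n]]) blast
  then obtain b where b: "\<And>n. norm (b n) \<le> 2" "\<And>n. norm (\<pi> (b n) \<Omega>) \<le> 2 * norm (\<pi> (h n) \<Omega>)"
    "\<And>n. norm (\<pi> (b n) y - y) \<le> 2 * norm (\<pi> (h n) y - y)" by metis
  have b\<Omega>: "(\<lambda>n. \<pi> (b n) \<Omega>) \<longlonglongrightarrow> 0"
    by (rule Lim_null_comparison[OF always_eventually[OF allI[OF b(2)]]])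
      (use tendsto_mult_left[OF tendsto_norm[OF h\<Omega>], of 2] in simp)
  have by': "(\<lambda>n. \<pi> (b n) y) \<longlonglongrightarrow> y"
    by (rule LIM_zero_cancel, rule Lim_null_comparison[OF always_eventually[OF allI[OF b(3)]]])
      (use tendsto_mult_left[OF tendsto_norm[OF LIM_zero[OF hy]], of 2] in simp)
  obtain F :: "'a cbidual" where F: "\<And>\<phi> c. (\<lambda>n. cblinfun_apply \<phi> (b n)) \<longlonglongrightarrow> c \<Longrightarrow> F \<phi> = c"
    using bidual_cluster_point[of b 2] b(1) by metis
  have "bidual_act F \<omega> = 0"
  proof (rule cblinfun_eqI)
    fix a
    have "(\<lambda>n. cinner (\<pi> a (\<pi> (b n) \<Omega>)) \<Omega>) \<longlonglongrightarrow> cinner (\<pi> a 0) \<Omega>"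
      by (intro tendsto_intros b\<Omega>)
    then have "(\<lambda>n. dual_act \<omega> a (b n)) \<longlonglongrightarrow> 0"
      by (simp add: dual_act_apply omega_eq pi_mult)
    then show "bidual_act F \<omega> a = cblinfun_apply 0 a" by (simp add: bidual_act_apply F)
  qed
  then have "F (vector_functional y y) = 0" by (rule central_support_annihilates[OF p])
  moreover have "(\<lambda>n. vector_functional y y (b n)) \<longlonglongrightarrow> cinner y y"
    unfolding vector_functional_apply by (intro tendsto_intros by')
  ultimately show "y = 0" using F[of "vector_functional y y" "cinner y y"] by simp
qed

end

section \<open>Extension from dense subspaces\<close>

lemma dense_convergence:
  fixes f :: "nat \<Rightarrow> 'a::real_normed_vector \<Rightarrow> 'b::real_normed_vector"
  assumes f: "\<And>N x y. norm (f N x - f N y) \<le> K * norm (x - y)"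
    and g: "\<And>x y. norm (g x - g y) \<le> K * norm (x - y)"
    and D: "closure D = UNIV" "\<And>x. x \<in> D \<Longrightarrow> (\<lambda>N. f N x) \<longlonglongrightarrow> g x"
  shows "(\<lambda>N. f N x) \<longlonglongrightarrow> g x"
proof (rule LIMSEQ_I)
  fix r :: real assume r: "0 < r"
  \<comment> \<open>Positive for every real \<open>K\<close>, so \<delta> is defined and positive
    without a sign condition on the Lipschitz constant.\<close>
  define k where "k = \<bar>K\<bar> + 1"
  have k: "0 < k" "\<bar>K\<bar> \<le> k" by (simp_all add: k_def add_nonneg_pos)
  define \<delta> where "\<delta> = r / (4 * k)"
  have \<delta>: "0 < \<delta>" using r k by (simp add: \<delta>_def)
  have "\<bar>K\<bar> * \<delta> \<le> k * \<delta>" using \<delta> k by (intro mult_right_mono) auto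
  also have "\<dots> = r / 4" using k by (simp add: \<delta>_def)
  finally have K\<delta>: "\<bar>K\<bar> * \<delta> \<le> r / 4" .
  have "x \<in> closure D" using D(1) by simp
  then obtain y where y: "y \<in> D" "dist y x < \<delta>" using \<delta> by (meson closure_approachable)
  have le: "K * norm (x - y) \<le> r / 4"
  proof -
    have "K * norm (x - y) \<le> \<bar>K\<bar> * norm (x - y)" by (simp add: mult_right_mono)
    also have "\<dots> \<le> \<bar>K\<bar> * \<delta>"
      using y(2) by (intro mult_left_mono) (auto simp: dist_norm norm_minus_commute)
    finally show ?thesis using K\<delta> by linarith
  qed
  obtain N0 where N0: "\<And>N. N \<ge> N0 \<Longrightarrow> norm (f N y - g y) < r / 4"
    using LIMSEQ_D[OF D(2)[OF y(1)], of "r / 4"] r by auto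
  have "norm (f N x - g x) < r" if "N \<ge> N0" for N
  proof -
    have "f N x - g x = (f N x - f N y) + (f N y - g y) + (g y - g x)" by simp
    then have "norm (f N x - g x) \<le> norm (f N x - f N y) + norm (f N y - g y) + norm (g y - g x)"
      by (metis norm_triangle_ineq norm_triangle_mono order_refl)
    then show ?thesis
      using f[of N x y] N0[OF that] g[of y x] le r by (simp add: norm_minus_commute)
  qed
  then show "\<exists>no. \<forall>n\<ge>no. norm (f n x - g x) < r" by blast
qed

text \<open>The map is given on indices because different indices may give the same vector
  \<open>g i\<close>; the isometry condition makes it well defined. In the application the indices
  are operators \<open>B\<close>, with \<open>g B = B \<Omega>\<close> and
  \<open>h B = B x\<close>.\<close>

lemma isometry_extension:
  fixes g :: "'i \<Rightarrow> 'a::complex_normed_vector" and h :: "'i \<Rightarrow> 'b::{complex_normed_vector, banach}"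
  assumes dense: "closure (g ` S) = UNIV"
    and iso: "\<And>i j. i \<in> S \<Longrightarrow> j \<in> S \<Longrightarrow> norm (h i - h j) = norm (g i - g j)"
      "\<And>i. i \<in> S \<Longrightarrow> norm (h i) = norm (g i)"
    and add: "\<And>i j. i \<in> S \<Longrightarrow> j \<in> S \<Longrightarrow> \<exists>k\<in>S. g k = g i + g j \<and> h k = h i + h j"
    and sc: "\<And>i c. i \<in> S \<Longrightarrow> \<exists>k\<in>S. g k = c *\<^sub>C g i \<and> h k = c *\<^sub>C h i"
  obtains V :: "'a \<Rightarrow>\<^sub>C\<^sub>L 'b" where "\<And>i. i \<in> S \<Longrightarrow> V (g i) = h i" "\<And>x. norm (V x) = norm x"
proof -
  have "\<exists>s. (\<forall>n. s n \<in> S) \<and> (\<lambda>n. g (s n)) \<longlonglongrightarrow> x" for x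
  proof -
    have "x \<in> closure (g ` S)" using dense by simp
    then obtain f where f: "\<And>n. f n \<in> g ` S" "f \<longlonglongrightarrow> x" by (auto simp: closure_sequential)
    then have "\<forall>n. \<exists>i\<in>S. f n = g i" by blast
    then obtain s where s: "\<And>n. s n \<in> S" "\<And>n. f n = g (s n)" by metis
    have "f = (\<lambda>n. g (s n))" by (rule ext) (rule s(2))
    then show ?thesis using f(2) s(1) by blast
  qed
  then obtain s where s: "\<And>x n. s x n \<in> S" "\<And>x. (\<lambda>n. g (s x n)) \<longlonglongrightarrow> x" by metis
  have "convergent (\<lambda>n. h (s x n))" for x
  proof -
    have "Cauchy (\<lambda>n. g (s x n))" using s(2) LIMSEQ_imp_Cauchy by blast
    then have "Cauchy (\<lambda>n. h (s x n))" by (simp add: Cauchy_def dist_norm iso(1) s(1))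
    then show ?thesis by (rule Cauchy_convergent)
  qed
  then obtain v where v: "\<And>x. (\<lambda>n. h (s x n)) \<longlonglongrightarrow> v x" unfolding convergent_def by metis
  have key: "(\<lambda>n. h (t n)) \<longlonglongrightarrow> v x" if t: "\<And>n. t n \<in> S" "(\<lambda>n. g (t n)) \<longlonglongrightarrow> x" for t x
  proof -
    have "(\<lambda>n. g (t n) - g (s x n)) \<longlonglongrightarrow> x - x" by (intro tendsto_intros t s)
    then have "(\<lambda>n. norm (h (t n) - h (s x n))) \<longlonglongrightarrow> 0"
      by (simp add: iso(1) t(1) s(1) tendsto_norm_zero)
    then have "(\<lambda>n. h (t n) - h (s x n)) \<longlonglongrightarrow> 0" by (rule tendsto_norm_zero_cancel)
    from tendsto_add[OF this v[of x]] show ?thesis by simp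
  qed
  have nv: "norm (v x) = norm x" for x
    using LIMSEQ_unique[OF tendsto_norm[OF v] tendsto_norm[OF s(2), unfolded iso(2)[OF s(1), symmetric]]] .
  have "v (x + y) = v x + v y" for x y
  proof -
    have "\<forall>n. \<exists>k\<in>S. g k = g (s x n) + g (s y n) \<and> h k = h (s x n) + h (s y n)"
      using add s(1) by blast
    then obtain t where t: "\<And>n. t n \<in> S" "\<And>n. g (t n) = g (s x n) + g (s y n)"
      "\<And>n. h (t n) = h (s x n) + h (s y n)" by metis
    have "(\<lambda>n. h (t n)) \<longlonglongrightarrow> v (x + y)" by (rule key[OF t(1)]) (simp only: t(2), intro tendsto_intros s)
    moreover have "(\<lambda>n. h (t n)) \<longlonglongrightarrow> v x + v y" unfolding t(3) by (intro tendsto_intros v)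
    ultimately show ?thesis by (rule LIMSEQ_unique)
  qed
  moreover have "v (c *\<^sub>C x) = c *\<^sub>C v x" for c x
  proof -
    have "\<forall>n. \<exists>k\<in>S. g k = c *\<^sub>C g (s x n) \<and> h k = c *\<^sub>C h (s x n)" using sc s(1) by blast
    then obtain t where t: "\<And>n. t n \<in> S" "\<And>n. g (t n) = c *\<^sub>C g (s x n)"
      "\<And>n. h (t n) = c *\<^sub>C h (s x n)" by metis
    have "(\<lambda>n. h (t n)) \<longlonglongrightarrow> v (c *\<^sub>C x)" by (rule key[OF t(1)]) (simp only: t(2), intro tendsto_intros s)
    moreover have "(\<lambda>n. h (t n)) \<longlonglongrightarrow> c *\<^sub>C v x" unfolding t(3) by (intro tendsto_intros v)
    ultimately show ?thesis by (rule LIMSEQ_unique)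
  qed
  moreover have "norm (v x) \<le> 1 * norm x" for x using nv by simp
  ultimately have "\<exists>V :: 'a \<Rightarrow>\<^sub>C\<^sub>L 'b. \<forall>x. V x = v x" by (rule Cblinfun_exists)
  then obtain V :: "'a \<Rightarrow>\<^sub>C\<^sub>L 'b" where V: "\<And>x. V x = v x" by blast
  show ?thesis
  proof (rule that)
    show "norm (V x) = norm x" for x by (simp add: V nv)
    show "V (g i) = h i" if "i \<in> S" for i
      unfolding V by (rule LIMSEQ_unique[OF key[of "\<lambda>_. i"]]) (use that in simp_all)
  qed
qed

lemma isometry_cinner:
  fixes V :: "'h::complex_hilbert \<Rightarrow>\<^sub>C\<^sub>L 'h"
  assumes V: "\<And>x. norm (V x) = norm x"
  shows "cinner (V x) (V y) = cinner x y"
proof -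
  have re: "Re (cinner (V x) (V y)) = Re (cinner x y)" for x y
    using norm_add_sq[of "V x" "V y"] norm_add_sq[of x y] V[of "x + y"]
    by (simp add: cblinfun_add_right V)
  have "Re (cinner (V x) (V (\<i> *\<^sub>C y))) = Re (cinner x (\<i> *\<^sub>C y))" by (rule re)
  then have "Im (cinner (V x) (V y)) = Im (cinner x y)"
    by (simp add: cblinfun_scaleC_right cinner_scaleC_right)
  then show ?thesis using re by (simp add: complex_eq_iff)
qed

lemma isometry_cadjoint_cancel:
  fixes V :: "'h::complex_hilbert \<Rightarrow>\<^sub>C\<^sub>L 'h"
  assumes "\<And>x. norm (V x) = norm x"
  shows "(V\<^sup>\<dagger>) (V x) = x"
  by (rule cinner_eqI_right) (simp add: cinner_adj_left[symmetric] isometry_cinner[OF assms])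

lemma cadjoint_add: "(S + T)\<^sup>\<dagger> = S\<^sup>\<dagger> + T\<^sup>\<dagger>"
  by (rule cadjoint_eqI) (simp add: cinner_add_left cinner_add_right cinner_adj_left)

lemma cadjoint_scaleC: "(c *\<^sub>C T)\<^sup>\<dagger> = cnj c *\<^sub>C T\<^sup>\<dagger>"
  by (rule cadjoint_eqI) (simp add: cinner_scaleC_left cinner_scaleC_right cinner_adj_left)

lemma cadjoint_diff: "(S - T)\<^sup>\<dagger> = S\<^sup>\<dagger> - T\<^sup>\<dagger>"
  by (rule cadjoint_eqI) (simp add: cinner_diff_left cinner_diff_right cinner_adj_left)

section \<open>Ergodic unitaries acting on an operator algebra\<close>

definition upow_conj :: "'h::complex_hilbert \<Rightarrow>\<^sub>C\<^sub>L 'h \<Rightarrow> int \<Rightarrow> 'h \<Rightarrow>\<^sub>C\<^sub>L 'h \<Rightarrow> 'h \<Rightarrow>\<^sub>C\<^sub>L 'h" where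
  "upow_conj U k T = upow U k o\<^sub>C T o\<^sub>C upow U (- k)"

lemma upow_conj_apply [simp]: "upow_conj U k T x = upow U k (T (upow U (- k) x))"
  by (simp add: upow_conj_def)

lemma upow_conj_commutant:
  assumes U: "unitary U" and S: "\<And>k X. X \<in> S \<Longrightarrow> upow_conj U k X \<in> S" and T: "T \<in> commutant S"
  shows "upow_conj U k T \<in> commutant S"
proof -
  have "(upow U k)\<^sup>\<dagger> o\<^sub>C X o\<^sub>C upow U k = upow_conj U (- k) X" for X
    by (rule cblinfun_eqI) (simp add: upow_cadjoint[OF U])
  then have "upow U k o\<^sub>C T o\<^sub>C (upow U k)\<^sup>\<dagger> \<in> commutant S"
    using S by (intro commutant_conj[OF unitary_upow[OF U] _ T]) simp
  then show ?thesis by (simp add: upow_conj_def upow_cadjoint[OF U])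
qed

text \<open>Formulated for an arbitrary unitary, as it is used both for \<open>U\<close> and for its
  power with exponent \<open>k2 - k1\<close>.\<close>

definition ergodic_vector :: "'h::complex_hilbert \<Rightarrow>\<^sub>C\<^sub>L 'h \<Rightarrow> 'h \<Rightarrow> bool" where
  "ergodic_vector U \<Omega> \<longleftrightarrow> unitary U \<and> U \<Omega> = \<Omega> \<and> norm \<Omega> = 1 \<and> (\<forall>x. U x = x \<longrightarrow> (\<exists>c. x = c *\<^sub>C \<Omega>))"

lemma ergodic_vectorD:
  assumes "ergodic_vector U \<Omega>"
  shows "unitary U" "U \<Omega> = \<Omega>" "norm \<Omega> = 1" "U x = x \<Longrightarrow> \<exists>c. x = c *\<^sub>C \<Omega>" "upow U k \<Omega> = \<Omega>"
proof -
  show U: "unitary U" "U \<Omega> = \<Omega>" "norm \<Omega> = 1" "U x = x \<Longrightarrow> \<exists>c. x = c *\<^sub>C \<Omega>"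
    using assms by (auto simp: ergodic_vector_def)
  show "upow U k \<Omega> = \<Omega>" using upow_eigen[OF U(1), of \<Omega> 1 k] U(2) by simp
qed

text \<open>On vectors \<open>C\<Omega>\<close> with \<open>C\<close> in the commutant this is the mean ergodic theorem.\<close>

lemma strong_operator_ergodic:
  assumes U: "ergodic_vector U \<Omega>" and S: "\<And>k X. X \<in> S \<Longrightarrow> upow_conj U k X \<in> S"
    and dense: "closure ((\<lambda>C. cblinfun_apply C \<Omega>) ` commutant S) = UNIV" and B: "B \<in> S"
  shows "cesaro (\<lambda>n. upow_conj U (int n) B y) \<longlonglongrightarrow> cinner (B \<Omega>) \<Omega> *\<^sub>C y"
proof -
  note U' = ergodic_vectorD[OF U]
  have le: "norm (upow_conj U k B x) \<le> norm B * norm x" for k x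
    using cblinfun_apply_le[of B "upow U (- k) x"] by (simp add: U'(1))
  have "norm (B \<Omega>) \<le> norm B" using cblinfun_apply_le[of B \<Omega>] by (simp add: U'(3))
  then have le': "cmod (cinner (B \<Omega>) \<Omega>) \<le> norm B"
    using cinner_norm_le[of "B \<Omega>" \<Omega>] by (simp add: U'(3))
  show ?thesis
  proof (rule dense_convergence[where f = "\<lambda>N x. cesaro (\<lambda>n. upow_conj U (int n) B x) N"
        and g = "\<lambda>x. cinner (B \<Omega>) \<Omega> *\<^sub>C x", OF _ _ dense])
    show "norm (cesaro (\<lambda>n. upow_conj U (int n) B x) N - cesaro (\<lambda>n. upow_conj U (int n) B y) N)
        \<le> norm B * norm (x - y)" for N x y
      unfolding cesaro_diff[symmetric] cblinfun_diff_right[symmetric]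
      by (rule norm_cesaro_le[OF le]) simp
    show "norm (cinner (B \<Omega>) \<Omega> *\<^sub>C x - cinner (B \<Omega>) \<Omega> *\<^sub>C y) \<le> norm B * norm (x - y)" for x y
      unfolding scaleC_diff_right[symmetric] norm_scaleC by (rule mult_right_mono[OF le']) simp
    fix x assume "x \<in> (\<lambda>C. cblinfun_apply C \<Omega>) ` commutant S"
    then obtain C where C: "C \<in> commutant S" "x = C \<Omega>" by blast
    have "upow_conj U (int n) B x = C (upow U (int n) (B \<Omega>))" for n
    proof -
      have "upow_conj U (int n) B x = C (upow_conj U (int n) B \<Omega>)"
        unfolding C(2) by (rule commutantD[OF C(1) S[OF B], symmetric])
      then show ?thesis by (simp add: U'(5))
    qed
    then have "cesaro (\<lambda>n. upow_conj U (int n) B x) = (\<lambda>N. C (cesaro (\<lambda>n. upow U (int n) (B \<Omega>)) N))"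
      by (simp add: fun_eq_iff cesaro_cblinfun)
    moreover have "(\<lambda>N. C (cesaro (\<lambda>n. upow U (int n) (B \<Omega>)) N)) \<longlonglongrightarrow> C (cinner (B \<Omega>) \<Omega> *\<^sub>C \<Omega>)"
      by (intro tendsto_intros mean_ergodic_one_dimensional U')
    ultimately show "cesaro (\<lambda>n. upow_conj U (int n) B x) \<longlonglongrightarrow> cinner (B \<Omega>) \<Omega> *\<^sub>C x"
      by (simp add: cblinfun_scaleC_right C(2))
  qed
qed

text \<open>The vector state of a unit eigenvector \<open>x\<close> is invariant, hence agrees with that of \<open>\<Omega>\<close> on \<open>S\<close>,
  so \<open>B\<Omega> \<mapsto> Bx\<close> is isometric and extends to an operator commuting with \<open>S\<close>.\<close>

lemma eigen_unitary_exists: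
  assumes U: "ergodic_vector U \<Omega>" and S: "\<And>k X. X \<in> S \<Longrightarrow> upow_conj U k X \<in> S"
    and alg: "operator_algebra S"
    and dense: "closure ((\<lambda>C. cblinfun_apply C \<Omega>) ` commutant S) = UNIV"
      "closure ((\<lambda>B. cblinfun_apply B \<Omega>) ` S) = UNIV"
    and v: "v \<in> point_spectrum U"
  shows "\<exists>V. V \<in> commutant S \<and> unitary V \<and> eigenspace U v = range (\<lambda>c. c *\<^sub>C V \<Omega>) \<and>
    U o\<^sub>C V o\<^sub>C U\<^sup>\<dagger> = v *\<^sub>C V"
proof -
  note U' = ergodic_vectorD[OF U]
  have S': "cblinfun_id \<in> S" "\<And>X Y. X \<in> S \<Longrightarrow> Y \<in> S \<Longrightarrow> X + Y \<in> S" "\<And>c X. X \<in> S \<Longrightarrow> c *\<^sub>C X \<in> S"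
    "\<And>X Y. X \<in> S \<Longrightarrow> Y \<in> S \<Longrightarrow> X o\<^sub>C Y \<in> S" "\<And>X. X \<in> S \<Longrightarrow> X\<^sup>\<dagger> \<in> S"
    using alg by (auto simp: operator_algebra_def)
  obtain x0 where x0: "x0 \<noteq> 0" "U x0 = v *\<^sub>C x0" using v by (auto simp: point_spectrum_def)
  define x where "x = x0 /\<^sub>R norm x0"
  have x: "norm x = 1" "U x = v *\<^sub>C x"
    using x0 by (simp_all add: x_def cblinfun_scaleR_right scaleR_scaleC_commute)
  have "cmod v = 1" using eigenvalue_unimodular[OF U'(1) x0(2,1)] .
  then have vv: "v * cnj v = 1" by (metis complex_norm_square of_real_1 one_power2)
  have pow: "upow U k x = (v powi k) *\<^sub>C x" "cmod (v powi k) = 1" for k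
    using upow_eigen[OF U'(1) x(2) \<open>cmod v = 1\<close>] \<open>cmod v = 1\<close> by (auto simp: norm_power_int)
  have state: "cinner (B x) x = cinner (B \<Omega>) \<Omega>" if B: "B \<in> S" for B
  proof -
    have "cinner (upow_conj U (int n) B x) x = cinner (B x) x" for n
    proof -
      have "cinner (upow_conj U (int n) B x) x
          = cinner (B (upow U (- int n) x)) (upow U (- int n) x)"
        by (simp add: cinner_upow_left[OF U'(1)])
      also have "\<dots> = (v powi (- int n) * cnj (v powi (- int n))) * cinner (B x) x"
        unfolding pow(1) by (simp add: cblinfun_scaleC_right cinner_scaleC_left cinner_scaleC_right)
      also have "v powi (- int n) * cnj (v powi (- int n)) = 1"
        using pow(2)[of "- int n"] by (metis complex_norm_square of_real_1 one_power2)
      finally show ?thesis by simp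
    qed
    then have "cesaro (\<lambda>_. cinner (B x) x) = cesaro (\<lambda>n. cinner (upow_conj U (int n) B x) x)"
      by (simp only:)
    also have "\<dots> = (\<lambda>N. cinner (cesaro (\<lambda>n. upow_conj U (int n) B x) N) x)"
      by (rule ext) (rule cesaro_cinner_left)
    also have "\<dots> \<longlonglongrightarrow> cinner (cinner (B \<Omega>) \<Omega> *\<^sub>C x) x"
      by (intro tendsto_intros strong_operator_ergodic[OF U S dense(1) B])
    finally have "cinner (B x) x = cinner (cinner (B \<Omega>) \<Omega> *\<^sub>C x) x"
      by (rule LIMSEQ_unique[OF cesaro_const_tendsto])
    then show ?thesis using x(1) by (simp add: cinner_scaleC_left cinner_self)
  qed
  have nB: "norm (B x) = norm (B \<Omega>)" if B: "B \<in> S" for B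
  proof -
    have "cinner (B x) (B x) = cinner (B \<Omega>) (B \<Omega>)"
      using state[OF S'(4)[OF S'(5)[OF B] B]] by (simp add: cinner_adj_right)
    then show ?thesis by (simp add: norm_eq_iff_cinner)
  qed
  have diff: "B - C \<in> S" if "B \<in> S" "C \<in> S" for B C
  proof -
    have eq: "B - C = B + (-1) *\<^sub>C C" by (rule cblinfun_eqI) (simp add: scaleC_minus_left)
    show ?thesis unfolding eq by (rule S'(2)[OF that(1) S'(3)[OF that(2)]])
  qed
  obtain V :: "'a \<Rightarrow>\<^sub>C\<^sub>L 'a" where V: "\<And>B. B \<in> S \<Longrightarrow> V (B \<Omega>) = B x" "\<And>y. norm (V y) = norm y"
  proof (rule isometry_extension[of "\<lambda>B. cblinfun_apply B \<Omega>" S "\<lambda>B. cblinfun_apply B x"])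
    show "norm (B x - C x) = norm (B \<Omega> - C \<Omega>)" if "B \<in> S" "C \<in> S" for B C
      using nB[OF diff[OF that]] by simp
    show "\<exists>k\<in>S. k \<Omega> = B \<Omega> + C \<Omega> \<and> k x = B x + C x" if "B \<in> S" "C \<in> S" for B C
      using S'(2)[OF that] by (intro bexI[of _ "B + C"]) auto
    show "\<exists>k\<in>S. k \<Omega> = c *\<^sub>C B \<Omega> \<and> k x = c *\<^sub>C B x" if "B \<in> S" for B c
      using S'(3)[OF that] by (intro bexI[of _ "c *\<^sub>C B"]) auto
  qed (use nB dense in auto)
  have V\<Omega>: "V \<Omega> = x" using V(1)[OF S'(1)] by simp
  have VS: "V \<in> commutant S"
  proof -
    have "V o\<^sub>C X = X o\<^sub>C V" if X: "X \<in> S" for X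
    proof (rule cblinfun_eqI_dense[OF dense(2)])
      fix y assume "y \<in> (\<lambda>B. cblinfun_apply B \<Omega>) ` S"
      then obtain B where B: "B \<in> S" "y = B \<Omega>" by blast
      show "(V o\<^sub>C X) y = (X o\<^sub>C V) y"
        using V(1)[OF S'(4)[OF X B(1)]] V(1)[OF B(1)] by (simp add: B(2))
    qed
    then show ?thesis by (auto simp: commutant_def)
  qed
  have VV: "(V\<^sup>\<dagger>) (V y) = y" for y by (rule isometry_cadjoint_cancel[OF V(2)])
  have UVU: "U o\<^sub>C V o\<^sub>C U\<^sup>\<dagger> = v *\<^sub>C V"
  proof (rule cblinfun_eqI_dense[OF dense(2)])
    fix y assume "y \<in> (\<lambda>B. cblinfun_apply B \<Omega>) ` S"
    then obtain B where B: "B \<in> S" "y = B \<Omega>" by blast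
    have UB: "upow_conj U (- 1) B \<in> S" by (rule S[OF B(1)])
    have e: "upow_conj U (- 1) B z = (U\<^sup>\<dagger>) (B (U z))" for z
      using upow_cadjoint[OF U'(1), of 1] by simp
    have "(U\<^sup>\<dagger>) y = upow_conj U (- 1) B \<Omega>" by (simp only: e B(2) U'(2))
    then have "V ((U\<^sup>\<dagger>) y) = upow_conj U (- 1) B x" by (simp only: V(1)[OF UB])
    also have "\<dots> = (U\<^sup>\<dagger>) (B (U x))" by (rule e)
    finally have "V ((U\<^sup>\<dagger>) y) = (U\<^sup>\<dagger>) (B (U x))" .
    then show "(U o\<^sub>C V o\<^sub>C U\<^sup>\<dagger>) y = (v *\<^sub>C V) y"
      by (simp add: unitaryD[OF U'(1)] x(2) cblinfun_scaleC_right B(2) V(1)[OF B(1)])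
  qed
  have UV: "U (V y) = v *\<^sub>C V (U y)" for y
    using arg_cong[OF UVU, of "\<lambda>T. cblinfun_apply T (U y)"] by (simp add: unitaryD[OF U'(1)])
  have UVd: "U ((V\<^sup>\<dagger>) y) = cnj v *\<^sub>C (V\<^sup>\<dagger>) (U y)" for y
  proof -
    have "(U o\<^sub>C V o\<^sub>C U\<^sup>\<dagger>)\<^sup>\<dagger> = cnj v *\<^sub>C V\<^sup>\<dagger>" unfolding UVU by (rule cadjoint_scaleC)
    then have "U o\<^sub>C (V\<^sup>\<dagger> o\<^sub>C U\<^sup>\<dagger>) = cnj v *\<^sub>C V\<^sup>\<dagger>" by (simp add: cadjoint_compose)
    from arg_cong[OF this, of "\<lambda>T. cblinfun_apply T (U y)"] show ?thesis
      by (simp add: unitaryD[OF U'(1)])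
  qed
  \<comment> \<open>The factors \<open>v\<close> and \<open>cnj v\<close> cancel, so
    \<open>P \<Omega>\<close> is fixed by \<open>U\<close> and \<open>P\<close> is a scalar; since
    \<open>P x = x\<close> the scalar is \<open>1\<close>, and the isometry \<open>V\<close> is
    onto.\<close>
  define P where "P = V o\<^sub>C V\<^sup>\<dagger>"
  have PS: "P \<in> commutant S"
    unfolding P_def by (intro commutant_compose VS commutant_cadjoint[OF S'(5)])
  have "U (P \<Omega>) = P \<Omega>"
    by (simp add: P_def UV UVd cblinfun_scaleC_right scaleC_scaleC vv U'(2))
  then obtain c where c: "P \<Omega> = c *\<^sub>C \<Omega>" using U'(4) by blast
  have Pc: "P = c *\<^sub>C cblinfun_id"
  proof (rule cblinfun_eqI_dense[OF dense(2)])
    fix y assume "y \<in> (\<lambda>B. cblinfun_apply B \<Omega>) ` S"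
    then obtain B where B: "B \<in> S" "y = B \<Omega>" by blast
    show "P y = (c *\<^sub>C cblinfun_id) y"
      using commutantD[OF PS B(1), of \<Omega>] by (simp add: B(2) c cblinfun_scaleC_right)
  qed
  have "P x = x" by (simp add: P_def V\<Omega>[symmetric] VV)
  then have "(c - 1) *\<^sub>C x = 0" by (simp add: Pc scaleC_diff_left)
  then have "c = 1" using x(1) by auto
  then have VV': "V ((V\<^sup>\<dagger>) y) = y" for y
    using arg_cong[OF Pc, of "\<lambda>T. cblinfun_apply T y"] by (simp add: P_def)
  have "eigenspace U v = range (\<lambda>c. c *\<^sub>C V \<Omega>)"
  proof (intro equalityI subsetI)
    fix y assume "y \<in> eigenspace U v"
    then have y: "U y = v *\<^sub>C y" by (simp add: eigenspace_def)
    \<comment> \<open>The adjoint of \<open>V\<close> carries the eigenspace for \<open>v\<close> to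
      the fixed vectors, which are the multiples of \<Omega>.\<close>
    have "U ((V\<^sup>\<dagger>) y) = (V\<^sup>\<dagger>) y"
      using vv by (simp add: UVd y cblinfun_scaleC_right scaleC_scaleC mult.commute)
    then obtain d where "(V\<^sup>\<dagger>) y = d *\<^sub>C \<Omega>" using U'(4) by blast
    then have "y = d *\<^sub>C V \<Omega>" using VV'[of y] by (simp add: cblinfun_scaleC_right)
    then show "y \<in> range (\<lambda>c. c *\<^sub>C V \<Omega>)" by blast
  next
    fix y assume "y \<in> range (\<lambda>c. c *\<^sub>C V \<Omega>)"
    then show "y \<in> eigenspace U v"
      by (auto simp: eigenspace_def V\<Omega> cblinfun_scaleC_right x(2) scaleC_scaleC mult.commute)
  qed
  moreover have "unitary V" by (rule unitaryI) (simp_all add: VV VV')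
  ultimately show ?thesis using VS UVU by blast
qed

section \<open>Ergodic invariant states\<close>

lemma cesaro_in_convex_cone:
  assumes "\<And>n. f n \<in> P" "0 \<in> P" "\<And>x y. x \<in> P \<Longrightarrow> y \<in> P \<Longrightarrow> x + y \<in> P"
    "\<And>r x. 0 \<le> r \<Longrightarrow> x \<in> P \<Longrightarrow> r *\<^sub>R x \<in> P"
  shows "cesaro f N \<in> P"
proof -
  have "(\<Sum>n<N. f n) \<in> P" by (induction N) (simp_all add: assms)
  then show ?thesis unfolding cesaro_def by (intro assms) auto
qed

text \<open>The last assumption is cyclicity of \<Omega> for the commutant, the form in which the
  separating property for the bicommutant is used below.\<close>

locale covariant_representation = cyclic_representation \<omega> \<pi> \<Omega>
  for \<omega> :: "'a::unital_cstar_algebra cdual" and \<pi> :: "'a \<Rightarrow> 'h::complex_hilbert \<Rightarrow>\<^sub>C\<^sub>L 'h" and \<Omega> :: 'h +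
  fixes \<alpha> :: "'a \<Rightarrow> 'a" and U :: "'h \<Rightarrow>\<^sub>C\<^sub>L 'h"
  assumes alpha: "star_automorphism \<alpha>"
    and state: "state \<omega>"
    and U: "unitary U" "U \<Omega> = \<Omega>"
    and covariant: "U o\<^sub>C \<pi> a o\<^sub>C U\<^sup>\<dagger> = \<pi> (\<alpha> a)"
    and separating: "closure ((\<lambda>B. cblinfun_apply B \<Omega>) ` commutant (range \<pi>)) = UNIV"
begin

lemma bij_alpha: "bij \<alpha>"
  using alpha by (simp add: star_automorphism_def)

lemma norm_Omega: "norm \<Omega> = 1"
proof -
  have "cinner \<Omega> \<Omega> = 1" using state omega_eq[of 1] by (simp add: state_def pi_one)
  then have "(norm \<Omega>)\<^sup>2 = 1" by (metis cinner_self of_real_eq_1_iff)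
  then show ?thesis by (simp add: power2_eq_1_iff)
      (metis norm_ge_zero not_one_le_zero neg_0_le_iff_le order_trans le_minus_one_simps(3))
qed

lemma upow_Omega [simp]: "upow U k \<Omega> = \<Omega>"
  using upow_eigen[OF U(1), of \<Omega> 1 k] U(2) by simp

lemma U_pi: "U (\<pi> a x) = \<pi> (\<alpha> a) (U x)"
  using arg_cong[OF covariant[of a], of "\<lambda>T. cblinfun_apply T (U x)"] by (simp add: unitaryD[OF U(1)])

lemma upow_pi: "upow U k (\<pi> a x) = \<pi> (int_iterate \<alpha> k a) (upow U k x)"
proof (induction k rule: int_induct[where k = 0])
  case (step1 i)
  then show ?case by (simp add: upow_succ[OF U(1)] int_iterate_succ[OF bij_alpha] U_pi)
next
  case (step2 i)
  let ?b = "int_iterate \<alpha> i a"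
  have "U (\<pi> (inv \<alpha> ?b) ((U\<^sup>\<dagger>) (upow U i x))) = \<pi> ?b (upow U i x)"
    using bij_alpha by (simp add: U_pi bij_is_surj surj_f_inv_f unitaryD[OF U(1)])
  then have "(U\<^sup>\<dagger>) (\<pi> ?b (upow U i x)) = \<pi> (inv \<alpha> ?b) ((U\<^sup>\<dagger>) (upow U i x))"
    by (metis unitaryD(1)[OF U(1)])
  then show ?case
    using step2 by (simp add: upow_pred[OF U(1)] int_iterate_pred[OF bij_alpha])
qed simp

lemma upow_conj_pi: "upow_conj U k (\<pi> a) = \<pi> (int_iterate \<alpha> k a)"
  by (rule cblinfun_eqI) (simp add: upow_pi upow_cancel[OF U(1)])

lemma upow_conj_range: "X \<in> range \<pi> \<Longrightarrow> upow_conj U k X \<in> range \<pi>"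
  by (auto simp: upow_conj_pi)

lemma upow_conj_commutant_pi:
  "B \<in> commutant (range \<pi>) \<Longrightarrow> upow_conj U k B \<in> commutant (range \<pi>)"
  by (rule upow_conj_commutant[OF U(1) upow_conj_range])

lemma operator_algebra_commutant: "operator_algebra (commutant (range \<pi>))"
  unfolding operator_algebra_def
  by (auto intro: commutant_add commutant_scaleC commutant_compose commutant_pi_cadjoint)

text \<open>For a self-adjoint contraction \<open>B\<close> of the commutant the functionals given by \<open>(1 \<plusminus> B)\<Omega>\<close>
  are positive; averaging them over the dynamics turns \<open>\<omega>\<close> into a midpoint of invariant states.\<close>

lemma ergodic_mean_eq_0:
  assumes erg: "ergodic (int_iterate \<alpha> m) \<omega>"
    and B: "B \<in> commutant (range \<pi>)" "B\<^sup>\<dagger> = B" "norm B \<le> 1" "cinner (B \<Omega>) \<Omega> = 0"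
    and z: "cesaro (\<lambda>n. upow (upow U m) (int n) (B \<Omega>)) \<longlonglongrightarrow> z" "upow U m z = z"
      "\<And>y. upow U m y = y \<Longrightarrow> cinner z y = cinner (B \<Omega>) y"
  shows "z = 0"
proof -
  \<comment> \<open>The vectors whose functional
    \<open>a \<mapsto> cinner (\<pi> a x) \<Omega>\<close> is positive. They form a closed convex
    cone, so positivity survives averaging and the limit.\<close>
  define P where "P = {x. \<forall>a. cinner (\<pi> (a\<^sup>\<star> * a) x) \<Omega> \<in> \<real>\<^sub>\<ge>\<^sub>0}"
  have "P = (\<Inter>a. (\<lambda>x. cinner (\<pi> (a\<^sup>\<star> * a) x) \<Omega>) -` \<real>\<^sub>\<ge>\<^sub>0)" by (auto simp: P_def)
  also have "closed \<dots>"
    by (intro closed_INT ballI closed_vimage closed_nonneg_Reals_complex continuous_intros)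
  finally have closedP: "closed P" .
  have posB: "\<Omega> + s *\<^sub>R upow U k (B \<Omega>) \<in> P" if s: "s = 1 \<or> s = - 1" for s k
    unfolding P_def
  proof (intro CollectI allI)
    fix a
    define C where "C = upow_conj U k B"
    have C: "C \<in> commutant (range \<pi>)" unfolding C_def by (rule upow_conj_commutant_pi[OF B(1)])
    have C\<Omega>: "upow U k (B \<Omega>) = C \<Omega>" by (simp add: C_def)
    define y where "y = \<pi> a \<Omega>"
    have "cinner (\<pi> (a\<^sup>\<star> * a) (\<Omega> + s *\<^sub>R C \<Omega>)) \<Omega> = cinner (\<pi> a (\<Omega> + s *\<^sub>R C \<Omega>)) y"
      by (simp only: pi_mult y_def pi_adj_right cblinfun_compose_apply)
    \<comment> \<open>Here membership in the commutant is essential: \<open>C\<close> passes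
      \<open>\<pi> a\<close> and acts on \<open>y\<close>, where a self-adjoint contraction cannot
      outweigh the squared norm of \<open>y\<close>.\<close>
    also have "\<pi> a (\<Omega> + s *\<^sub>R C \<Omega>) = y + s *\<^sub>R C y"
      by (simp add: y_def cblinfun_add_right cblinfun_scaleR_right commutant_piD[OF C])
    also have "cinner (y + s *\<^sub>R C y) y = of_real ((norm y)\<^sup>2) + of_real s * cinner (C y) y"
      by (simp add: cinner_add_left cinner_scaleR_left cinner_self)
    finally have eq: "cinner (\<pi> (a\<^sup>\<star> * a) (\<Omega> + s *\<^sub>R C \<Omega>)) \<Omega>
        = of_real ((norm y)\<^sup>2) + of_real s * cinner (C y) y" .
    have "cinner (C y) y = cinner (B (upow U (- k) y)) (upow U (- k) y)"
      by (simp add: C_def cinner_upow_left[OF U(1)])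
    also have "\<dots> = cnj (cinner (B (upow U (- k) y)) (upow U (- k) y))"
      by (subst cinner_adj_left, subst cinner_commute) (simp add: B(2))
    also have "cinner (B (upow U (- k) y)) (upow U (- k) y) = cinner (C y) y"
      by (simp add: C_def cinner_upow_left[OF U(1)])
    finally have im: "Im (cinner (C y) y) = 0" by (simp add: complex_eq_iff)
    have "norm (C y) \<le> norm B * norm y"
      using cblinfun_apply_le[of B "upow U (- k) y"] by (simp add: C_def U(1))
    also have "\<dots> \<le> 1 * norm y" by (intro mult_right_mono B(3)) simp
    finally have "cmod (cinner (C y) y) \<le> norm y * norm y"
      by (intro order_trans[OF cinner_norm_le] mult_right_mono) auto
    then have "\<bar>Re (cinner (C y) y)\<bar> \<le> (norm y)\<^sup>2"
      using abs_Re_le_cmod order_trans unfolding power2_eq_square by blast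
    then show "cinner (\<pi> (a\<^sup>\<star> * a) (\<Omega> + s *\<^sub>R upow U k (B \<Omega>))) \<Omega> \<in> \<real>\<^sub>\<ge>\<^sub>0"
      unfolding C\<Omega> eq complex_nonneg_Reals_iff using im s by auto
  qed
  have zP: "\<Omega> + s *\<^sub>R z \<in> P" if s: "s = 1 \<or> s = - 1" for s
  proof -
    have "cesaro (\<lambda>n. \<Omega> + s *\<^sub>R upow (upow U m) (int n) (B \<Omega>)) N \<in> P" for N
    proof (rule cesaro_in_convex_cone)
      show "\<Omega> + s *\<^sub>R upow (upow U m) (int n) (B \<Omega>) \<in> P" for n
        using posB[OF s] by (simp add: upow_upow[OF U(1)])
    qed (auto simp: P_def cblinfun_add_right cinner_add_left cblinfun_scaleR_right cinner_scaleR_left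
        complex_nonneg_Reals_iff)
    moreover have "cesaro (\<lambda>n. \<Omega> + s *\<^sub>R upow (upow U m) (int n) (B \<Omega>)) \<longlonglongrightarrow> \<Omega> + s *\<^sub>R z"
    proof -
      have "(\<lambda>N. cesaro (\<lambda>_. \<Omega>) N + s *\<^sub>R cesaro (\<lambda>n. upow (upow U m) (int n) (B \<Omega>)) N) \<longlonglongrightarrow> \<Omega> + s *\<^sub>R z"
        by (intro tendsto_intros z cesaro_const_tendsto)
      then show ?thesis by (simp only: cesaro_add[symmetric] cesaro_scaleR[symmetric])
    qed
    ultimately show ?thesis using closedP closed_sequentially by blast
  qed
  have inv: "vector_functional (\<Omega> + s *\<^sub>R z) \<Omega> \<in> invariant_states (int_iterate \<alpha> m)"
    if s: "s = 1 \<or> s = - 1" for s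
  proof -
    have "cinner z \<Omega> = 0" using z(3)[of \<Omega>] B(4) by simp
    then have one: "vector_functional (\<Omega> + s *\<^sub>R z) \<Omega> 1 = 1"
      by (simp add: vector_functional_apply pi_one cinner_add_left cinner_scaleR_left cinner_self norm_Omega)
    have "vector_functional (\<Omega> + s *\<^sub>R z) \<Omega> (int_iterate \<alpha> m a) = vector_functional (\<Omega> + s *\<^sub>R z) \<Omega> a" for a
    proof -
      have "cinner (\<pi> (int_iterate \<alpha> m a) (upow U m (\<Omega> + s *\<^sub>R z))) (upow U m \<Omega>) = cinner (\<pi> a (\<Omega> + s *\<^sub>R z)) \<Omega>"
        unfolding upow_pi[symmetric] by (rule cinner_upow[OF U(1)])
      then show ?thesis
        by (simp add: vector_functional_apply z(2) cblinfun_add_right[of "upow U m"]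
            cblinfun_scaleR_right[of "upow U m"])
    qed
    then show ?thesis
      using zP[OF s] one by (auto simp: invariant_states_def state_def P_def vector_functional_apply)
  qed
  define \<phi> where "\<phi> s = vector_functional (\<Omega> + s *\<^sub>R z) \<Omega>" for s
  have mid: "\<omega> = (1 - 1/2) *\<^sub>R \<phi> 1 + (1/2) *\<^sub>R \<phi> (- 1)"
  proof (rule cblinfun_eqI)
    fix a
    show "\<omega> a = ((1 - 1/2) *\<^sub>R \<phi> 1 + (1/2) *\<^sub>R \<phi> (- 1)) a"
      by (simp add: \<phi>_def omega_eq vector_functional_apply cblinfun_add_right cinner_add_left
          scaleR_conv_of_real cblinfun_diff_right cinner_diff_left, simp add: field_simps)
  qed
  \<comment> \<open>An extreme point lies in no open segment between invariant states. Being the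
    midpoint of these two, \<omega> forces them to coincide.\<close>
  have "\<omega> \<notin> open_segment (\<phi> 1) (\<phi> (- 1))"
    using erg inv[of 1] inv[of "- 1"] by (auto simp: ergodic_def extreme_point_of_def \<phi>_def)
  then have "\<phi> 1 = \<phi> (- 1)" using mid unfolding in_segment(2) by (metis field_sum_of_halves half_gt_zero
        less_add_same_cancel1 zero_less_one)
  then have "\<phi> 1 a = \<phi> (- 1) a" for a by simp
  then have orth: "cinner (\<pi> a z) \<Omega> = 0" for a
    by (simp add: \<phi>_def vector_functional_apply cblinfun_add_right cinner_add_left
        cblinfun_diff_right cinner_diff_left)
  have "closed {y. cinner z y = 0}" by (intro closed_Collect_eq continuous_intros)
  moreover have "cinner z (\<pi> a \<Omega>) = 0" for a using orth[of "a\<^sup>\<star>"] by (simp add: pi_adj_right)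
  ultimately have "closure (range (\<lambda>a. \<pi> a \<Omega>)) \<subseteq> {y. cinner z y = 0}"
    by (intro closure_minimal) auto
  then have "cinner z z = 0" using cyclic by blast
  then show "z = 0" by simp
qed

text \<open>A fixed vector orthogonal to \<Omega> is orthogonal to \<open>B \<Omega>\<close> for all
  \<open>B\<close> in the commutant: for self-adjoint contractions of mean zero by
  \<open>ergodic_mean_eq_0\<close>, and in general by scaling, subtracting the mean and splitting
  into self-adjoint parts.\<close>

theorem ergodic_imp_ergodic_vector:
  assumes erg: "ergodic (int_iterate \<alpha> m) \<omega>"
  shows "ergodic_vector (upow U m) \<Omega>"
proof -
  have *: "x = 0" if x: "upow U m x = x" "cinner x \<Omega> = 0" for x
  proof -
    have x': "cinner \<Omega> x = 0" using x(2) cinner_sym_0 by blast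
    have 1: "cinner (B \<Omega>) x = 0"
      if B: "B \<in> commutant (range \<pi>)" "B\<^sup>\<dagger> = B" "norm B \<le> 1" "cinner (B \<Omega>) \<Omega> = 0" for B
    proof -
      obtain z where z: "cesaro (\<lambda>n. upow (upow U m) (int n) (B \<Omega>)) \<longlonglongrightarrow> z" "upow U m z = z"
        "\<And>y. upow U m y = y \<Longrightarrow> cinner z y = cinner (upow (upow U m) (int 0) (B \<Omega>)) y"
        by (rule mean_ergodic_unitary[OF unitary_upow[OF U(1), of m],
              of "\<lambda>n. upow (upow U m) (int n) (B \<Omega>)"])
          (simp_all only: upow_Suc[OF unitary_upow[OF U(1)]])
      have "z = 0" by (rule ergodic_mean_eq_0[OF erg B z(1,2)]) (use z(3) in simp)
      then show ?thesis using z(3)[OF x(1)] by simp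
    qed
    have 2: "cinner (B \<Omega>) x = 0"
      if B: "B \<in> commutant (range \<pi>)" "B\<^sup>\<dagger> = B" "cinner (B \<Omega>) \<Omega> = 0" for B
    proof (cases "B = 0")
      case False
      let ?c = "complex_of_real (inverse (norm B))"
      have "cinner ((?c *\<^sub>C B) \<Omega>) x = 0"
      proof (rule 1)
        show "?c *\<^sub>C B \<in> commutant (range \<pi>)" by (rule commutant_scaleC[OF B(1)])
        show "(?c *\<^sub>C B)\<^sup>\<dagger> = ?c *\<^sub>C B" unfolding cadjoint_scaleC B(2) by simp
        show "norm (?c *\<^sub>C B) \<le> 1" unfolding norm_scaleC using False by (simp add: norm_inverse)
        show "cinner ((?c *\<^sub>C B) \<Omega>) \<Omega> = 0" by (simp add: cinner_scaleC_left B(3))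
      qed
      then show ?thesis using False by (simp add: cinner_scaleC_left)
    qed simp
    have 3: "cinner (B \<Omega>) x = 0" if B: "B \<in> commutant (range \<pi>)" "B\<^sup>\<dagger> = B" for B
    proof -
      define c where "c = cinner (B \<Omega>) \<Omega>"
      have c: "cnj c = c"
        unfolding c_def by (subst cinner_commute) (simp add: cinner_adj_left B(2))
      have "cinner ((B - c *\<^sub>C cblinfun_id) \<Omega>) x = 0"
      proof (rule 2)
        show "B - c *\<^sub>C cblinfun_id \<in> commutant (range \<pi>)"
          by (intro commutant_diff commutant_scaleC B(1)) simp
        have "(cblinfun_id :: 'h \<Rightarrow>\<^sub>C\<^sub>L 'h)\<^sup>\<dagger> = cblinfun_id" by (rule cadjoint_eqI) simp
        then show "(B - c *\<^sub>C cblinfun_id)\<^sup>\<dagger> = B - c *\<^sub>C cblinfun_id"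
          by (simp add: cadjoint_diff cadjoint_scaleC B(2) c)
        show "cinner ((B - c *\<^sub>C cblinfun_id) \<Omega>) \<Omega> = 0"
          by (simp add: cinner_diff_left cinner_scaleC_left cinner_self norm_Omega c_def[symmetric])
      qed
      then show ?thesis by (simp add: cinner_diff_left cinner_scaleC_left x')
    qed
    have 4: "cinner (B \<Omega>) x = 0" if B: "B \<in> commutant (range \<pi>)" for B
    proof -
      have B': "B\<^sup>\<dagger> \<in> commutant (range \<pi>)" by (rule commutant_pi_cadjoint[OF B])
      have "cinner ((B + B\<^sup>\<dagger>) \<Omega>) x = 0"
        by (rule 3) (use commutant_add[OF B B'] in \<open>simp_all add: cadjoint_add add.commute\<close>)
      moreover have "cinner ((\<i> *\<^sub>C (B - B\<^sup>\<dagger>)) \<Omega>) x = 0"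
      proof (rule 3)
        show "\<i> *\<^sub>C (B - B\<^sup>\<dagger>) \<in> commutant (range \<pi>)" by (intro commutant_scaleC commutant_diff B B')
        show "(\<i> *\<^sub>C (B - B\<^sup>\<dagger>))\<^sup>\<dagger> = \<i> *\<^sub>C (B - B\<^sup>\<dagger>)"
          by (simp add: cadjoint_scaleC cadjoint_diff scaleC_minus_left scaleC_diff_right)
      qed
      ultimately show ?thesis
        by (simp add: cinner_add_left cinner_diff_left cinner_scaleC_left)
    qed
    have "closed {y. cinner y x = 0}" by (intro closed_Collect_eq continuous_intros)
    then have "closure ((\<lambda>B. cblinfun_apply B \<Omega>) ` commutant (range \<pi>)) \<subseteq> {y. cinner y x = 0}"
      by (intro closure_minimal) (auto simp: 4)
    then have "cinner x x = 0" using separating by blast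
    then show ?thesis by simp
  qed
  have "\<exists>c. x = c *\<^sub>C \<Omega>" if "upow U m x = x" for x
  proof -
    have "x - cinner x \<Omega> *\<^sub>C \<Omega> = 0"
      by (rule *) (simp_all add: cblinfun_diff_right cblinfun_scaleC_right that cinner_diff_left
          cinner_scaleC_left cinner_self norm_Omega)
    then show ?thesis by (intro exI[of _ "cinner x \<Omega>"]) simp
  qed
  then show ?thesis by (simp add: ergodic_vector_def unitary_upow[OF U(1)] norm_Omega)
qed

end

section \<open>Orthonormal series\<close>

definition orthonormal_on :: "'i set \<Rightarrow> ('i \<Rightarrow> 'h::complex_hilbert) \<Rightarrow> bool" where
  "orthonormal_on I e \<longleftrightarrow> (\<forall>i\<in>I. \<forall>j\<in>I. cinner (e i) (e j) = (if i = j then 1 else 0))"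

lemma norm_orthonormal_sum:
  assumes f: "orthonormal_on I f" and J: "finite J" "J \<subseteq> I"
  shows "(norm (\<Sum>i\<in>J. c i *\<^sub>C f i))\<^sup>2 = (\<Sum>i\<in>J. (cmod (c i))\<^sup>2)"
proof -
  have "complex_of_real ((norm (\<Sum>i\<in>J. c i *\<^sub>C f i))\<^sup>2)
      = (\<Sum>i\<in>J. \<Sum>j\<in>J. c i * (cnj (c j) * cinner (f i) (f j)))"
    unfolding norm_sum_sq by (simp add: cinner_scaleC_left cinner_scaleC_right mult.left_commute)
  also have "\<dots> = (\<Sum>i\<in>J. \<Sum>j\<in>J. if i = j then c i * cnj (c i) else 0)"
  proof (intro sum.cong refl)
    fix i j assume "i \<in> J" "j \<in> J"
    then have "i \<in> I" "j \<in> I" using J(2) by auto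
    then have "cinner (f i) (f j) = (if i = j then 1 else 0)"
      using f by (simp add: orthonormal_on_def)
    then show "c i * (cnj (c j) * cinner (f i) (f j)) = (if i = j then c i * cnj (c i) else 0)"
      by simp
  qed
  also have "\<dots> = (\<Sum>i\<in>J. c i * cnj (c i))" using J(1) by simp
  also have "\<dots> = complex_of_real (\<Sum>i\<in>J. (cmod (c i))\<^sup>2)"
    by (simp only: complex_norm_square of_real_sum)
  finally show ?thesis by (simp only: of_real_eq_iff)
qed

lemma bessel_inequality:
  assumes e: "orthonormal_on I e" and J: "finite J" "J \<subseteq> I"
  shows "(\<Sum>i\<in>J. (cmod (cinner \<xi> (e i)))\<^sup>2) \<le> (norm \<xi>)\<^sup>2"
proof -
  define p where "p = (\<Sum>i\<in>J. cinner \<xi> (e i) *\<^sub>C e i)"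
  have "cinner \<xi> p = (\<Sum>i\<in>J. complex_of_real ((cmod (cinner \<xi> (e i)))\<^sup>2))"
    unfolding p_def cinner_sum_right cinner_scaleC_right complex_norm_square by (simp add: mult.commute)
  then have "Re (cinner \<xi> p) = (\<Sum>i\<in>J. (cmod (cinner \<xi> (e i)))\<^sup>2)" by simp
  moreover have "(norm p)\<^sup>2 = (\<Sum>i\<in>J. (cmod (cinner \<xi> (e i)))\<^sup>2)"
    unfolding p_def by (rule norm_orthonormal_sum[OF e J])
  ultimately have "(norm (\<xi> - p))\<^sup>2 = (norm \<xi>)\<^sup>2 - (\<Sum>i\<in>J. (cmod (cinner \<xi> (e i)))\<^sup>2)"
    by (simp add: norm_diff_sq)
  then show ?thesis using zero_le_power2[of "norm (\<xi> - p)"] by linarith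
qed

text \<open>The finite partial sums form a Cauchy net: once \<open>J0\<close> comes within
  \<open>(r / 2)\<^sup>2\<close> of the supremum of the squared coefficients, Pythagoras bounds
  whatever is added later by \<open>r / 2\<close>.\<close>

lemma orthonormal_series_summable:
  fixes f :: "'i \<Rightarrow> 'h::complex_hilbert"
  assumes f: "orthonormal_on I f"
    and bd: "\<And>J. finite J \<Longrightarrow> J \<subseteq> I \<Longrightarrow> (\<Sum>i\<in>J. (cmod (c i))\<^sup>2) \<le> K"
  shows "(\<lambda>i. c i *\<^sub>C f i) summable_on I"
proof -
  define s where "s J = (\<Sum>i\<in>J. (cmod (c i))\<^sup>2)" for J
  define F where "F = {J. finite J \<and> J \<subseteq> I}"
  define L where "L = (SUP J\<in>F. s J)"
  have bdd: "bdd_above (s ` F)" by (rule bdd_aboveI2[of _ _ K]) (use bd in \<open>auto simp: F_def s_def\<close>)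
  have F0: "{} \<in> F" by (simp add: F_def)
  have "\<exists>P. eventually P (finite_subsets_at_top I) \<and>
      (\<forall>J J'. P J \<and> P J' \<longrightarrow> dist (\<Sum>i\<in>J. c i *\<^sub>C f i) (\<Sum>i\<in>J'. c i *\<^sub>C f i) < r)" if r: "r > 0" for r
  proof -
    have "L - (r / 2)\<^sup>2 < L" using r by simp
    then obtain J0 where J0: "J0 \<in> F" "L - (r / 2)\<^sup>2 < s J0"
      using less_cSUP_iff[OF _ bdd, of "L - (r / 2)\<^sup>2"] F0 unfolding L_def by blast
    define P where "P J \<longleftrightarrow> finite J \<and> J0 \<subseteq> J \<and> J \<subseteq> I" for J
    have ev: "eventually P (finite_subsets_at_top I)"
      unfolding eventually_finite_subsets_at_top P_def using J0(1) by (auto simp: F_def intro!: exI[of _ J0])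
    have near: "dist (\<Sum>i\<in>J. c i *\<^sub>C f i) (\<Sum>i\<in>J0. c i *\<^sub>C f i) < r / 2" if "P J" for J
    proof -
      have J: "finite J" "J0 \<subseteq> J" "J \<subseteq> I" using that by (auto simp: P_def)
      have "(norm (\<Sum>i\<in>J - J0. c i *\<^sub>C f i))\<^sup>2 = s (J - J0)"
        unfolding s_def by (rule norm_orthonormal_sum[OF f]) (use J in auto)
      also have "\<dots> = s J - s J0" unfolding s_def by (rule sum_diff[OF J(1,2)])
      finally have eq: "(norm (\<Sum>i\<in>J - J0. c i *\<^sub>C f i))\<^sup>2 = s J - s J0" .
      have "s J \<le> L" unfolding L_def by (rule cSUP_upper[OF _ bdd]) (use J in \<open>simp add: F_def\<close>)
      with eq have "(norm (\<Sum>i\<in>J - J0. c i *\<^sub>C f i))\<^sup>2 < (r / 2)\<^sup>2" using J0(2) by linarith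
      then have "norm (\<Sum>i\<in>J - J0. c i *\<^sub>C f i) < r / 2"
        using r power2_less_imp_less[of "norm (\<Sum>i\<in>J - J0. c i *\<^sub>C f i)" "r / 2"] by simp
      then show ?thesis by (simp only: dist_norm sum_diff[OF J(1,2)])
    qed
    show ?thesis
    proof (intro exI[of _ P] conjI allI impI ev)
      fix J J' assume "P J \<and> P J'"
      then show "dist (\<Sum>i\<in>J. c i *\<^sub>C f i) (\<Sum>i\<in>J'. c i *\<^sub>C f i) < r"
        by (blast intro: dist_triangle_half_l near)
    qed
  qed
  then have "cauchy_filter (filtermap (sum (\<lambda>i. c i *\<^sub>C f i)) (finite_subsets_at_top I))"
    unfolding cauchy_filter_metric_filtermap by blast
  moreover have "complete (UNIV :: 'h set)" by (simp add: complete_eq_closed)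
  ultimately obtain l where "(sum (\<lambda>i. c i *\<^sub>C f i) \<longlongrightarrow> l) (finite_subsets_at_top I)"
    using complete_uniform[where S = "UNIV :: 'h set"] by (force simp add: filterlim_def)
  then show ?thesis unfolding summable_on_def has_sum_def by blast
qed

text \<open>The partial isometry taking \<open>e i\<close> to \<open>f i\<close>. Bessel's
  inequality for \<open>e\<close> bounds the coefficients and orthonormality of \<open>f\<close>
  sums them.\<close>

lemma orthonormal_series:
  fixes f :: "'i \<Rightarrow> 'h::complex_hilbert" and e :: "'i \<Rightarrow> 'k::complex_hilbert"
  assumes e: "orthonormal_on I e" and f: "orthonormal_on I f"
  shows "(\<lambda>i. cinner \<xi> (e i) *\<^sub>C f i) summable_on I"
    and "norm (\<Sum>\<^sub>\<infinity>i\<in>I. cinner \<xi> (e i) *\<^sub>C f i) \<le> norm \<xi>"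
    and "(\<Sum>\<^sub>\<infinity>i\<in>I. cinner (\<xi> + \<eta>) (e i) *\<^sub>C f i)
      = (\<Sum>\<^sub>\<infinity>i\<in>I. cinner \<xi> (e i) *\<^sub>C f i) + (\<Sum>\<^sub>\<infinity>i\<in>I. cinner \<eta> (e i) *\<^sub>C f i)"
    and "(\<Sum>\<^sub>\<infinity>i\<in>I. cinner (c *\<^sub>C \<xi>) (e i) *\<^sub>C f i) = c *\<^sub>C (\<Sum>\<^sub>\<infinity>i\<in>I. cinner \<xi> (e i) *\<^sub>C f i)"
proof -
  show sm: "(\<lambda>i. cinner \<xi> (e i) *\<^sub>C f i) summable_on I" for \<xi>
    by (rule orthonormal_series_summable[OF f bessel_inequality[OF e]])
  have lim: "(sum (\<lambda>i. cinner \<xi> (e i) *\<^sub>C f i) \<longlongrightarrow> (\<Sum>\<^sub>\<infinity>i\<in>I. cinner \<xi> (e i) *\<^sub>C f i))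
      (finite_subsets_at_top I)" for \<xi>
    using has_sum_infsum[OF sm] by (simp add: has_sum_def)
  show "norm (\<Sum>\<^sub>\<infinity>i\<in>I. cinner \<xi> (e i) *\<^sub>C f i) \<le> norm \<xi>"
  proof (rule tendsto_upperbound[OF tendsto_norm[OF lim]])
    show "\<forall>\<^sub>F J in finite_subsets_at_top I. norm (\<Sum>i\<in>J. cinner \<xi> (e i) *\<^sub>C f i) \<le> norm \<xi>"
    proof (rule eventually_finite_subsets_at_top_weakI)
      fix J assume J: "finite J" "J \<subseteq> I"
      have "(norm (\<Sum>i\<in>J. cinner \<xi> (e i) *\<^sub>C f i))\<^sup>2 \<le> (norm \<xi>)\<^sup>2"
        unfolding norm_orthonormal_sum[OF f J] by (rule bessel_inequality[OF e J])
      then show "norm (\<Sum>i\<in>J. cinner \<xi> (e i) *\<^sub>C f i) \<le> norm \<xi>" by (rule power2_le_imp_le) simp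
    qed
  qed simp
  show "(\<Sum>\<^sub>\<infinity>i\<in>I. cinner (\<xi> + \<eta>) (e i) *\<^sub>C f i)
      = (\<Sum>\<^sub>\<infinity>i\<in>I. cinner \<xi> (e i) *\<^sub>C f i) + (\<Sum>\<^sub>\<infinity>i\<in>I. cinner \<eta> (e i) *\<^sub>C f i)"
    unfolding cinner_add_left scaleC_add_left by (rule infsum_add[OF sm sm])
  have "((\<lambda>i. cinner (c *\<^sub>C \<xi>) (e i) *\<^sub>C f i) has_sum c *\<^sub>C (\<Sum>\<^sub>\<infinity>i\<in>I. cinner \<xi> (e i) *\<^sub>C f i)) I"
    unfolding has_sum_def cinner_scaleC_left scaleC_scaleC[symmetric] scaleC_sum_right[symmetric]
    by (intro tendsto_intros lim)
  then show "(\<Sum>\<^sub>\<infinity>i\<in>I. cinner (c *\<^sub>C \<xi>) (e i) *\<^sub>C f i) = c *\<^sub>C (\<Sum>\<^sub>\<infinity>i\<in>I. cinner \<xi> (e i) *\<^sub>C f i)"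
    by (rule infsumI)
qed

section \<open>Convergence on eigenvectors and on their orthogonal complement\<close>

text \<open>Multiplication by \<open>z\<close> is a shift of the sequence, so \<open>z - 1\<close>
  times the averages tends to \<open>0\<close>.\<close>

lemma cesaro_power_tendsto:
  fixes y :: "'h::complex_hilbert"
  assumes z: "cmod z = 1"
  shows "cesaro (\<lambda>n. z ^ n *\<^sub>C y) \<longlonglongrightarrow> (if z = 1 then y else 0)"
proof (cases "z = 1")
  case True then show ?thesis by (simp add: cesaro_const_tendsto)
next
  case False
  have "(\<lambda>N. cesaro (\<lambda>n. z ^ (n + 1) *\<^sub>C y) N - cesaro (\<lambda>n. z ^ n *\<^sub>C y) N) \<longlonglongrightarrow> 0"
    by (rule cesaro_shift_tendsto[where K = "norm y"]) (simp add: norm_scaleC norm_power z)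
  moreover have "cesaro (\<lambda>n. z ^ (n + 1) *\<^sub>C y) N = z *\<^sub>C cesaro (\<lambda>n. z ^ n *\<^sub>C y) N" for N
    unfolding cesaro_scaleC[symmetric] by (simp add: scaleC_scaleC)
  ultimately have "(\<lambda>N. (z - 1) *\<^sub>C cesaro (\<lambda>n. z ^ n *\<^sub>C y) N) \<longlonglongrightarrow> 0"
    by (simp add: scaleC_diff_left)
  from tendsto_scaleC[OF tendsto_const[of "inverse (z - 1)"] this] show ?thesis
    using False by (simp add: scaleC_scaleC)
qed

text \<open>The vectors at which convergence holds form a complex subspace containing all
  eigenvectors. A vector orthogonal to it is orthogonal to all eigenvectors, hence belongs to it and
  vanishes; so the subspace is dense.\<close>

lemma eigen_decomposition_convergence:
  fixes f :: "nat \<Rightarrow> 'h::complex_hilbert \<Rightarrow> 'k::complex_hilbert" and U :: "'h \<Rightarrow>\<^sub>C\<^sub>L 'h"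
  assumes f: "\<And>N x y. f N (x + y) = f N x + f N y" "\<And>N c x. f N (c *\<^sub>C x) = c *\<^sub>C f N x"
      "\<And>N x. norm (f N x) \<le> K * norm x"
    and g: "\<And>x y. g (x + y) = g x + g y" "\<And>c x. g (c *\<^sub>C x) = c *\<^sub>C g x"
      "\<And>x. norm (g x) \<le> K * norm x"
    and eigen: "\<And>e v. U e = v *\<^sub>C e \<Longrightarrow> (\<lambda>N. f N e) \<longlonglongrightarrow> g e"
    and orth: "\<And>x. x \<in> eigen_orthogonal U \<Longrightarrow> (\<lambda>N. f N x) \<longlonglongrightarrow> g x"
  shows "(\<lambda>N. f N x) \<longlonglongrightarrow> g x"
proof (rule dense_convergence[where f = f and g = g and K = K and D = "{x. (\<lambda>N. f N x) \<longlonglongrightarrow> g x}"])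
  have fd: "f N (x - y) = f N x - f N y" for N x y
    using f(1)[of N x "- y"] f(2)[of N "-1" y] by (simp add: scaleC_minus_left)
  show "norm (f N x - f N y) \<le> K * norm (x - y)" for N x y
    using f(3)[of N "x - y"] by (simp add: fd)
  have gd: "g (x - y) = g x - g y" for x y
    using g(1)[of x "- y"] g(2)[of "-1" y] by (simp add: scaleC_minus_left)
  show "norm (g x - g y) \<le> K * norm (x - y)" for x y
    using g(3)[of "x - y"] by (simp add: gd)
  let ?G = "{x. (\<lambda>N. f N x) \<longlonglongrightarrow> g x}"
  show "closure ?G = UNIV"
  proof (rule orthogonal_imp_dense)
    have "0 \<in> ?G" using eigen[of 0 1] by simp
    then show "csubspace ?G" unfolding csubspace_def by (auto simp: f g intro!: tendsto_intros)
    fix y assume y: "\<And>e. e \<in> ?G \<Longrightarrow> cinner y e = 0"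
    have "y \<in> eigen_orthogonal U" using y eigen by (auto simp: eigen_orthogonal_def)
    then have "cinner y y = 0" using y orth by blast
    then show "y = 0" by simp
  qed
  show "(\<lambda>N. f N x) \<longlonglongrightarrow> g x" if "x \<in> ?G" for x using that by simp
qed

section \<open>The resonance isometry\<close>

locale resonance = covariant_representation \<omega> \<pi> \<Omega> \<alpha> U
  for \<omega> :: "'a::unital_cstar_algebra cdual" and \<pi> :: "'a \<Rightarrow> 'h::complex_hilbert \<Rightarrow>\<^sub>C\<^sub>L 'h" and \<Omega> \<alpha> U +
  fixes tens :: "'h \<Rightarrow> 'h \<Rightarrow> 'k::complex_hilbert" and k1 k2 :: int
  assumes tens: "hilbert_tensor_product tens"
    and k: "k1 \<noteq> 0" "k2 \<noteq> 0"
    and ergodic_m: "ergodic_vector (upow U (k2 - k1)) \<Omega>"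
begin

abbreviation V where "V \<equiv> eigen_unitary (commutant (commutant (range \<pi>))) U \<Omega>"
abbreviation W where "W \<equiv> eigen_unitary (commutant (range \<pi>)) U \<Omega>"
abbreviation R where "R \<equiv> resonance_isometry \<pi> U \<Omega> tens k1 k2"

lemma ergodic_U: "ergodic_vector U \<Omega>"
proof -
  have "\<exists>c. x = c *\<^sub>C \<Omega>" if "U x = x" for x
    using upow_eigen[OF U(1), of x 1] ergodic_vectorD(4)[OF ergodic_m, of x] that by simp
  then show ?thesis using U norm_Omega by (simp add: ergodic_vector_def)
qed

lemma bicommutant_dense:
  "closure ((\<lambda>C. cblinfun_apply C \<Omega>) ` commutant (commutant (range \<pi>))) = UNIV"
proof -
  have "range (\<lambda>a. \<pi> a \<Omega>) \<subseteq> (\<lambda>C. cblinfun_apply C \<Omega>) ` commutant (commutant (range \<pi>))"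
    using commutant_bicommutant[of "range \<pi>"] by blast
  from closure_mono[OF this] show ?thesis using cyclic by auto
qed

text \<open>The general existence result yields unitaries in the commutant of \<open>S\<close>. Here
  \<open>S\<close> is the commutant of \<open>\<pi>(A)\<close>, while \<open>W_props\<close> takes
  \<open>\<pi>(A)\<close> itself.\<close>

lemma V_props:
  assumes "v \<in> point_spectrum U"
  shows "V v \<in> commutant (commutant (range \<pi>))" "unitary (V v)"
    "eigenspace U v = range (\<lambda>c. c *\<^sub>C V v \<Omega>)" "U o\<^sub>C V v o\<^sub>C U\<^sup>\<dagger> = v *\<^sub>C V v"
  unfolding eigen_unitary_def
  using someI_ex[OF eigen_unitary_exists[OF ergodic_U upow_conj_commutant_pi
      operator_algebra_commutant bicommutant_dense separating assms]] by blast+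

lemma W_props:
  assumes "w \<in> point_spectrum U"
  shows "W w \<in> commutant (range \<pi>)" "unitary (W w)"
    "eigenspace U w = range (\<lambda>c. c *\<^sub>C W w \<Omega>)" "U o\<^sub>C W w o\<^sub>C U\<^sup>\<dagger> = w *\<^sub>C W w"
proof -
  have "closure ((\<lambda>B. cblinfun_apply B \<Omega>) ` range \<pi>) = UNIV"
    using cyclic by (simp add: image_image)
  from someI_ex[OF eigen_unitary_exists[OF ergodic_U upow_conj_range operator_algebra_pi separating this assms]]
  show "W w \<in> commutant (range \<pi>)" "unitary (W w)"
    "eigenspace U w = range (\<lambda>c. c *\<^sub>C W w \<Omega>)" "U o\<^sub>C W w o\<^sub>C U\<^sup>\<dagger> = w *\<^sub>C W w"
    unfolding eigen_unitary_def by blast+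
qed

section \<open>Eigenvalue relations of the two families of unitaries\<close>

lemma V_eigen:
  assumes v: "v \<in> point_spectrum U"
  shows "U (V v x) = v *\<^sub>C V v (U x)" "norm (V v \<Omega>) = 1" "U (V v \<Omega>) = v *\<^sub>C V v \<Omega>" "cmod v = 1"
proof -
  show *: "U (V v x) = v *\<^sub>C V v (U x)" for x
    using arg_cong[OF V_props(4)[OF v], of "\<lambda>T. cblinfun_apply T (U x)"] by (simp add: unitaryD[OF U(1)])
  show n: "norm (V v \<Omega>) = 1" by (simp add: unitaryD(4)[OF V_props(2)[OF v]] norm_Omega)
  show "U (V v \<Omega>) = v *\<^sub>C V v \<Omega>" using *[of \<Omega>] by (simp add: U(2))
  then show "cmod v = 1" by (rule eigenvalue_unimodular[OF U(1)]) (use n in auto)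
qed

lemma W_eigen:
  assumes w: "w \<in> point_spectrum U"
  shows "norm (W w \<Omega>) = 1" "U (W w \<Omega>) = w *\<^sub>C W w \<Omega>" "cmod w = 1"
proof -
  have *: "U (W w x) = w *\<^sub>C W w (U x)" for x
    using arg_cong[OF W_props(4)[OF w], of "\<lambda>T. cblinfun_apply T (U x)"] by (simp add: unitaryD[OF U(1)])
  show n: "norm (W w \<Omega>) = 1" by (simp add: unitaryD(4)[OF W_props(2)[OF w]] norm_Omega)
  show "U (W w \<Omega>) = w *\<^sub>C W w \<Omega>" using *[of \<Omega>] by (simp add: U(2))
  then show "cmod w = 1" by (rule eigenvalue_unimodular[OF U(1)]) (use n in auto)
qed

lemma upow_V:
  assumes v: "v \<in> point_spectrum U"
  shows "upow U j (V v x) = (v powi j) *\<^sub>C V v (upow U j x)"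
proof -
  have v0: "v \<noteq> 0" using V_eigen(4)[OF v] by auto
  show ?thesis
  proof (induction j rule: int_induct[where k = 0])
    case (step1 i)
    then show ?case
      using v0 by (simp add: upow_succ[OF U(1)] cblinfun_scaleC_right V_eigen(1)[OF v] scaleC_scaleC power_int_add)
  next
    case (step2 i)
    have "(U\<^sup>\<dagger>) (V v y) = inverse v *\<^sub>C V v ((U\<^sup>\<dagger>) y)" for y
    proof -
      have "U (V v ((U\<^sup>\<dagger>) y)) = v *\<^sub>C V v y" by (simp add: V_eigen(1)[OF v] unitaryD[OF U(1)])
      then have "V v ((U\<^sup>\<dagger>) y) = (U\<^sup>\<dagger>) (v *\<^sub>C V v y)" by (metis unitaryD(1)[OF U(1)])
      then show ?thesis using v0 by (simp add: cblinfun_scaleC_right)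
    qed
    then show ?case
      using v0 step2 by (simp add: upow_pred[OF U(1)] cblinfun_scaleC_right scaleC_scaleC
          power_int_diff divide_inverse)
  qed simp
qed

lemma V_orthonormal:
  assumes "v \<in> point_spectrum U" "v' \<in> point_spectrum U"
  shows "cinner (V v \<Omega>) (V v' \<Omega>) = (if v = v' then 1 else 0)"
  using eigenvectors_orthogonal[OF U(1) V_eigen(3)[OF assms(1)] V_eigen(3)[OF assms(2)]]
    V_eigen(2)[OF assms(1)] by (auto simp: cinner_self)

lemma W_orthonormal:
  assumes "w \<in> point_spectrum U" "w' \<in> point_spectrum U"
  shows "cinner (W w \<Omega>) (W w' \<Omega>) = (if w = w' then 1 else 0)"
  using eigenvectors_orthogonal[OF U(1) W_eigen(2)[OF assms(1)] W_eigen(2)[OF assms(2)]]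
    W_eigen(1)[OF assms(1)] by (auto simp: cinner_self)

section \<open>Initial and final orthonormal systems of the partial isometry\<close>

definition source :: "complex \<times> complex \<Rightarrow> 'k" where
  "source i = tens (V (fst i) \<Omega>) (W (snd i) \<Omega>)"

definition target :: "complex \<times> complex \<Rightarrow> 'h" where
  "target i = V (fst i) (W (snd i) \<Omega>)"

lemma R_eq: "R \<xi> = (\<Sum>\<^sub>\<infinity>i\<in>resonance_set U k1 k2. cinner \<xi> (source i) *\<^sub>C target i)"
  by (simp add: resonance_isometry_def source_def target_def case_prod_unfold)

lemma resonance_setD:
  "i \<in> resonance_set U k1 k2 \<Longrightarrow> fst i \<in> point_spectrum U \<and> snd i \<in> point_spectrum U \<and>
    fst i powi k1 * snd i powi k2 = 1"
  by (auto simp: resonance_set_def)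

lemma source_orthonormal: "orthonormal_on (resonance_set U k1 k2) source"
  by (auto simp: orthonormal_on_def source_def tensorD(5)[OF tens] V_orthonormal W_orthonormal
      prod_eq_iff dest!: resonance_setD)

text \<open>If \<open>vw = v'w'\<close> on the resonance set, then \<open>a = v'/v\<close> is an eigenvalue of \<open>U\<close> satisfying
  \<open>a\<^bsup>k2 - k1\<^esup> = 1\<close>, so ergodicity gives \<open>a = 1\<close>.\<close>

lemma resonance_product_inj:
  assumes i: "i \<in> resonance_set U k1 k2" and j: "j \<in> resonance_set U k1 k2"
    and eq: "fst i * snd i = fst j * snd j"
  shows "i = j"
proof -
  obtain v w v' w' where ij: "i = (v, w)" "j = (v', w')" by (cases i, cases j)
  have s: "v \<in> point_spectrum U" "w \<in> point_spectrum U" "v powi k1 * w powi k2 = 1"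
    "v' \<in> point_spectrum U" "w' \<in> point_spectrum U" "v' powi k1 * w' powi k2 = 1"
    using resonance_setD[OF i] resonance_setD[OF j] by (auto simp: ij)
  have n: "cmod v = 1" "cmod w = 1" "cmod v' = 1" using V_eigen(4) s by blast+
  then have nz: "v \<noteq> 0" "w \<noteq> 0" "v' \<noteq> 0" by auto
  define a where "a = v' / v"
  have a0: "a \<noteq> 0" "cmod a = 1" using nz n by (auto simp: a_def norm_divide)
  have v': "v' = v * a" using nz by (simp add: a_def)
  have w': "w' = w * inverse a"
    using eq nz a0 by (simp add: ij v' field_simps)
  have "v' powi k1 * w' powi k2 = (v powi k1 * w powi k2) * (a powi k1 * inverse (a powi k2))"
    by (simp add: v' w' power_int_mult_distrib power_int_inverse)
  then have "a powi k1 * inverse (a powi k2) = 1" using s by simp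
  then have "a powi k2 = a powi k1" using a0 by (simp add: field_simps)
  then have am: "a powi (k2 - k1) = 1" using a0 by (simp add: power_int_diff)
  \<comment> \<open>Both unitaries shift the eigenvalue multiplicatively, so this vector is an
    eigenvector of \<open>U\<close> for the quotient \<open>a\<close>.\<close>
  define y where "y = ((V v)\<^sup>\<dagger>) (V v' \<Omega>)"
  have Vy: "V v y = V v' \<Omega>" by (simp add: y_def unitaryD(2)[OF V_props(2)[OF s(1)]])
  then have y0: "y \<noteq> 0" using V_eigen(2)[OF s(4)] by auto
  have "v *\<^sub>C V v (U y) = v' *\<^sub>C V v y"
    unfolding V_eigen(1)[OF s(1), symmetric] Vy by (rule V_eigen(3)[OF s(4)])
  then have "inverse v *\<^sub>C v *\<^sub>C V v (U y) = inverse v *\<^sub>C v' *\<^sub>C V v y" by simp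
  then have "V v (U y) = V v (a *\<^sub>C y)"
    using nz by (simp add: scaleC_scaleC cblinfun_scaleC_right a_def divide_inverse mult.commute)
  then have Uy: "U y = a *\<^sub>C y" by (metis unitaryD(1)[OF V_props(2)[OF s(1)]])
  have "upow U (k2 - k1) y = y" using upow_eigen[OF U(1) Uy a0(2), of "k2 - k1"] am by simp
  then obtain c where "y = c *\<^sub>C \<Omega>" using ergodic_vectorD(4)[OF ergodic_m] by blast
  then have "U y = y" by (simp add: cblinfun_scaleC_right U(2))
  then have "(a - 1) *\<^sub>C y = 0" by (simp add: Uy scaleC_diff_left)
  then have "a = 1" using y0 by simp
  then show ?thesis by (simp add: ij v' w')
qed

text \<open>Each target is a unit eigenvector for the product of its two eigenvalues, and distinct
  resonant pairs have distinct products.\<close>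

lemma target_orthonormal: "orthonormal_on (resonance_set U k1 k2) target"
  unfolding orthonormal_on_def
proof (intro ballI)
  fix i j assume i: "i \<in> resonance_set U k1 k2" and j: "j \<in> resonance_set U k1 k2"
  have ev: "U (target i) = (fst i * snd i) *\<^sub>C target i" if "i \<in> resonance_set U k1 k2" for i
  proof -
    have s: "fst i \<in> point_spectrum U" "snd i \<in> point_spectrum U" using resonance_setD[OF that] by auto
    show ?thesis
      by (simp add: target_def V_eigen(1)[OF s(1)] W_eigen(2)[OF s(2)] cblinfun_scaleC_right scaleC_scaleC)
  qed
  have "norm (target i) = 1"
    using resonance_setD[OF i] by (simp add: target_def unitaryD(4)[OF V_props(2)] W_eigen(1))
  moreover have "cinner (target i) (target j) = 0" if "i \<noteq> j"
    using eigenvectors_orthogonal[OF U(1) ev[OF i] ev[OF j]] resonance_product_inj[OF i j] that by blast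
  ultimately show "cinner (target i) (target j) = (if i = j then 1 else 0)" by (auto simp: cinner_self)
qed

lemma R_add: "R (\<xi> + \<eta>) = R \<xi> + R \<eta>" and R_scaleC: "R (c *\<^sub>C \<xi>) = c *\<^sub>C R \<xi>"
  and norm_R: "norm (R \<xi>) \<le> norm \<xi>"
  unfolding R_eq
  by (rule orthonormal_series(3)[OF source_orthonormal target_orthonormal]
      orthonormal_series(4)[OF source_orthonormal target_orthonormal]
      orthonormal_series(2)[OF source_orthonormal target_orthonormal])+

lemma R_eq_0: "(\<And>i. i \<in> resonance_set U k1 k2 \<Longrightarrow> cinner \<xi> (source i) = 0) \<Longrightarrow> R \<xi> = 0"
  unfolding R_eq by (simp cong: infsum_cong)

lemma R_V_W:
  assumes v: "v \<in> point_spectrum U" and w: "w \<in> point_spectrum U"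
  shows "R (tens (V v \<Omega>) (W w \<Omega>)) = (if v powi k1 * w powi k2 = 1 then V v (W w \<Omega>) else 0)"
proof -
  have c: "cinner (tens (V v \<Omega>) (W w \<Omega>)) (source i) = (if i = (v, w) then 1 else 0)"
    if "i \<in> resonance_set U k1 k2" for i
    using resonance_setD[OF that] v w
    by (auto simp: source_def tensorD(5)[OF tens] V_orthonormal W_orthonormal prod_eq_iff)
  show ?thesis
  proof (cases "(v, w) \<in> resonance_set U k1 k2")
    case True
    have "R (tens (V v \<Omega>) (W w \<Omega>)) = (\<Sum>\<^sub>\<infinity>i\<in>{(v, w)}. target (v, w))"
      unfolding R_eq by (rule infsum_cong_neutral) (use True c in auto)
    then show ?thesis using resonance_setD[OF True] by (simp add: target_def)
  next
    case False
    have "R (tens (V v \<Omega>) (W w \<Omega>)) = 0" by (rule R_eq_0) (use False c in auto)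
    then show ?thesis using False v w by (auto simp: resonance_set_def)
  qed
qed

text \<open>On an eigenvector \<eta> for \<open>w\<close> the average is geometric with ratio
  \<open>v powi k1 * w powi k2\<close>, and the limit survives exactly under the resonance
  condition. On \<eta> orthogonal to all eigenvectors the limit is \<open>0\<close>, by an orbit
  relation that relies on \<open>k2 \<noteq> 0\<close>.\<close>

lemma average_V:
  assumes v: "v \<in> point_spectrum U"
  shows "cesaro (\<lambda>n. (v powi (int n * k1)) *\<^sub>C V v (upow U (int n * k2) \<eta>)) \<longlonglongrightarrow> R (tens (V v \<Omega>) \<eta>)"
proof (rule eigen_decomposition_convergence[where U = U and K = 1
      and f = "\<lambda>N \<eta>. cesaro (\<lambda>n. (v powi (int n * k1)) *\<^sub>C V v (upow U (int n * k2) \<eta>)) N"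
      and g = "\<lambda>\<eta>. R (tens (V v \<Omega>) \<eta>)"])
  note nv = V_eigen(4)[OF v]
  let ?f = "\<lambda>n \<eta>. (v powi (int n * k1)) *\<^sub>C V v (upow U (int n * k2) \<eta>)"
  show "cesaro (\<lambda>n. ?f n (x + y)) N = cesaro (\<lambda>n. ?f n x) N + cesaro (\<lambda>n. ?f n y) N" for N x y
    by (simp add: cblinfun_add_right scaleC_add_right cesaro_add)
  show "cesaro (\<lambda>n. ?f n (c *\<^sub>C x)) N = c *\<^sub>C cesaro (\<lambda>n. ?f n x) N" for N c x
    unfolding cesaro_scaleC[symmetric] by (simp add: cblinfun_scaleC_right scaleC_scaleC mult.commute)
  show "norm (cesaro (\<lambda>n. ?f n x) N) \<le> 1 * norm x" for N x
    by (rule norm_cesaro_le)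
      (simp_all add: norm_scaleC norm_power_int nv unitaryD(4)[OF V_props(2)[OF v]] U(1))
  show "R (tens (V v \<Omega>) (x + y)) = R (tens (V v \<Omega>) x) + R (tens (V v \<Omega>) y)" for x y
    by (simp add: tensorD(2)[OF tens] R_add)
  show "R (tens (V v \<Omega>) (c *\<^sub>C x)) = c *\<^sub>C R (tens (V v \<Omega>) x)" for c x
    by (simp add: tensorD(4)[OF tens] R_scaleC)
  show "norm (R (tens (V v \<Omega>) x)) \<le> 1 * norm x" for x
    using norm_R[of "tens (V v \<Omega>) x"] by (simp add: norm_tensor[OF tens] V_eigen(2)[OF v])
  show "cesaro (\<lambda>n. ?f n e) \<longlonglongrightarrow> R (tens (V v \<Omega>) e)" if e: "U e = w *\<^sub>C e" for e w
  proof (cases "e = 0")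
    case True
    have "R (tens (V v \<Omega>) 0) = 0" using norm_R[of "tens (V v \<Omega>) 0"] by (simp add: norm_tensor[OF tens])
    then show ?thesis by (simp add: True cesaro_const_tendsto)
  next
    case False
    then have w: "w \<in> point_spectrum U" using e by (auto simp: point_spectrum_def)
    obtain c where c: "e = c *\<^sub>C W w \<Omega>"
      using W_props(3)[OF w] e by (auto simp: eigenspace_def)
    define z where "z = v powi k1 * w powi k2"
    have "?f n e = z ^ n *\<^sub>C (c *\<^sub>C V v (W w \<Omega>))" for n
    proof -
      have "v powi (int n * k1) * w powi (int n * k2) = z ^ n"
        by (simp add: z_def power_mult_distrib power_int_power' mult.commute[of "int n"])
      moreover have "?f n e = (v powi (int n * k1) * w powi (int n * k2)) *\<^sub>C V v e"
        by (simp add: upow_eigen[OF U(1) e W_eigen(3)[OF w]] cblinfun_scaleC_right scaleC_scaleC)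
      ultimately show ?thesis by (simp add: c cblinfun_scaleC_right)
    qed
    moreover have "cmod z = 1" by (simp add: z_def norm_mult norm_power_int nv W_eigen(3)[OF w])
    moreover have "R (tens (V v \<Omega>) e) = (if z = 1 then c *\<^sub>C V v (W w \<Omega>) else 0)"
      by (simp add: c tensorD(4)[OF tens] R_scaleC R_V_W[OF v w] z_def)
    ultimately show ?thesis using cesaro_power_tendsto[of z "c *\<^sub>C V v (W w \<Omega>)"] by simp
  qed
  show "cesaro (\<lambda>n. ?f n x) \<longlonglongrightarrow> R (tens (V v \<Omega>) x)" if x: "x \<in> eigen_orthogonal U" for x
  proof -
    have "R (tens (V v \<Omega>) x) = 0"
      by (rule R_eq_0)
        (use eigen_orthogonalD[OF x W_eigen(2)] in \<open>auto simp: source_def tensorD(5)[OF tens] dest!: resonance_setD\<close>)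
    moreover have "cesaro (\<lambda>n. ?f n x) \<longlonglongrightarrow> V v 0"
    proof -
      define u where "u = v powi k1"
      have u: "cmod u = 1" by (simp add: u_def norm_power_int nv)
      define T where "T = u *\<^sub>C upow U k2"
      have uu: "u * cnj u = 1" using u by (metis complex_norm_square of_real_1 one_power2)
      have T: "unitary T"
      proof (rule unitaryI)
        have Td: "T\<^sup>\<dagger> = cnj u *\<^sub>C upow U (- k2)" by (simp add: T_def cadjoint_scaleC upow_cadjoint[OF U(1)])
        have app: "T x = u *\<^sub>C upow U k2 x" "(T\<^sup>\<dagger>) x = cnj u *\<^sub>C upow U (- k2) x" for x
          unfolding Td by (simp_all add: T_def)
        show "(T\<^sup>\<dagger>) (T x) = x" "T ((T\<^sup>\<dagger>) x) = x" for x
          using uu by (simp_all add: app cblinfun_scaleC_right scaleC_scaleC upow_cancel[OF U(1)]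
              mult.commute)
      qed
      define \<xi> where "\<xi> n = (v powi (int n * k1)) *\<^sub>C upow U (int n * k2) x" for n
      have "\<xi> (Suc n) = T (\<xi> n)" for n
      proof -
        have "v \<noteq> 0" using nv by auto
        then have "v powi (int (Suc n) * k1) = u * v powi (int n * k1)"
          by (simp add: u_def power_int_add[symmetric] distrib_right)
        moreover have "upow U (int (Suc n) * k2) x = upow U k2 (upow U (int n * k2) x)"
          by (simp add: upow_add[OF U(1), symmetric] distrib_right)
        ultimately show ?thesis by (simp add: \<xi>_def T_def cblinfun_scaleC_right scaleC_scaleC mult.commute)
      qed
      then obtain z where z: "cesaro \<xi> \<longlonglongrightarrow> z" "T z = z"
        using mean_ergodic_unitary[OF T, of \<xi>] by metis
      have zo: "z \<in> eigen_orthogonal U" unfolding eigen_orthogonal_def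
      proof (intro CollectI allI impI)
        fix e w assume e: "U e = w *\<^sub>C e"
        have "cinner (\<xi> n) e = 0" for n
          using eigen_orthogonalD[OF upow_eigen_orthogonal[OF U(1) x] e] by (simp add: \<xi>_def cinner_scaleC_left)
        then have "cinner (cesaro \<xi> N) e = 0" for N
          by (simp add: cesaro_cinner_left[symmetric]) (simp add: cesaro_def)
        moreover have "(\<lambda>N. cinner (cesaro \<xi> N) e) \<longlonglongrightarrow> cinner z e" by (intro tendsto_intros z)
        ultimately show "cinner z e = 0" by (simp add: LIMSEQ_const_iff)
      qed
      \<comment> \<open>That \<open>z\<close> is fixed by \<open>T\<close> is a two-term linear
        relation between \<open>z\<close> and its image under \<open>upow U k2\<close>.\<close>
      have "(\<Sum>j\<in>{0, 1}. (if j = 0 then - 1 else u) *\<^sub>C upow U (int j * k2) z) = 0"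
        using z(2) by (simp add: T_def scaleC_minus_left)
      then have "z = 0"
        by (rule orbit_relation[OF U(1) zo k(2), of "\<lambda>j. if j = 0 then - 1 else u" "{0, 1}" 0]) simp_all
      then have "(\<lambda>N. V v (cesaro \<xi> N)) \<longlonglongrightarrow> V v 0" using z(1) by (intro tendsto_intros) simp
      moreover have "(\<lambda>N. V v (cesaro \<xi> N)) = cesaro (\<lambda>n. ?f n x)"
        by (rule ext) (simp add: cesaro_cblinfun[symmetric] \<xi>_def cblinfun_scaleC_right)
      ultimately show ?thesis by simp
    qed
    ultimately show ?thesis by simp
  qed
qed

text \<open>On an eigenvector, a multiple of \<open>V v \<Omega>\<close>, the operator
  \<open>B\<close> commutes with \<open>V v\<close>, and the powers of \<open>v\<close> combine
  because \<open>- (k2 - k1) + k2 = k1\<close>; this is \<open>average_V\<close> at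
  \<open>B \<Omega>\<close>. On the orthogonal complement both sides tend to
  \<open>0\<close>.\<close>

lemma average_commutant:
  assumes B: "B \<in> commutant (range \<pi>)"
  shows "cesaro (\<lambda>n. upow U (int n * k2) (B (upow U (- (int n * (k2 - k1))) x))) \<longlonglongrightarrow> R (tens x (B \<Omega>))"
proof -
  define m where "m = k2 - k1"
  define X where "X n x = upow U (int n * k2) (B (upow U (- (int n * m)) x))" for n x
  have X_le: "norm (X n x) \<le> norm B * norm x" for n x
    using cblinfun_apply_le[of B "upow U (- (int n * m)) x"] by (simp add: X_def U(1))
  have "cesaro (\<lambda>n. X n x) \<longlonglongrightarrow> R (tens x (B \<Omega>))"
  proof (rule eigen_decomposition_convergence[where U = U and K = "norm B"
        and f = "\<lambda>N x. cesaro (\<lambda>n. X n x) N" and g = "\<lambda>x. R (tens x (B \<Omega>))"])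
    show "cesaro (\<lambda>n. X n (x + y)) N = cesaro (\<lambda>n. X n x) N + cesaro (\<lambda>n. X n y) N" for N x y
      by (simp add: X_def cblinfun_add_right cesaro_add)
    show "cesaro (\<lambda>n. X n (c *\<^sub>C x)) N = c *\<^sub>C cesaro (\<lambda>n. X n x) N" for N c x
      by (simp add: X_def cblinfun_scaleC_right cesaro_scaleC)
    show "norm (cesaro (\<lambda>n. X n x) N) \<le> norm B * norm x" for N x
      by (rule norm_cesaro_le[OF X_le]) simp
    show "R (tens (x + y) (B \<Omega>)) = R (tens x (B \<Omega>)) + R (tens y (B \<Omega>))" for x y
      by (simp add: tensorD(1)[OF tens] R_add)
    show "R (tens (c *\<^sub>C x) (B \<Omega>)) = c *\<^sub>C R (tens x (B \<Omega>))" for c x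
      by (simp add: tensorD(3)[OF tens] R_scaleC)
    have nB: "norm (B \<Omega>) \<le> norm B" using cblinfun_apply_le[of B \<Omega>] by (simp add: norm_Omega)
    show "norm (R (tens x (B \<Omega>))) \<le> norm B * norm x" for x
      using norm_R[of "tens x (B \<Omega>)"] mult_left_mono[OF nB, of "norm x"]
      by (simp add: norm_tensor[OF tens] mult.commute)
    show "cesaro (\<lambda>n. X n e) \<longlonglongrightarrow> R (tens e (B \<Omega>))" if e: "U e = v *\<^sub>C e" for e v
    proof (cases "e = 0")
      case True
      have "R (tens 0 (B \<Omega>)) = 0" using norm_R[of "tens 0 (B \<Omega>)"] by (simp add: norm_tensor[OF tens])
      then show ?thesis by (simp add: True X_def cesaro_const_tendsto)
    next
      case False
      then have v: "v \<in> point_spectrum U" using e by (auto simp: point_spectrum_def)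
      have v0: "v \<noteq> 0" using V_eigen(4)[OF v] by auto
      obtain c where c: "e = c *\<^sub>C V v \<Omega>"
        using V_props(3)[OF v] e by (auto simp: eigenspace_def)
      let ?g = "\<lambda>n. (v powi (int n * k1)) *\<^sub>C V v (upow U (int n * k2) (B \<Omega>))"
      have "X n e = c *\<^sub>C ?g n" for n
      proof -
        have BV: "B (V v \<Omega>) = V v (B \<Omega>)"
          using commutantD[OF V_props(1)[OF v] B] by simp
        have "v powi (- (int n * m)) * v powi (int n * k2) = v powi (int n * k1)"
          using v0 by (simp add: power_int_add[symmetric] m_def algebra_simps)
        moreover have "X n e = (v powi (- (int n * m)) * v powi (int n * k2)) *\<^sub>C c *\<^sub>C V v (upow U (int n * k2) (B \<Omega>))"
          unfolding X_def c
          by (simp add: cblinfun_scaleC_right upow_eigen[OF U(1) V_eigen(3)[OF v] V_eigen(4)[OF v]] BV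
              upow_V[OF v] scaleC_scaleC ac_simps)
        ultimately show ?thesis by (simp add: scaleC_scaleC mult.commute)
      qed
      then have "cesaro (\<lambda>n. X n e) = (\<lambda>N. c *\<^sub>C cesaro ?g N)"
        by (simp add: fun_eq_iff cesaro_scaleC)
      moreover have "(\<lambda>N. c *\<^sub>C cesaro ?g N) \<longlonglongrightarrow> c *\<^sub>C R (tens (V v \<Omega>) (B \<Omega>))"
        by (intro tendsto_intros average_V v)
      ultimately show ?thesis by (simp add: c tensorD(3)[OF tens] R_scaleC)
    qed
    show "cesaro (\<lambda>n. X n x) \<longlonglongrightarrow> R (tens x (B \<Omega>))" if x: "x \<in> eigen_orthogonal U" for x
    proof -
      have "R (tens x (B \<Omega>)) = 0"
        by (rule R_eq_0)
          (use eigen_orthogonalD[OF x V_eigen(3)] in \<open>auto simp: source_def tensorD(5)[OF tens] dest!: resonance_setD\<close>)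
      moreover have "cesaro (\<lambda>n. X n x) \<longlonglongrightarrow> 0"
      proof (rule van_der_Corput[OF X_le])
        define \<xi> where "\<xi> h = tens (upow U (int h * k1) x) (upow U (int h * k2) (B \<Omega>))" for h
        show "cesaro \<xi> \<longlonglongrightarrow> 0"
          unfolding \<xi>_def by (rule tensor_average_tendsto_0[OF tens U(1) k(1) x])
        fix h h'
        define C where "C h = upow_conj U (int h * k2) B" for h
        define x' where "x' h = upow U (int h * k1) x" for h
        have C: "C h \<in> commutant (range \<pi>)" for h unfolding C_def by (rule upow_conj_commutant_pi[OF B])
        \<comment> \<open>A shift by \<open>h\<close> is absorbed by replacing \<open>B\<close> with
          a conjugate and \<open>x\<close> with \<open>x' h\<close>: the inner exponent is
          \<open>h * k2 - h * m = h * k1\<close>.\<close>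
        have Xnh: "X (n + h) x = upow U (int n * k2) (C h (upow U (- (int n * m)) (x' h)))" for n h
          by (simp add: X_def C_def x'_def upow_add[OF U(1), symmetric] m_def algebra_simps)
        \<comment> \<open>With the outer unitaries cancelled, the correlation is a matrix
          coefficient of conjugates of \<open>D\<close> under powers of \<open>upow U m\<close>, to
          which the operator ergodic theorem applies.\<close>
        define D where "D = (C h')\<^sup>\<dagger> o\<^sub>C C h"
        have D: "D \<in> commutant (range \<pi>)"
          unfolding D_def by (intro commutant_compose commutant_pi_cadjoint C)
        have conj: "upow_conj (upow U m) j T = upow_conj U (j * m) T" for j T
          by (rule cblinfun_eqI) (simp add: upow_upow[OF U(1)])
        have "cinner (X (n + h) x) (X (n + h') x) = cinner (upow_conj (upow U m) (int n) D (x' h)) (x' h')" for n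
          unfolding Xnh cinner_upow[OF U(1)] conj upow_conj_apply cinner_upow_left[OF U(1)] D_def
          by (simp add: cinner_adj_right[symmetric] upow_cancel[OF U(1)])
        then have "cesaro (\<lambda>n. cinner (X (n + h) x) (X (n + h') x))
            = (\<lambda>N. cinner (cesaro (\<lambda>n. upow_conj (upow U m) (int n) D (x' h)) N) (x' h'))"
          by (simp add: fun_eq_iff cesaro_cinner_left)
        also have "\<dots> \<longlonglongrightarrow> cinner (cinner (D \<Omega>) \<Omega> *\<^sub>C x' h) (x' h')"
        proof (intro tendsto_intros strong_operator_ergodic)
          show "ergodic_vector (upow U m) \<Omega>" using ergodic_m by (simp add: m_def)
          show "upow_conj (upow U m) j T \<in> commutant (range \<pi>)" if "T \<in> commutant (range \<pi>)" for j T
            unfolding conj by (rule upow_conj_commutant_pi[OF that])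
        qed (rule bicommutant_dense, rule D)
        also have "cinner (cinner (D \<Omega>) \<Omega> *\<^sub>C x' h) (x' h') = cinner (\<xi> h) (\<xi> h')"
        proof -
          have "cinner (D \<Omega>) \<Omega> = cinner (upow U (int h * k2) (B \<Omega>)) (upow U (int h' * k2) (B \<Omega>))"
            by (simp add: D_def cinner_adj_right[symmetric] C_def cinner_adj_left)
          then show ?thesis by (simp add: \<xi>_def x'_def tensorD(5)[OF tens] cinner_scaleC_left mult.commute)
        qed
        finally show "cesaro (\<lambda>n. cinner (X (n + h) x) (X (n + h') x)) \<longlonglongrightarrow> cinner (\<xi> h) (\<xi> h')" .
      qed
      ultimately show ?thesis by simp
    qed
  qed
  then show ?thesis by (simp add: X_def m_def)
qed

text \<open>The estimate by \<open>norm (\<pi> a)\<close> times the norm of \<eta> is uniform in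
  \<open>n\<close>, so \<eta> may be taken in the dense set \<open>M'\<Omega>\<close>, where the
  sequence is that of \<open>average_commutant\<close> at \<open>\<pi> a \<Omega>\<close>.\<close>

lemma average_pi:
  "cesaro (\<lambda>n. \<pi> (int_iterate \<alpha> (int n * k1) a) (upow U (int n * k2) \<eta>)) \<longlonglongrightarrow> R (tens (\<pi> a \<Omega>) \<eta>)"
proof (rule dense_convergence[where K = "norm (\<pi> a)"
      and f = "\<lambda>N \<eta>. cesaro (\<lambda>n. \<pi> (int_iterate \<alpha> (int n * k1) a) (upow U (int n * k2) \<eta>)) N"
      and g = "\<lambda>\<eta>. R (tens (\<pi> a \<Omega>) \<eta>)", OF _ _ separating])
  have le: "norm (\<pi> (int_iterate \<alpha> j a) y) \<le> norm (\<pi> a) * norm y" for j y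
    using cblinfun_apply_le[of "\<pi> a" "upow U (- j) y"]
    by (simp add: upow_conj_pi[symmetric] U(1))
  show "norm (cesaro (\<lambda>n. \<pi> (int_iterate \<alpha> (int n * k1) a) (upow U (int n * k2) x)) N
      - cesaro (\<lambda>n. \<pi> (int_iterate \<alpha> (int n * k1) a) (upow U (int n * k2) y)) N)
      \<le> norm (\<pi> a) * norm (x - y)" for N x y
    unfolding cesaro_diff[symmetric] cblinfun_diff_right[symmetric]
    by (rule norm_cesaro_le) (use le[of _ "upow U _ (x - y)"] in \<open>simp_all add: U(1)\<close>)
  show "norm (R (tens (\<pi> a \<Omega>) x) - R (tens (\<pi> a \<Omega>) y)) \<le> norm (\<pi> a) * norm (x - y)" for x y
  proof -
    have "R (tens (\<pi> a \<Omega>) x) = R (tens (\<pi> a \<Omega>) (x - y)) + R (tens (\<pi> a \<Omega>) y)"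
      unfolding R_add[symmetric] tensorD(2)[OF tens, symmetric] by simp
    then have "norm (R (tens (\<pi> a \<Omega>) x) - R (tens (\<pi> a \<Omega>) y)) \<le> norm (\<pi> a \<Omega>) * norm (x - y)"
      using norm_R[of "tens (\<pi> a \<Omega>) (x - y)"] by (simp add: norm_tensor[OF tens])
    also have "\<dots> \<le> norm (\<pi> a) * norm (x - y)"
      using cblinfun_apply_le[of "\<pi> a" \<Omega>] by (intro mult_right_mono) (simp_all add: norm_Omega)
    finally show ?thesis .
  qed
  fix \<eta> assume "\<eta> \<in> (\<lambda>B. cblinfun_apply B \<Omega>) ` commutant (range \<pi>)"
  then obtain B where B: "B \<in> commutant (range \<pi>)" "\<eta> = B \<Omega>" by blast
  have "\<pi> (int_iterate \<alpha> (int n * k1) a) (upow U (int n * k2) \<eta>)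
      = upow U (int n * k2) (B (upow U (- (int n * (k2 - k1))) (\<pi> a \<Omega>)))" for n
  proof -
    \<comment> \<open>The difference of the two exponents. Since \<open>U\<close> fixes \<Omega>,
      applying \<open>upow U j\<close> to \<open>B \<Omega>\<close> equals applying the conjugate of
      \<open>B\<close>, an element of the commutant that passes \<open>\<pi> a\<close>.\<close>
    define j where "j = int n * (k2 - k1)"
    have C: "upow_conj U j B \<in> commutant (range \<pi>)" by (rule upow_conj_commutant_pi[OF B(1)])
    have "\<pi> (int_iterate \<alpha> (int n * k1) a) (upow U (int n * k2) \<eta>)
        = upow U (int n * k1) (\<pi> a (upow U (- (int n * k1)) (upow U (int n * k2) \<eta>)))"
      by (simp add: upow_conj_pi[symmetric])
    also have "upow U (- (int n * k1)) (upow U (int n * k2) \<eta>) = upow_conj U j B \<Omega>"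
      by (simp add: upow_add[OF U(1), symmetric] j_def B(2) algebra_simps)
    also have "\<pi> a (upow_conj U j B \<Omega>) = upow_conj U j B (\<pi> a \<Omega>)" by (rule commutant_piD[OF C, symmetric])
    also have "upow U (int n * k1) (upow_conj U j B (\<pi> a \<Omega>)) = upow U (int n * k2) (B (upow U (- j) (\<pi> a \<Omega>)))"
      by (simp add: upow_add[OF U(1), symmetric] j_def algebra_simps)
    finally show ?thesis by (simp add: j_def)
  qed
  then show "cesaro (\<lambda>n. \<pi> (int_iterate \<alpha> (int n * k1) a) (upow U (int n * k2) \<eta>)) \<longlonglongrightarrow> R (tens (\<pi> a \<Omega>) \<eta>)"
    using average_commutant[OF B(1), of "\<pi> a \<Omega>"] by (simp only: B(2))
qed

end

theorem corollary4p3: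
  fixes \<alpha> :: "'a::unital_cstar_algebra \<Rightarrow> 'a"
    and \<omega> :: "'a cdual"
    and s :: "'a cbidual"
    and \<pi> :: "'a \<Rightarrow> 'h::complex_hilbert \<Rightarrow>\<^sub>C\<^sub>L 'h"
    and U :: "'h \<Rightarrow>\<^sub>C\<^sub>L 'h"
    and \<Omega> :: 'h
    and tens :: "'h \<Rightarrow> 'h \<Rightarrow> 'k::complex_hilbert"
    and k1 k2 :: int
    and A0 A1 A2 :: 'a
  assumes "cstar_dynamical_system \<alpha> \<omega>"
    and "support_projection \<omega> s"
    and "s \<in> bidual_centre"
    and "k1 \<noteq> 0" and "k2 \<noteq> 0" and "k1 \<noteq> k2"
    and "ergodic (int_iterate \<alpha> (k2 - k1)) \<omega>"
    and "covariant_GNS \<alpha> \<omega> \<pi> U \<Omega>"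
    and "hilbert_tensor_product tens"
  shows "(\<lambda>N. (1 / of_nat N) *
            (\<Sum>n<N. \<omega> (A0 * int_iterate \<alpha> (int n * k1) A1 * int_iterate \<alpha> (int n * k2) A2)))
         \<longlonglongrightarrow>
         cinner (resonance_isometry \<pi> U \<Omega> tens k1 k2 (tens (\<pi> A1 \<Omega>) (\<pi> A2 \<Omega>)))
                (\<pi> (A0\<^sup>\<star>) \<Omega>)"
proof -
  interpret cyclic_representation \<omega> \<pi> \<Omega>
    by unfold_locales (use assms(8) in \<open>auto simp: covariant_GNS_def\<close>)
  interpret covariant_representation \<omega> \<pi> \<Omega> \<alpha> U
  proof unfold_locales
    show "closure ((\<lambda>B. cblinfun_apply B \<Omega>) ` commutant (range \<pi>)) = UNIV"
      by (rule central_support_imp_separating[OF assms(2,3)])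
  qed (use assms(1,8) in \<open>auto simp: covariant_GNS_def cstar_dynamical_system_def invariant_states_def\<close>)
  interpret resonance \<omega> \<pi> \<Omega> \<alpha> U tens k1 k2
    by unfold_locales (use assms(4,5,9) ergodic_imp_ergodic_vector[OF assms(7)] in auto)
  let ?x = "\<lambda>n. \<pi> (int_iterate \<alpha> (int n * k1) A1) (upow U (int n * k2) (\<pi> A2 \<Omega>))"
  \<comment> \<open>Covariance turns the outer iterate on \<open>A2\<close> into a power of
    \<open>U\<close>, because \<Omega> is fixed; \<open>A0\<close> goes to the right as its
    adjoint.\<close>
  have "\<omega> (A0 * int_iterate \<alpha> (int n * k1) A1 * int_iterate \<alpha> (int n * k2) A2)
      = cinner (?x n) (\<pi> (A0\<^sup>\<star>) \<Omega>)" for n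
    by (simp add: omega_eq pi_mult upow_pi pi_adj_right star_star)
  then have "(1 / of_nat N) * (\<Sum>n<N. \<omega> (A0 * int_iterate \<alpha> (int n * k1) A1 * int_iterate \<alpha> (int n * k2) A2))
      = cinner (cesaro ?x N) (\<pi> (A0\<^sup>\<star>) \<Omega>)" for N
    unfolding cesaro_cinner_left[symmetric] by (simp add: cesaro_def scaleR_conv_of_real)
  then show ?thesis by (simp only:) (intro tendsto_intros average_pi)
qed

end
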